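(* Let $\alpha\in\mathbb{C}$ and consider the second Painlevé equation (P$_{\rm II}$): $dx/dz=2y^3+yz+\alpha$, $dy/dz=x$. Define coordinates $(u^+,w^+)$ and $(u^-,w^-)$ by $$u^\pm=xy^2\pm y^4\pm\tfrac12zy^2+\bigl(\tfrac12\pm\alpha\bigr)y,\qquad w^\pm=y^{-1}. \qquad( * )$$ (i) The space of initial conditions $E(z)$ for (P$_{\rm II}$) is given by $\mathbb{C}^2_{(x,y)}\cup\mathbb{C}^2_{(u^+,w^+)}\cup\mathbb{C}^2_{(u^-,w^-)}$ glued by $( * )$. (ii) The transformation $( * )$ is symplectic (for fixed $z$, $dy\wedge dx=du^\pm\wedge dw^\pm$), and (P$_{\rm II}$) written in $(u^+,w^+)$ and in $(u^-,w^-)$ are also polynomial Hamiltonian systems. (iii) Consider a Hamiltonian system $dx/dz=f(x,y,z)$, $dy/dz=g(x,y,z)$, where $f$ and $g$ are polynomials in $x$ and $y$ (with coefficients depending on $z$). If it is also expressed as a polynomial Hamiltonian system in the $(u^+,w^+)$- and in the $(u^-,w^-)$-coordinates, then it is (P$_{\rm II}$).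
   Context: A manifold $E(z)$ parameterized by $z\in\mathbb{C}$ is called the space of initial conditions of a polynomial system (with independent variable $z$) if every solution of the system gives a global holomorphic section of the fiber bundle $\mathcal{P}=\{(x,z): x\in E(z),\ z\in\mathbb{C}\}$ over $\mathbb{C}$. The independent variable $z$ is the same in all the charts; the gluings identify $\{y\neq0\}$ with $\{w^\pm\neq0\}$. Polynomial in the $(u^\pm,w^\pm)$-coordinates means polynomial in $u^\pm,w^\pm$. Hamiltonian is meant with respect to $dy\wedge dx$, resp. $du^\pm\wedge dw^\pm$. The parameter $\alpha$ in $( * )$ is the same as that in (P$_{\rm II}$). *)

theory Defs
  imports "HOL-Analysis.Analysis"
begin

section \<open>Complex manifolds and holomorphic maps\<close>

text \<open>Only the spaces built from \<^typ>\<open>complex\<close> by pairing are used as models, so that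
  \<^typ>\<open>complex \<times> complex\<close> serves as the complex plane of dimension two and
  \<^typ>\<open>(complex \<times> complex) \<times> complex\<close> as the complex space of dimension three.\<close>

class complex_space = real_normed_vector +
  fixes cscale :: "complex \<Rightarrow> 'a \<Rightarrow> 'a"
  assumes cscale_of_real: "cscale (of_real r) v = r *\<^sub>R v"
    and cscale_add_left: "cscale (c + d) v = cscale c v + cscale d v"
    and cscale_add_right: "cscale c (v + w) = cscale c v + cscale c w"
    and cscale_cscale: "cscale c (cscale d v) = cscale (c * d) v"

instantiation complex :: complex_space
begin
definition cscale_complex :: "complex \<Rightarrow> complex \<Rightarrow> complex"
  where "cscale_complex c v = c * v"
instance
  by standard (auto simp: cscale_complex_def algebra_simps scaleR_conv_of_real)
end

instantiation prod :: (complex_space, complex_space) complex_space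
begin
definition cscale_prod :: "complex \<Rightarrow> 'a \<times> 'b \<Rightarrow> 'a \<times> 'b"
  where "cscale_prod c v = (cscale c (fst v), cscale c (snd v))"
instance
  by standard
    (auto simp: cscale_prod_def cscale_of_real cscale_add_left cscale_add_right cscale_cscale
      prod_eq_iff)
end

definition holomorphic_map_on :: "('m::complex_space \<Rightarrow> 'n::complex_space) \<Rightarrow> 'm set \<Rightarrow> bool"
  where "holomorphic_map_on h U \<longleftrightarrow> open U \<and>
    (\<forall>p\<in>U. \<exists>D. (h has_derivative D) (at p) \<and> (\<forall>c v. D (cscale c v) = cscale c (D v)))"

text \<open>Charts are given by their inverses: a chart with index \<open>i\<close> is a parametrization \<open>\<psi> i\<close>
  defined on the whole model space.\<close>

definition complex_manifold :: "'p topology \<Rightarrow> ('i \<Rightarrow> 'm::complex_space \<Rightarrow> 'p) \<Rightarrow> bool"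
  where "complex_manifold X \<psi> \<longleftrightarrow>
    Hausdorff_space X \<and> second_countable X \<and>
    topspace X = (\<Union>i. range (\<psi> i)) \<and>
    (\<forall>i. openin X (range (\<psi> i)) \<and> embedding_map euclidean X (\<psi> i)) \<and>
    (\<forall>i j. holomorphic_map_on (\<lambda>p. inv (\<psi> j) (\<psi> i p)) {p. \<psi> i p \<in> range (\<psi> j)})"

definition holomorphic_into ::
    "('k::complex_space \<Rightarrow> 'p) \<Rightarrow> ('i \<Rightarrow> 'm::complex_space \<Rightarrow> 'p) \<Rightarrow> bool"
  where "holomorphic_into s \<psi> \<longleftrightarrow>
    (\<forall>t0. \<exists>N i h. t0 \<in> N \<and> holomorphic_map_on h N \<and> (\<forall>t\<in>N. s t = \<psi> i (h t)))"

text \<open>The quotient topology of the disjoint union of the model spaces under the maps \<open>\<psi> i\<close>.\<close>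

definition glued_topology :: "('i \<Rightarrow> 'm::topological_space \<Rightarrow> 'p) \<Rightarrow> 'p topology"
  where "glued_topology \<psi> =
    topology (\<lambda>U. U \<subseteq> (\<Union>i. range (\<psi> i)) \<and> (\<forall>i. open (\<psi> i -` U)))"

lemma openin_glued_topology:
  "openin (glued_topology \<psi>) U \<longleftrightarrow>
    U \<subseteq> (\<Union>i. range (\<psi> i)) \<and> (\<forall>i. open (\<psi> i -` U))"
proof -
  have "istopology (\<lambda>U. U \<subseteq> (\<Union>i. range (\<psi> i)) \<and> (\<forall>i. open (\<psi> i -` U)))"
    unfolding istopology_def by (auto simp: vimage_Union)
  then show ?thesis
    by (simp add: glued_topology_def topology_inverse')
qed

lemma topspace_glued_topology: "topspace (glued_topology \<psi>) = (\<Union>i. range (\<psi> i))"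
proof
  show "topspace (glued_topology \<psi>) \<subseteq> (\<Union>i. range (\<psi> i))"
    by (auto simp: topspace_def openin_glued_topology)
  have "\<psi> i -` (\<Union>i. range (\<psi> i)) = UNIV" for i
    by auto
  then have "openin (glued_topology \<psi>) (\<Union>i. range (\<psi> i))"
    by (simp add: openin_glued_topology)
  then show "(\<Union>i. range (\<psi> i)) \<subseteq> topspace (glued_topology \<psi>)"
    by (rule openin_subset)
qed


section \<open>Spaces of initial conditions\<close>

text \<open>A planar system \<open>dx/dz = f x y z\<close>, \<open>dy/dz = g x y z\<close>.\<close>

type_synonym rhs = "complex \<Rightarrow> complex \<Rightarrow> complex \<Rightarrow> complex"

definition solution_on ::
    "rhs \<Rightarrow> rhs \<Rightarrow> complex set \<Rightarrow> (complex \<Rightarrow> complex) \<Rightarrow> (complex \<Rightarrow> complex) \<Rightarrow> bool"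
  where "solution_on f g U x y \<longleftrightarrow>
    (\<forall>z\<in>U. (x has_field_derivative f (x z) (y z) z) (at z) \<and>
            (y has_field_derivative g (x z) (y z) z) (at z))"

text \<open>A family of surfaces \<open>E z\<close> is given by parametrizations \<open>\<psi> z i\<close>. The total space
  consists of the pairs \<open>(e, z)\<close> with \<open>e\<close> in \<open>E z\<close>, and \<open>z\<close> itself is the third coordinate
  in all of its charts.\<close>

definition total_chart :: "(complex \<Rightarrow> 'i \<Rightarrow> complex \<times> complex \<Rightarrow> 'p) \<Rightarrow>
    'i \<Rightarrow> (complex \<times> complex) \<times> complex \<Rightarrow> 'p \<times> complex"
  where "total_chart \<psi> i q = (\<psi> (snd q) i (fst q), snd q)"

definition fiber_bundle ::
    "('p \<times> complex) topology \<Rightarrow> (complex \<Rightarrow> 'p topology) \<Rightarrow> bool"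
  where "fiber_bundle T E \<longleftrightarrow>
    topspace T = {(e, z). e \<in> topspace (E z)} \<and>
    continuous_map T euclidean snd \<and>
    (\<forall>z0. \<exists>D \<Theta>. open D \<and> z0 \<in> D \<and>
       homeomorphic_map (subtopology T {q. snd q \<in> D})
         (prod_topology (E z0) (top_of_set D)) \<Theta> \<and>
       (\<forall>q\<in>topspace T. snd q \<in> D \<longrightarrow> snd (\<Theta> q) = snd q))"

text \<open>The index \<open>i0\<close> is that of the chart in whose coordinates \<open>(x, y)\<close> the system is written.\<close>

definition space_of_initial_conditions ::
    "rhs \<Rightarrow> rhs \<Rightarrow> 'i \<Rightarrow> (complex \<Rightarrow> 'i \<Rightarrow> complex \<times> complex \<Rightarrow> 'p) \<Rightarrow> bool"
  where "space_of_initial_conditions f g i0 \<psi> \<longleftrightarrow>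
    (\<forall>z. complex_manifold (glued_topology (\<psi> z)) (\<psi> z)) \<and>
    complex_manifold (glued_topology (total_chart \<psi>)) (total_chart \<psi>) \<and>
    fiber_bundle (glued_topology (total_chart \<psi>)) (\<lambda>z. glued_topology (\<psi> z)) \<and>
    (\<forall>U x y. open U \<and> connected U \<and> U \<noteq> {} \<and> solution_on f g U x y \<longrightarrow>
      (\<exists>s. holomorphic_into s (total_chart \<psi>) \<and> (\<forall>z. snd (s z) = z) \<and>
           (\<forall>z\<in>U. s z = total_chart \<psi> i0 ((x z, y z), z))))"


section \<open>The second Painleve equation and its charts\<close>

definition PII_x :: "complex \<Rightarrow> rhs"
  where "PII_x \<alpha> x y z = 2 * y^3 + y * z + \<alpha>"

definition PII_y :: rhs
  where "PII_y x y z = x"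

datatype pm = Plus | Minus

fun pm_val :: "pm \<Rightarrow> complex"
  where "pm_val Plus = 1" | "pm_val Minus = -1"

definition coord_u :: "complex \<Rightarrow> pm \<Rightarrow> complex \<Rightarrow> complex \<times> complex \<Rightarrow> complex"
  where "coord_u \<alpha> \<sigma> z = (\<lambda>(x, y). x * y^2 + pm_val \<sigma> * y^4 + pm_val \<sigma> * (1/2) * z * y^2
    + (1/2 + pm_val \<sigma> * \<alpha>) * y)"

definition coord_w :: "complex \<times> complex \<Rightarrow> complex"
  where "coord_w = (\<lambda>(x, y). inverse y)"

datatype chart = XY | UW pm

type_synonym chart_point = "chart \<times> complex \<times> complex"

inductive glue :: "complex \<Rightarrow> complex \<Rightarrow> chart_point \<Rightarrow> chart_point \<Rightarrow> bool"
  for \<alpha> z :: complex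
  where "y \<noteq> 0 \<Longrightarrow> glue \<alpha> z (XY, (x, y)) (UW \<sigma>, (coord_u \<alpha> \<sigma> z (x, y), coord_w (x, y)))"

text \<open>A point of \<open>E z\<close> is a class of chart points under the equivalence relation generated
  by the gluing; \<open>PII_chart \<alpha> z i\<close> sends a point of the chart \<open>i\<close> to its class.\<close>

definition PII_chart ::
    "complex \<Rightarrow> complex \<Rightarrow> chart \<Rightarrow> complex \<times> complex \<Rightarrow> chart_point set"
  where "PII_chart \<alpha> z i p = {q. equivclp (glue \<alpha> z) (i, p) q}"


section \<open>Symplectic forms and Hamiltonian systems\<close>

text \<open>The value of \<open>da \<and> db\<close> at the point \<open>p\<close> on the tangent vectors \<open>v\<close>, \<open>v'\<close>.\<close>

definition wedge_d :: "(complex \<times> complex \<Rightarrow> complex) \<Rightarrow> (complex \<times> complex \<Rightarrow> complex) \<Rightarrow>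
    complex \<times> complex \<Rightarrow> complex \<times> complex \<Rightarrow> complex \<times> complex \<Rightarrow> complex"
  where "wedge_d a b p v v' =
    frechet_derivative a (at p) v * frechet_derivative b (at p) v'
    - frechet_derivative a (at p) v' * frechet_derivative b (at p) v"

definition polynomial_rhs :: "complex set \<Rightarrow> rhs \<Rightarrow> bool"
  where "polynomial_rhs D F \<longleftrightarrow> (\<exists>n (c :: nat \<Rightarrow> nat \<Rightarrow> complex \<Rightarrow> complex).
    \<forall>z\<in>D. \<forall>a b. F a b z = (\<Sum>i\<le>n. \<Sum>j\<le>n. c i j z * a^i * b^j))"

text \<open>The system \<open>dq/dz = Q q p z\<close>, \<open>dp/dz = P q p z\<close>, Hamiltonian with respect to the form
  \<open>dq \<and> dp\<close>.\<close>

definition hamiltonian_system :: "complex set \<Rightarrow> rhs \<Rightarrow> rhs \<Rightarrow> bool"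
  where "hamiltonian_system D Q P \<longleftrightarrow> (\<exists>H :: rhs. \<forall>z\<in>D. \<forall>q p.
    ((\<lambda>t. H q t z) has_field_derivative Q q p z) (at p) \<and>
    ((\<lambda>t. H t p z) has_field_derivative - P q p z) (at q))"

definition polynomial_hamiltonian_system :: "complex set \<Rightarrow> rhs \<Rightarrow> rhs \<Rightarrow> bool"
  where "polynomial_hamiltonian_system D Q P \<longleftrightarrow>
    polynomial_rhs D Q \<and> polynomial_rhs D P \<and> hamiltonian_system D Q P"

text \<open>The change of variables depends on \<open>z\<close>, so rewriting a system includes the explicit
  \<open>z\<close>-derivative of the coordinates. Testing on all curves having the prescribed velocity at
  \<open>z\<close> is the chain rule, and it does not presuppose the existence of solutions when the
  coefficients are arbitrary functions of \<open>z\<close>.\<close>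

definition expressed_in_uw ::
    "complex \<Rightarrow> pm \<Rightarrow> complex set \<Rightarrow> rhs \<Rightarrow> rhs \<Rightarrow> rhs \<Rightarrow> rhs \<Rightarrow> bool"
  where "expressed_in_uw \<alpha> \<sigma> D f g F G \<longleftrightarrow>
    (\<forall>z\<in>D. \<forall>x y :: complex \<Rightarrow> complex. y z \<noteq> 0 \<and>
       (x has_field_derivative f (x z) (y z) z) (at z) \<and>
       (y has_field_derivative g (x z) (y z) z) (at z) \<longrightarrow>
       ((\<lambda>t. coord_u \<alpha> \<sigma> t (x t, y t)) has_field_derivative
          F (coord_u \<alpha> \<sigma> z (x z, y z)) (coord_w (x z, y z)) z) (at z) \<and>
       ((\<lambda>t. coord_w (x t, y t)) has_field_derivative
          G (coord_u \<alpha> \<sigma> z (x z, y z)) (coord_w (x z, y z)) z) (at z))"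

text \<open>In the \<open>(x, y)\<close>-plane the form is \<open>dy \<and> dx\<close>, hence \<open>y\<close> is the position and \<open>x\<close> the
  momentum.\<close>

definition polynomial_hamiltonian_xy :: "complex set \<Rightarrow> rhs \<Rightarrow> rhs \<Rightarrow> bool"
  where "polynomial_hamiltonian_xy D f g \<longleftrightarrow>
    polynomial_hamiltonian_system D (\<lambda>y x. g x y) (\<lambda>y x. f x y)"

definition polynomial_hamiltonian_uw ::
    "complex \<Rightarrow> pm \<Rightarrow> complex set \<Rightarrow> rhs \<Rightarrow> rhs \<Rightarrow> bool"
  where "polynomial_hamiltonian_uw \<alpha> \<sigma> D f g \<longleftrightarrow>
    (\<exists>F G. expressed_in_uw \<alpha> \<sigma> D f g F G \<and> polynomial_hamiltonian_system D F G)"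

end

theory Submission
  imports Defs "HOL-Complex_Analysis.Complex_Analysis"
    "HOL-Computational_Algebra.Fundamental_Theorem_Algebra"
begin

text \<open>
  The manifold is Hausdorff because the points at infinity of the two charts
  \<open>(u\<^sup>\<plusminus>, w\<^sup>\<plusminus>)\<close> drift apart like \<open>2 / w\<^sup>4\<close>, and a shift of \<open>y\<close> that turns \<open>y\<^sup>2 + z/2\<close> into
  \<open>y\<^sup>2 + z0/2\<close> up to order \<open>y\<^sup>-\<^sup>2\<close> trivialises the family topologically. For the Painleve property,
  the function \<open>W = x\<^sup>2 - y\<^sup>4 - z y\<^sup>2 - 2 \<alpha> y + x/y\<close>, with the pole at \<open>y = 0\<close> cut off smoothly,
  satisfies \<open>\<bar>W'\<bar> \<le> C (1 + \<bar>W\<bar>)\<close> along rays, also through the points at infinity. By Gronwall it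
  stays bounded, and where it is bounded one of the three charts is. The existence
  time of local solutions is therefore bounded below on every disc, so that solutions extend to all
  of the plane.

  For uniqueness, let \<open>h\<close> be the difference of the two Hamiltonians at a fixed \<open>z\<close>. It is a
  polynomial in \<open>x, y\<close> whose expansions along the curves \<open>u\<^sup>+ = 0\<close> and \<open>u\<^sup>- = 0\<close> have no pole as
  \<open>y \<rightarrow> \<infinity>\<close>. Writing the curves as \<open>x = a(y)\<close> and \<open>x = b(y)\<close>, Hermite interpolation forces
  \<open>h = C ((x - a) (x - b))\<^sup>m + \<dots>\<close>, and since \<open>a + b = -1/y\<close> the coefficient of \<open>x\<^sup>2\<^sup>m\<^sup>-\<^sup>1\<close> contains
  \<open>C m / y\<close>, which is not a polynomial unless \<open>C m = 0\<close>.
\<close>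

text \<open>At w = 0 both charts at infinity have w' = 1 or w' = -1, so a pole of a solution is a
  simple zero of w and an ordinary point of a polynomial system. What has to be excluded is that a
  solution leaves the bounded parts of all three charts at a finite z. The energy alone cannot do
  this: its derivative is -y^2, so it has a simple pole at each pole of y. The correction x/y
  removes that pole but is singular at y = 0, where solutions are regular. Smoothing 1/y near 0
  gives up holomorphy and keeps a real derivative along every ray, which is all that the Gronwall
  argument uses.

  In the uniqueness part the coefficients are arbitrary functions of z. Freezing z is possible
  because the explicit z-derivative of the coordinates is the same for both systems and cancels in
  their difference. The degree of h in x is not known in advance, so its coefficients are eliminated
  from the top. Both curves are needed, since one of them supplies only half of the interpolation
  data.\<close>

lemma pm_val_square [simp]: "pm_val \<sigma> * pm_val \<sigma> = 1"
  by (cases \<sigma>) auto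

lemma norm_pm_val [simp]: "norm (pm_val \<sigma>) = 1"
  by (cases \<sigma>) auto

subsection \<open>Gluing charts along holomorphic transition maps\<close>

definition complex_differentiable_at ::
    "('m::complex_space \<Rightarrow> 'n::complex_space) \<Rightarrow> 'm \<Rightarrow> bool"
  where "complex_differentiable_at h p \<longleftrightarrow>
    (\<exists>D. (h has_derivative D) (at p) \<and> (\<forall>c v. D (cscale c v) = cscale c (D v)))"

lemma holomorphic_map_on_iff:
  "holomorphic_map_on h U \<longleftrightarrow> open U \<and> (\<forall>p\<in>U. complex_differentiable_at h p)"
  by (simp add: holomorphic_map_on_def complex_differentiable_at_def)

lemma cscale_0_right [simp]: "cscale c (0 :: 'a::complex_space) = 0"
  using cscale_add_right[of c 0 0] by simp

named_theorems cdiff_intros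

lemma complex_differentiable_at_const [cdiff_intros]: "complex_differentiable_at (\<lambda>_. k) p"
  unfolding complex_differentiable_at_def by (intro exI[of _ "\<lambda>_. 0"]) auto

lemma complex_differentiable_at_id [cdiff_intros]: "complex_differentiable_at (\<lambda>q. q) p"
  unfolding complex_differentiable_at_def by (intro exI[of _ "\<lambda>v. v"]) auto

lemma complex_differentiable_at_fst [cdiff_intros]:
  assumes "complex_differentiable_at f p"
  shows "complex_differentiable_at (\<lambda>q. fst (f q)) p"
proof -
  obtain D where "(f has_derivative D) (at p)" "\<forall>c v. D (cscale c v) = cscale c (D v)"
    using assms unfolding complex_differentiable_at_def by blast
  then show ?thesis
    unfolding complex_differentiable_at_def
    by (intro exI[of _ "\<lambda>v. fst (D v)"] conjI has_derivative_fst) (simp_all add: cscale_prod_def)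
qed

lemma complex_differentiable_at_snd [cdiff_intros]:
  assumes "complex_differentiable_at f p"
  shows "complex_differentiable_at (\<lambda>q. snd (f q)) p"
proof -
  obtain D where "(f has_derivative D) (at p)" "\<forall>c v. D (cscale c v) = cscale c (D v)"
    using assms unfolding complex_differentiable_at_def by blast
  then show ?thesis
    unfolding complex_differentiable_at_def
    by (intro exI[of _ "\<lambda>v. snd (D v)"] conjI has_derivative_snd) (simp_all add: cscale_prod_def)
qed

lemma complex_differentiable_at_Pair [cdiff_intros]:
  assumes "complex_differentiable_at f p" "complex_differentiable_at g p"
  shows "complex_differentiable_at (\<lambda>q. (f q, g q)) p"
proof -
  obtain D E where "(f has_derivative D) (at p)" "(g has_derivative E) (at p)"
    "\<forall>c v. D (cscale c v) = cscale c (D v)" "\<forall>c v. E (cscale c v) = cscale c (E v)"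
    using assms unfolding complex_differentiable_at_def by blast
  then show ?thesis
    unfolding complex_differentiable_at_def
    by (intro exI[of _ "\<lambda>v. (D v, E v)"]) (auto intro!: has_derivative_Pair simp: cscale_prod_def)
qed

lemma complex_differentiable_at_add [cdiff_intros]:
  fixes f g :: "'m::complex_space \<Rightarrow> complex"
  assumes "complex_differentiable_at f p" "complex_differentiable_at g p"
  shows "complex_differentiable_at (\<lambda>q. f q + g q) p"
proof -
  obtain D E where "(f has_derivative D) (at p)" "(g has_derivative E) (at p)"
    "\<forall>c v. D (cscale c v) = cscale c (D v)" "\<forall>c v. E (cscale c v) = cscale c (E v)"
    using assms unfolding complex_differentiable_at_def by blast
  then show ?thesis
    unfolding complex_differentiable_at_def
    by (intro exI[of _ "\<lambda>v. D v + E v"])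
      (auto intro!: has_derivative_add simp: cscale_complex_def algebra_simps)
qed

lemma complex_differentiable_at_mult [cdiff_intros]:
  fixes f g :: "'m::complex_space \<Rightarrow> complex"
  assumes "complex_differentiable_at f p" "complex_differentiable_at g p"
  shows "complex_differentiable_at (\<lambda>q. f q * g q) p"
proof -
  obtain D E where "(f has_derivative D) (at p)" "(g has_derivative E) (at p)"
    "\<forall>c v. D (cscale c v) = cscale c (D v)" "\<forall>c v. E (cscale c v) = cscale c (E v)"
    using assms unfolding complex_differentiable_at_def by blast
  then show ?thesis
    unfolding complex_differentiable_at_def
    by (intro exI[of _ "\<lambda>v. f p * E v + D v * g p"] conjI has_derivative_mult)
      (simp_all add: cscale_complex_def algebra_simps)
qed

lemma complex_differentiable_at_minus [cdiff_intros]: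
  fixes f g :: "'m::complex_space \<Rightarrow> complex"
  assumes "complex_differentiable_at f p" "complex_differentiable_at g p"
  shows "complex_differentiable_at (\<lambda>q. f q - g q) p"
  using complex_differentiable_at_add[OF assms(1) complex_differentiable_at_mult[OF
      complex_differentiable_at_const[of "-1"] assms(2)]] by simp

lemma complex_differentiable_at_power [cdiff_intros]:
  fixes f :: "'m::complex_space \<Rightarrow> complex"
  assumes "complex_differentiable_at f p"
  shows "complex_differentiable_at (\<lambda>q. f q ^ n) p"
proof (induction n)
  case (Suc n)
  show ?case
    using complex_differentiable_at_mult[OF assms Suc] by simp
qed (simp add: complex_differentiable_at_const)

lemma complex_differentiable_at_inverse [cdiff_intros]:
  fixes f :: "'m::complex_space \<Rightarrow> complex"
  assumes "complex_differentiable_at f p" "f p \<noteq> 0"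
  shows "complex_differentiable_at (\<lambda>q. inverse (f q)) p"
proof -
  obtain D where "(f has_derivative D) (at p)" "\<forall>c v. D (cscale c v) = cscale c (D v)"
    using assms unfolding complex_differentiable_at_def by blast
  then show ?thesis
    unfolding complex_differentiable_at_def using assms(2)
    by (intro exI[of _ "\<lambda>v. - (inverse (f p) * D v * inverse (f p))"] conjI
        Deriv.has_derivative_inverse) (simp_all add: cscale_complex_def algebra_simps)
qed

lemma holomorphic_map_on_imp_continuous_on:
  assumes "holomorphic_map_on h U"
  shows "continuous_on U h"
  using assms unfolding holomorphic_map_on_def
  by (meson continuous_at_imp_continuous_on has_derivative_continuous)

text \<open>By \<open>eq_iff\<close>, \<open>tr\<close> is the coordinate change and
  \<open>dom\<close> its exact domain; symmetry and the cocycle rule come from equality in the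
  target. \<open>separated\<close> speaks only of pairs that share no chart, because two points of
  one chart are separated in the model space.\<close>

locale holomorphic_gluing =
  fixes \<psi> :: "'i \<Rightarrow> 'm::{complex_space, second_countable_topology} \<Rightarrow> 'p"
    and dom :: "'i \<Rightarrow> 'i \<Rightarrow> 'm set" and tr :: "'i \<Rightarrow> 'i \<Rightarrow> 'm \<Rightarrow> 'm"
  assumes countable_charts: "countable (UNIV :: 'i set)"
    and eq_iff: "\<psi> i p = \<psi> j q \<longleftrightarrow> p \<in> dom i j \<and> q = tr i j p"
    and holomorphic: "holomorphic_map_on (tr i j) (dom i j)"
    and separated: "(\<And>k. p \<in> dom i k \<Longrightarrow> q \<notin> dom j k) \<Longrightarrow>
      \<exists>A B. open A \<and> open B \<and> p \<in> A \<and> q \<in> B \<and> \<psi> i ` A \<inter> \<psi> j ` B = {}"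
begin

abbreviation "X \<equiv> glued_topology \<psi>"

lemma inj_chart: "inj (\<psi> i)"
proof (rule injI)
  fix p q assume "\<psi> i p = \<psi> i q"
  then have "p = tr i i p" "q = tr i i p"
    using eq_iff[of i p i p] eq_iff[of i p i q] by auto
  then show "p = q" by simp
qed

lemma in_range_iff: "\<psi> i p \<in> range (\<psi> j) \<longleftrightarrow> p \<in> dom i j"
  using eq_iff by (auto simp: image_iff)

lemma open_dom: "open (dom i j)"
  using holomorphic unfolding holomorphic_map_on_def by blast

lemma open_tr_vimage: "open A \<Longrightarrow> open {p \<in> dom i j. tr i j p \<in> A}"
  using continuous_open_preimage[OF holomorphic_map_on_imp_continuous_on[OF holomorphic] open_dom]
  by (simp add: vimage_def Int_def)

text \<open>In another chart the image of an open set appears as a preimage under a transition,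
  which is continuous with open domain.\<close>

lemma openin_image:
  assumes "open A"
  shows "openin X (\<psi> i ` A)"
proof -
  have "\<psi> j -` \<psi> i ` A = {p \<in> dom j i. tr j i p \<in> A}" for j
    using eq_iff by (auto simp: image_iff)
  then show ?thesis
    using open_tr_vimage[OF assms] by (auto simp: openin_glued_topology)
qed

lemma openin_range: "openin X (range (\<psi> i))"
  by (rule openin_image) simp

lemma embedding_chart: "embedding_map euclidean X (\<psi> i)"
proof (rule injective_open_imp_embedding_map)
  show "continuous_map euclidean X (\<psi> i)"
    by (auto simp: continuous_map_def topspace_glued_topology openin_glued_topology vimage_def)
  show "open_map euclidean X (\<psi> i)"
    by (simp add: open_map_def openin_image)
qed (simp add: inj_chart)

lemma separate:
  assumes "\<psi> i p \<noteq> \<psi> j q"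
  shows "\<exists>A B. open A \<and> open B \<and> p \<in> A \<and> q \<in> B \<and> \<psi> i ` A \<inter> \<psi> j ` B = {}"
proof (cases "\<exists>k. p \<in> dom i k \<and> q \<in> dom j k")
  case True
  then obtain k where k: "p \<in> dom i k" "q \<in> dom j k" by blast
  then have e: "\<psi> i p = \<psi> k (tr i k p)" "\<psi> j q = \<psi> k (tr j k q)"
    using eq_iff by blast+
  then have "tr i k p \<noteq> tr j k q"
    using assms by metis
  then obtain A B where AB: "open A" "open B" "tr i k p \<in> A" "tr j k q \<in> B" "A \<inter> B = {}"
    using hausdorff by metis
  show ?thesis
  proof (intro exI conjI)
    show "open {p \<in> dom i k. tr i k p \<in> A}" "open {q \<in> dom j k. tr j k q \<in> B}"
      by (rule open_tr_vimage[OF AB(1)], rule open_tr_vimage[OF AB(2)])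
    show "p \<in> {p \<in> dom i k. tr i k p \<in> A}" "q \<in> {q \<in> dom j k. tr j k q \<in> B}"
      using AB(3,4) k by simp_all
    show "\<psi> i ` {p \<in> dom i k. tr i k p \<in> A} \<inter> \<psi> j ` {q \<in> dom j k. tr j k q \<in> B} = {}"
    proof -
      have False if "p' \<in> dom i k" "tr i k p' \<in> A" "q' \<in> dom j k" "tr j k q' \<in> B"
        "\<psi> i p' = \<psi> j q'" for p' q'
      proof -
        have "\<psi> i p' = \<psi> k (tr i k p')" "\<psi> j q' = \<psi> k (tr j k q')"
          using that(1,3) eq_iff by blast+
        then have "tr i k p' = tr j k q'"
          using that(5) injD[OF inj_chart[of k], of "tr i k p'" "tr j k q'"] by simp
        then show False
          using that(2,4) AB(5) by auto
      qed
      then show ?thesis by blast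
    qed
  qed
next
  case False
  then show ?thesis by (intro separated) simp
qed

lemma Hausdorff: "Hausdorff_space X"
  unfolding Hausdorff_space_def
proof (intro allI impI)
  fix P Q assume "P \<in> topspace X \<and> Q \<in> topspace X \<and> P \<noteq> Q"
  then obtain i p j q where "P = \<psi> i p" "Q = \<psi> j q" "\<psi> i p \<noteq> \<psi> j q"
    by (auto simp: topspace_glued_topology)
  with separate[of i p j q] obtain A B where
    "open A" "open B" "p \<in> A" "q \<in> B" "\<psi> i ` A \<inter> \<psi> j ` B = {}"
    by blast
  then show "\<exists>U V. openin X U \<and> openin X V \<and> P \<in> U \<and> Q \<in> V \<and> disjnt U V"
    unfolding disjnt_def \<open>P = \<psi> i p\<close> \<open>Q = \<psi> j q\<close>
    by (intro exI[of _ "\<psi> i ` A"] exI[of _ "\<psi> j ` B"] conjI openin_image imageI)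
qed

lemma second_countable: "second_countable X"
proof -
  obtain \<B> :: "'m set set" where \<B>: "countable \<B>" "topological_basis \<B>"
    using ex_countable_basis by blast
  let ?B = "(\<lambda>(i, A). \<psi> i ` A) ` (UNIV \<times> \<B>)"
  have countable: "countable ((\<lambda>(i, A). \<psi> i ` A) ` (UNIV \<times> \<B>))"
    using \<B>(1) countable_charts by (intro countable_image countable_SIGMA)
  have basis_open: "openin X V" if "V \<in> (\<lambda>(i, A). \<psi> i ` A) ` (UNIV \<times> \<B>)" for V
    using that by (auto intro!: openin_image topological_basis_open[OF \<B>(2)])
  have basis: "\<exists>V \<in> (\<lambda>(i, A). \<psi> i ` A) ` (UNIV \<times> \<B>). P \<in> V \<and> V \<subseteq> U"
    if "openin X U" "P \<in> U" for U P
  proof -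
    have "P \<in> topspace X"
      using that openin_subset by blast
    then obtain i p where P: "P = \<psi> i p"
      by (auto simp: topspace_glued_topology)
    have "open (\<psi> i -` U)" "p \<in> \<psi> i -` U"
      using that P by (auto simp: openin_glued_topology)
    from topological_basisE[OF \<B>(2) this] obtain B where "B \<in> \<B>" "p \<in> B" "B \<subseteq> \<psi> i -` U"
      by blast
    then show ?thesis
      using P by (intro bexI[of _ "\<psi> i ` B"]) auto
  qed
  show ?thesis
    unfolding second_countable_def
    by (intro exI[of _ ?B] conjI countable ballI basis_open allI impI)
      (assumption, erule conjE, rule basis)
qed

lemma transition:
  "holomorphic_map_on (\<lambda>p. inv (\<psi> j) (\<psi> i p)) {p. \<psi> i p \<in> range (\<psi> j)}"
proof -
  have dom: "{p. \<psi> i p \<in> range (\<psi> j)} = dom i j"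
    by (simp add: in_range_iff)
  have eq: "inv (\<psi> j) (\<psi> i p) = tr i j p" if "p \<in> dom i j" for p
  proof -
    have "\<psi> i p = \<psi> j (tr i j p)"
      using that by (simp add: eq_iff)
    then show ?thesis
      by (simp add: inv_f_f[OF inj_chart])
  qed
  show ?thesis
    unfolding dom holomorphic_map_on_def
  proof (intro conjI open_dom ballI)
    fix p assume p: "p \<in> dom i j"
    obtain D where "(tr i j has_derivative D) (at p)" "\<forall>c v. D (cscale c v) = cscale c (D v)"
      using holomorphic p unfolding holomorphic_map_on_def by blast
    then show "\<exists>D. ((\<lambda>p. inv (\<psi> j) (\<psi> i p)) has_derivative D) (at p) \<and>
        (\<forall>c v. D (cscale c v) = cscale c (D v))"
      using has_derivative_transform_within_open[OF _ open_dom p] eq by metis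
  qed
qed

theorem complex_manifold: "complex_manifold X \<psi>"
  unfolding complex_manifold_def
  using Hausdorff second_countable openin_range embedding_chart transition
  by (auto simp: topspace_glued_topology)

end

subsection \<open>The charts of the second Painleve equation\<close>

definition uw_to_xy :: "complex \<Rightarrow> pm \<Rightarrow> complex \<Rightarrow> complex \<times> complex \<Rightarrow> complex \<times> complex"
  where "uw_to_xy \<alpha> \<sigma> z p =
    (fst p * snd p ^ 2 - pm_val \<sigma> * inverse (snd p) ^ 2 - pm_val \<sigma> * (1/2) * z
      - (1/2 + pm_val \<sigma> * \<alpha>) * snd p, inverse (snd p))"

definition xy_to_uw :: "complex \<Rightarrow> pm \<Rightarrow> complex \<Rightarrow> complex \<times> complex \<Rightarrow> complex \<times> complex"
  where "xy_to_uw \<alpha> \<sigma> z p = (coord_u \<alpha> \<sigma> z p, coord_w p)"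

lemma uw_to_xy_xy_to_uw [simp]:
  assumes "snd p \<noteq> 0"
  shows "uw_to_xy \<alpha> \<sigma> z (xy_to_uw \<alpha> \<sigma> z p) = p"
proof -
  \<comment> \<open>Division is replaced by a letter w with y w = 1, which turns the claim into a
    polynomial identity modulo that relation. The later coordinate computations follow the same
    pattern.\<close>
  have *: "(x * y^2 + e * y^4 + k * y^2 + c * y) * w^2 - e * y^2 - k - c * w = x"
    if "y * w = 1" for x y e k c w :: complex
    using that by algebra
  show ?thesis
    using assms *[of "snd p" "inverse (snd p)" "fst p" "pm_val \<sigma>" "pm_val \<sigma> * (1/2) * z"
        "1/2 + pm_val \<sigma> * \<alpha>"]
    by (simp add: uw_to_xy_def xy_to_uw_def coord_u_def coord_w_def split_def prod_eq_iff)
qed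

lemma xy_to_uw_uw_to_xy [simp]:
  assumes "snd p \<noteq> 0"
  shows "xy_to_uw \<alpha> \<sigma> z (uw_to_xy \<alpha> \<sigma> z p) = p"
proof -
  have *: "(u * w^2 - e * y^2 - k - c * w) * y^2 + e * y^4 + k * y^2 + c * y = u"
    if "y * w = 1" for u y e k c w :: complex
    using that by algebra
  show ?thesis
    using assms *[of "inverse (snd p)" "snd p" "fst p" "pm_val \<sigma>" "pm_val \<sigma> * (1/2) * z"
        "1/2 + pm_val \<sigma> * \<alpha>"]
    by (simp add: uw_to_xy_def xy_to_uw_def coord_u_def coord_w_def split_def prod_eq_iff)
qed

lemma snd_uw_to_xy [simp]: "snd (uw_to_xy \<alpha> \<sigma> z p) = inverse (snd p)"
  by (simp add: uw_to_xy_def)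

lemma snd_xy_to_uw [simp]: "snd (xy_to_uw \<alpha> \<sigma> z p) = inverse (snd p)"
  by (simp add: xy_to_uw_def coord_w_def split: prod.splits)

text \<open>Every class contains exactly one point that lies in the chart \<open>XY\<close> or has \<open>w = 0\<close>.\<close>

definition normal_form :: "complex \<Rightarrow> complex \<Rightarrow> chart_point \<Rightarrow> chart_point"
  where "normal_form \<alpha> z q = (case fst q of XY \<Rightarrow> q
    | UW \<sigma> \<Rightarrow> if snd (snd q) = 0 then q else (XY, uw_to_xy \<alpha> \<sigma> z (snd q)))"

lemma normal_form_XY [simp]: "normal_form \<alpha> z (XY, p) = (XY, p)"
  by (simp add: normal_form_def)

lemma normal_form_UW:
  "normal_form \<alpha> z (UW \<sigma>, p) = (if snd p = 0 then (UW \<sigma>, p) else (XY, uw_to_xy \<alpha> \<sigma> z p))"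
  by (simp add: normal_form_def)

definition normal_point :: "chart_point \<Rightarrow> bool"
  where "normal_point q \<longleftrightarrow> (fst q = XY \<or> snd (snd q) = 0)"

lemma normal_point_normal_form: "normal_point (normal_form \<alpha> z q)"
  by (cases q; cases "fst q") (auto simp: normal_form_def normal_point_def)

lemma normal_form_normal_point: "normal_point q \<Longrightarrow> normal_form \<alpha> z q = q"
  by (cases q; cases "fst q") (auto simp: normal_form_def normal_point_def)

lemma glue_iff:
  "glue \<alpha> z a b \<longleftrightarrow> (\<exists>p \<sigma>. snd p \<noteq> 0 \<and> a = (XY, p) \<and> b = (UW \<sigma>, xy_to_uw \<alpha> \<sigma> z p))"
proof
  assume "glue \<alpha> z a b"
  then obtain x y \<sigma> where "y \<noteq> 0" "a = (XY, (x, y))"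
    "b = (UW \<sigma>, (coord_u \<alpha> \<sigma> z (x, y), coord_w (x, y)))"
    by (rule glue.cases)
  then show "\<exists>p \<sigma>. snd p \<noteq> 0 \<and> a = (XY, p) \<and> b = (UW \<sigma>, xy_to_uw \<alpha> \<sigma> z p)"
    by (intro exI[of _ "(x, y)"] exI[of _ \<sigma>]) (simp add: xy_to_uw_def)
next
  assume "\<exists>p \<sigma>. snd p \<noteq> 0 \<and> a = (XY, p) \<and> b = (UW \<sigma>, xy_to_uw \<alpha> \<sigma> z p)"
  then obtain x y \<sigma> where "y \<noteq> 0" "a = (XY, (x, y))" "b = (UW \<sigma>, xy_to_uw \<alpha> \<sigma> z (x, y))"
    by auto
  then show "glue \<alpha> z a b"
    using glue.intros[of y \<alpha> z x \<sigma>] by (simp add: xy_to_uw_def)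
qed

text \<open>The normal form is constant along each elementary gluing, and a point is either its own
  normal form or glued to it in one step. Comparing representatives thus replaces the generated
  equivalence.\<close>

lemma equivclp_glue_iff:
  "equivclp (glue \<alpha> z) a b \<longleftrightarrow> normal_form \<alpha> z a = normal_form \<alpha> z b"
proof
  have *: "normal_form \<alpha> z a = normal_form \<alpha> z b" if "glue \<alpha> z a b" for a b
    using that by (auto simp: glue_iff normal_form_UW)
  show "normal_form \<alpha> z a = normal_form \<alpha> z b" if "equivclp (glue \<alpha> z) a b"
    using that by (induction rule: equivclp_induct) (auto dest: *)
  have **: "equivclp (glue \<alpha> z) (normal_form \<alpha> z a) a" for a
  proof (cases "normal_form \<alpha> z a = a")
    case False
    then obtain \<sigma> p where a: "a = (UW \<sigma>, p)" "snd p \<noteq> 0"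
      by (cases a; cases "fst a") (auto simp: normal_form_def split: if_splits)
    then have "glue \<alpha> z (normal_form \<alpha> z a) a"
      unfolding glue_iff
      by (intro exI[of _ "uw_to_xy \<alpha> \<sigma> z p"] exI[of _ \<sigma>]) (simp add: normal_form_UW)
    then show ?thesis by (rule r_into_equivclp)
  qed (simp add: equivp_reflp)
  show "equivclp (glue \<alpha> z) a b" if "normal_form \<alpha> z a = normal_form \<alpha> z b"
    using **[of a] **[of b] that by (metis equivclp_sym equivclp_trans)
qed

lemma PII_chart_eq_iff:
  "PII_chart \<alpha> z i p = PII_chart \<alpha> z j q \<longleftrightarrow> normal_form \<alpha> z (i, p) = normal_form \<alpha> z (j, q)"
proof
  assume "PII_chart \<alpha> z i p = PII_chart \<alpha> z j q"
  moreover have "(j, q) \<in> PII_chart \<alpha> z j q"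
    by (simp add: PII_chart_def equivclp_glue_iff)
  ultimately show "normal_form \<alpha> z (i, p) = normal_form \<alpha> z (j, q)"
    by (metis PII_chart_def equivclp_glue_iff mem_Collect_eq)
qed (simp add: PII_chart_def equivclp_glue_iff)

text \<open>Since w = 1/y, every proper overlap is described in either kind of coordinates by a
  nonzero second coordinate.\<close>

definition overlap :: "chart \<Rightarrow> chart \<Rightarrow> (complex \<times> complex) set"
  where "overlap i j = (if i = j then UNIV else {p. snd p \<noteq> 0})"

fun transition_map :: "complex \<Rightarrow> complex \<Rightarrow> chart \<Rightarrow> chart \<Rightarrow> complex \<times> complex \<Rightarrow> complex \<times> complex"
  where "transition_map \<alpha> z XY XY p = p"
  | "transition_map \<alpha> z XY (UW \<sigma>) p = xy_to_uw \<alpha> \<sigma> z p"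
  | "transition_map \<alpha> z (UW \<sigma>) XY p = uw_to_xy \<alpha> \<sigma> z p"
  | "transition_map \<alpha> z (UW \<sigma>) (UW \<tau>) p =
      (if \<sigma> = \<tau> then p else xy_to_uw \<alpha> \<tau> z (uw_to_xy \<alpha> \<sigma> z p))"

text \<open>This is the assumption \<open>eq_iff\<close> of the gluing at a fixed z. Points with
  second coordinate 0 meet no other chart; elsewhere both sides express equality in the (x,
  y)-plane.\<close>

lemma normal_form_eq_iff:
  "normal_form \<alpha> z (i, p) = normal_form \<alpha> z (j, q) \<longleftrightarrow>
    p \<in> overlap i j \<and> q = transition_map \<alpha> z i j p"
proof -
  have XU: "p = uw_to_xy \<alpha> \<sigma> z q \<longleftrightarrow> q = xy_to_uw \<alpha> \<sigma> z p" if "snd q \<noteq> 0 \<or> snd p \<noteq> 0" for \<sigma> p q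
  proof
    assume p: "p = uw_to_xy \<alpha> \<sigma> z q"
    then have "snd q \<noteq> 0" using that by auto
    then show "q = xy_to_uw \<alpha> \<sigma> z p" using p by simp
  next
    assume q: "q = xy_to_uw \<alpha> \<sigma> z p"
    then have "snd p \<noteq> 0" using that by auto
    then show "p = uw_to_xy \<alpha> \<sigma> z q" using q by simp
  qed
  have sn: "snd q = 0 \<longleftrightarrow> snd p = 0" if "q = xy_to_uw \<alpha> \<sigma> z p" for \<sigma> p q
    using that by simp
  show ?thesis
  proof (cases i)
    case XY
    then show ?thesis
    proof (cases j)
      case (UW \<sigma>)
      show ?thesis
        using XU[of q p \<sigma>] sn[of q \<sigma> p] XY UW
        by (cases "snd q = 0") (auto simp: normal_form_UW overlap_def)
    qed (auto simp: overlap_def)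
  next
    case (UW \<sigma>)
    show ?thesis
    proof (cases j)
      case XY
      then show ?thesis
        using UW by (auto simp: normal_form_UW overlap_def)
    next
      case (UW \<tau>)
      show ?thesis
      proof (cases "snd p = 0")
        case True
        then show ?thesis
          using UW \<open>i = UW \<sigma>\<close> by (auto simp: normal_form_UW overlap_def)
      next
        case False
        have "uw_to_xy \<alpha> \<sigma> z p = uw_to_xy \<alpha> \<sigma> z q \<longleftrightarrow> q = p"
          using False XU[of q "uw_to_xy \<alpha> \<sigma> z p" \<sigma>] by auto
        then show ?thesis
          using False XU[of q "uw_to_xy \<alpha> \<sigma> z p" \<tau>] sn[of q \<tau> "uw_to_xy \<alpha> \<sigma> z p"]
            UW \<open>i = UW \<sigma>\<close>
          by (cases "snd q = 0") (auto simp: normal_form_UW overlap_def)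
      qed
    qed
  qed
qed

lemma countable_chart: "countable (UNIV :: chart set)"
proof -
  have "(UNIV :: chart set) = {XY, UW Plus, UW Minus}"
  proof (rule UNIV_eq_I)
    show "i \<in> {XY, UW Plus, UW Minus}" for i
    proof (cases i)
      case (UW \<sigma>)
      then show ?thesis by (cases \<sigma>) simp_all
    qed simp
  qed
  then have "finite (UNIV :: chart set)"
    by (rule ssubst) simp
  then show ?thesis by (rule countable_finite)
qed

section \<open>Holomorphic transitions and separation of points\<close>

lemma complex_differentiable_at_transition_map:
  assumes "complex_differentiable_at \<zeta> q" "complex_differentiable_at \<pi> q" "\<pi> q \<in> overlap i j"
  shows "complex_differentiable_at (\<lambda>q. transition_map \<alpha> (\<zeta> q) i j (\<pi> q)) q"
proof -
  have 1: "complex_differentiable_at (\<lambda>q. xy_to_uw \<alpha> \<sigma> (\<zeta> q) (\<rho> q)) q"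
    if "complex_differentiable_at \<rho> q" "snd (\<rho> q) \<noteq> 0" for \<rho> \<sigma>
    unfolding xy_to_uw_def coord_u_def coord_w_def split_def
    by (intro cdiff_intros that assms(1))
  have 2: "complex_differentiable_at (\<lambda>q. uw_to_xy \<alpha> \<sigma> (\<zeta> q) (\<rho> q)) q"
    if "complex_differentiable_at \<rho> q" "snd (\<rho> q) \<noteq> 0" for \<rho> \<sigma>
    unfolding uw_to_xy_def by (intro cdiff_intros that assms(1))
  show ?thesis
  proof (cases "i = j")
    case True
    then have "transition_map \<alpha> (\<zeta> q) i j (\<pi> q) = \<pi> q" for q
      by (cases i) auto
    then show ?thesis using assms(2) by simp
  next
    case False
    then have nz: "snd (\<pi> q) \<noteq> 0"
      using assms(3) by (simp add: overlap_def)
    show ?thesis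
      using False 1[OF assms(2) nz] 2[OF assms(2) nz] 1[OF 2[OF assms(2) nz]] nz
      by (cases i; cases j) auto
  qed
qed

lemma open_overlap: "open (overlap i j)"
proof -
  have "open {p :: complex \<times> complex. snd p \<noteq> 0}"
    by (intro open_Collect_neq continuous_intros)
  then show ?thesis by (simp add: overlap_def)
qed

text \<open>On the two charts at infinity \<open>u\<^sup>+ - u\<^sup>- = (2 + z w\<^sup>2 + 2 \<alpha> w\<^sup>3) / w\<^sup>4\<close>, so
  points with bounded \<open>u\<close>-coordinates and small \<open>w\<close> are never identified.\<close>

lemma transition_PM:
  assumes "snd p \<noteq> 0" "\<sigma> \<noteq> \<tau>"
  shows "(fst (transition_map \<alpha> z (UW \<sigma>) (UW \<tau>) p) - fst p) * snd p ^ 4 =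
    pm_val \<tau> * (2 + z * snd p ^ 2 + 2 * \<alpha> * snd p ^ 3)"
proof -
  have *: "((u * w^2 - e * y^2 - e * k - (d + e * \<alpha>) * w) * y^2 - e * y^4 - e * k * y^2
      + (d - e * \<alpha>) * y - u) * w^4 = (- e) * (2 + 2 * k * w^2 + 2 * \<alpha> * w^3)"
    if "y * w = 1" for u y e k d w :: complex
    using that by algebra
  have "pm_val \<tau> = - pm_val \<sigma>"
    using assms(2) by (cases \<sigma>; cases \<tau>) auto
  then show ?thesis
    using assms *[of "inverse (snd p)" "snd p" "fst p" "pm_val \<sigma>" "(1/2) * z" "1/2"]
    by (simp add: uw_to_xy_def xy_to_uw_def coord_u_def coord_w_def split_def mult.assoc)
qed

text \<open>Taking k = i and k = j shows that both points have second coordinate 0, in different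
  charts. If one chart is \<open>XY\<close>, identified points satisfy |y| |w| = 1, so the regions
  where the second coordinate is below 1 are disjoint. Between the charts at infinity the
  u-coordinates diverge. The neighbourhoods live in the total space; fixing z in them separates the
  points of a fibre.\<close>

lemma separated_total:
  assumes "\<And>k. p \<in> overlap i k \<Longrightarrow> q \<notin> overlap j k"
  shows "\<exists>A B. open A \<and> open B \<and> (p, z0) \<in> A \<and> (q, z0) \<in> B \<and>
    (\<forall>p' z' q'. (p', z') \<in> A \<longrightarrow> (q', z') \<in> B \<longrightarrow> q' \<noteq> transition_map \<alpha> z' i j p' \<or> p' \<notin> overlap i j)"
proof -
  have pq: "snd p = 0" "snd q = 0" "i \<noteq> j"
    using assms[of i] assms[of j] by (auto simp: overlap_def split: if_splits)
  have small: "\<exists>A B. open A \<and> open B \<and> (p, z0) \<in> A \<and> (q, z0) \<in> B \<and>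
    (\<forall>p' z' q'. (p', z') \<in> A \<longrightarrow> (q', z') \<in> B \<longrightarrow> q' \<noteq> transition_map \<alpha> z' i j p' \<or> p' \<notin> overlap i j)"
    if XY: "i = XY \<or> j = XY"
  proof -
    let ?A = "{P :: (complex \<times> complex) \<times> complex. norm (snd (fst P)) < 1}"
    have "open ?A"
      by (intro open_Collect_less continuous_intros)
    moreover have "q' \<noteq> transition_map \<alpha> z' i j p' \<or> p' \<notin> overlap i j"
      if h: "norm (snd p') < 1" "norm (snd q') < 1" for p' q' z'
    proof (rule ccontr)
      assume c: "\<not> (q' \<noteq> transition_map \<alpha> z' i j p' \<or> p' \<notin> overlap i j)"
      then have "snd q' = inverse (snd p')" "snd p' \<noteq> 0"
        using XY pq by (cases i; cases j; auto simp: overlap_def)+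
      then have "norm (snd q') * norm (snd p') = 1"
        by (simp add: norm_inverse)
      moreover have "norm (snd q') * norm (snd p') < 1 * 1"
        using h by (intro mult_strict_mono) auto
      ultimately show False by simp
    qed
    ultimately show ?thesis
      using pq by (intro exI[of _ ?A]) auto
  qed
  show ?thesis
  proof (cases "i = XY \<or> j = XY")
    case False
    then obtain \<sigma> \<tau> where ij: "i = UW \<sigma>" "j = UW \<tau>" "\<sigma> \<noteq> \<tau>"
      using pq by (cases i; cases j) auto
    \<comment> \<open>At w = 0 the inequality reads 0 < 2. Where it holds, an identified point has a
      u-coordinate at distance more than |u| + |q| + 1 from u, where |q| stands for the norm of
      \<open>fst q\<close>; this contradicts the bound in \<open>?B\<close>.\<close>
    let ?A = "{P :: (complex \<times> complex) \<times> complex.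
      (norm (fst (fst P)) + norm (fst q) + 1) * norm (snd (fst P)) ^ 4
        < norm (2 + snd P * snd (fst P) ^ 2 + 2 * \<alpha> * snd (fst P) ^ 3)}"
    let ?B = "{P :: (complex \<times> complex) \<times> complex. norm (fst (fst P)) < norm (fst q) + 1}"
    have "open ?A" "open ?B"
      by (intro open_Collect_less continuous_intros)+
    moreover have "(p, z0) \<in> ?A" "(q, z0) \<in> ?B"
      using pq by auto
    moreover have "q' \<noteq> transition_map \<alpha> z' i j p' \<or> p' \<notin> overlap i j"
      if h: "(p', z') \<in> ?A" "(q', z') \<in> ?B" for p' q' z'
    proof (rule ccontr)
      assume c: "\<not> (q' \<noteq> transition_map \<alpha> z' i j p' \<or> p' \<notin> overlap i j)"
      then have "snd p' \<noteq> 0"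
        using pq by (auto simp: overlap_def)
      then have "(fst q' - fst p') * snd p' ^ 4 =
          pm_val \<tau> * (2 + z' * snd p' ^ 2 + 2 * \<alpha> * snd p' ^ 3)"
        using transition_PM[of p' \<sigma> \<tau> \<alpha> z'] c ij by auto
      then have "norm (2 + z' * snd p' ^ 2 + 2 * \<alpha> * snd p' ^ 3) = norm (fst q' - fst p') * norm (snd p') ^ 4"
        by (metis norm_mult norm_pm_val norm_power mult_1)
      also have "\<dots> \<le> (norm (fst p') + norm (fst q) + 1) * norm (snd p') ^ 4"
        using h norm_triangle_ineq4[of "fst q'" "fst p'"] by (intro mult_right_mono) auto
      finally show False
        using h by simp
    qed
    ultimately show ?thesis
      by (intro exI[of _ ?A] exI[of _ ?B] conjI allI impI)
  qed (use small in blast)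
qed

lemma holomorphic_gluing_total:
  "holomorphic_gluing (total_chart (PII_chart \<alpha>)) (\<lambda>i j. {P. fst P \<in> overlap i j})
    (\<lambda>i j P. (transition_map \<alpha> (snd P) i j (fst P), snd P))"
proof
  show "countable (UNIV :: chart set)"
    by (rule countable_chart)
  show eq: "total_chart (PII_chart \<alpha>) i P = total_chart (PII_chart \<alpha>) j Q \<longleftrightarrow>
      P \<in> {P. fst P \<in> overlap i j} \<and> Q = (transition_map \<alpha> (snd P) i j (fst P), snd P)" for i j P Q
    by (cases "snd P = snd Q")
      (simp_all add: total_chart_def PII_chart_eq_iff normal_form_eq_iff prod_eq_iff[of Q])
  show "holomorphic_map_on (\<lambda>P. (transition_map \<alpha> (snd P) i j (fst P), snd P))
      {P. fst P \<in> overlap i j}" for i j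
    unfolding holomorphic_map_on_iff
  proof safe
    have "open (fst -` overlap i j :: ((complex \<times> complex) \<times> complex) set)"
      by (rule open_vimage_fst) (rule open_overlap)
    then show "open {P :: (complex \<times> complex) \<times> complex. fst P \<in> overlap i j}"
      by (simp add: vimage_def)
  qed (intro cdiff_intros complex_differentiable_at_transition_map)
  fix P Q :: "(complex \<times> complex) \<times> complex" and i j assume nc: "\<And>k. P \<in> {P. fst P \<in> overlap i k} \<Longrightarrow> Q \<notin> {P. fst P \<in> overlap j k}"
  show "\<exists>A B. open A \<and> open B \<and> P \<in> A \<and> Q \<in> B \<and>
      total_chart (PII_chart \<alpha>) i ` A \<inter> total_chart (PII_chart \<alpha>) j ` B = {}"
  proof (cases "snd P = snd Q")
    case True
    obtain A B where "open A" "open B" "(fst P, snd P) \<in> A" "(fst Q, snd P) \<in> B"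
      "\<forall>p' z' q'. (p', z') \<in> A \<longrightarrow> (q', z') \<in> B \<longrightarrow>
        q' \<noteq> transition_map \<alpha> z' i j p' \<or> p' \<notin> overlap i j"
      using separated_total[of "fst P" i "fst Q" j "snd P" \<alpha>] nc by auto
    moreover from this(5) have "total_chart (PII_chart \<alpha>) i ` A \<inter> total_chart (PII_chart \<alpha>) j ` B = {}"
      unfolding disjoint_iff image_iff using eq by (metis mem_Collect_eq prod.collapse)
    moreover have "P \<in> A" "Q \<in> B"
      using calculation(3,4) True by (metis prod.collapse)+
    ultimately show ?thesis
      by - (rule exI[of _ A], rule exI[of _ B], intro conjI)
  next
    case False
    then obtain A B where "open A" "open B" "snd P \<in> A" "snd Q \<in> B" "A \<inter> B = {}"
      using hausdorff by metis
    then show ?thesis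
      by - (rule exI[of _ "snd -` A"], rule exI[of _ "snd -` B"],
          auto simp: total_chart_def intro!: open_vimage_snd)
  qed
qed

lemma holomorphic_gluing_fiber:
  "holomorphic_gluing (PII_chart \<alpha> z) overlap (transition_map \<alpha> z)"
proof
  show "countable (UNIV :: chart set)"
    by (rule countable_chart)
  show eq: "PII_chart \<alpha> z i p = PII_chart \<alpha> z j q \<longleftrightarrow>
      p \<in> overlap i j \<and> q = transition_map \<alpha> z i j p" for i j p q
    by (simp add: PII_chart_eq_iff normal_form_eq_iff)
  show "holomorphic_map_on (transition_map \<alpha> z i j) (overlap i j)" for i j
    using complex_differentiable_at_transition_map[where \<zeta> = "\<lambda>_. z" and \<pi> = "\<lambda>q. q"]
    by (auto simp: holomorphic_map_on_iff open_overlap cdiff_intros)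
  fix p q :: "complex \<times> complex" and i j assume "\<And>k. p \<in> overlap i k \<Longrightarrow> q \<notin> overlap j k"
  then obtain A B where AB: "open A" "open B" "(p, z) \<in> A" "(q, z) \<in> B"
      "\<forall>p' z' q'. (p', z') \<in> A \<longrightarrow> (q', z') \<in> B \<longrightarrow>
        q' \<noteq> transition_map \<alpha> z' i j p' \<or> p' \<notin> overlap i j"
    using separated_total[of p i q j z \<alpha>] by auto
  have "open ((\<lambda>p. (p, z)) -` A)" "open ((\<lambda>p. (p, z)) -` B)"
    using AB by (auto intro!: open_vimage continuous_intros)
  moreover have "PII_chart \<alpha> z i ` ((\<lambda>p. (p, z)) -` A) \<inter> PII_chart \<alpha> z j ` ((\<lambda>p. (p, z)) -` B) = {}"
  proof -
    have False if "(p', z) \<in> A" "(q', z) \<in> B" "PII_chart \<alpha> z i p' = PII_chart \<alpha> z j q'" for p' q'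
      using AB(5)[rule_format, OF that(1,2)] that(3)[unfolded eq] by simp
    then show ?thesis by blast
  qed
  ultimately show "\<exists>A B. open A \<and> open B \<and> p \<in> A \<and> q \<in> B \<and>
      PII_chart \<alpha> z i ` A \<inter> PII_chart \<alpha> z j ` B = {}"
    using AB(3,4)
    by - (rule exI[of _ "(\<lambda>p. (p, z)) -` A"], rule exI[of _ "(\<lambda>p. (p, z)) -` B"], simp)
qed

subsection \<open>Polynomial right-hand sides\<close>

text \<open>With closure under addition this reduces a polynomiality claim to a list of monomials.
  The indicator coefficients place a single monomial in the square range of exponents.\<close>

lemma polynomial_rhs_monomial:
  "polynomial_rhs D (\<lambda>a b z. c z * a ^ i * b ^ j)"
proof -
  have "c z * a ^ i * b ^ j = (\<Sum>k\<le>max i j. \<Sum>l\<le>max i j.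
      (if k = i \<and> l = j then c z else 0) * a ^ k * b ^ l)" for z a b :: complex
  proof -
    have "(\<Sum>l\<le>max i j. (if k = i \<and> l = j then c z else 0) * a ^ k * b ^ l)
      = (\<Sum>l\<le>max i j. if l = j then (if k = i then c z * a ^ k * b ^ l else 0) else 0)" for k
      by (intro sum.cong) auto
    then show ?thesis by simp
  qed
  then show ?thesis
    unfolding polynomial_rhs_def
    by (intro exI[of _ "max i j"] exI[of _ "\<lambda>k l z. if k = i \<and> l = j then c z else 0"]) simp
qed

lemma polynomial_rhs_extend:
  fixes F :: rhs
  assumes "\<forall>z\<in>D. \<forall>a b. F a b z = (\<Sum>i\<le>n. \<Sum>j\<le>n. c i j z * a ^ i * b ^ j)" "n \<le> m"
    "z \<in> D"
  shows "F a b z = (\<Sum>i\<le>m. \<Sum>j\<le>m. (if i \<le> n \<and> j \<le> n then c i j z else 0) * a ^ i * b ^ j)"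
proof -
  have "(\<Sum>i\<le>m. \<Sum>j\<le>m. (if i \<le> n \<and> j \<le> n then c i j z else 0) * a ^ i * b ^ j)
    = (\<Sum>i\<le>n. \<Sum>j\<le>m. (if i \<le> n \<and> j \<le> n then c i j z else 0) * a ^ i * b ^ j)"
    using assms(2) by (intro sum.mono_neutral_right) (auto intro!: sum.neutral)
  also have "\<dots> = (\<Sum>i\<le>n. \<Sum>j\<le>n. (if i \<le> n \<and> j \<le> n then c i j z else 0) * a ^ i * b ^ j)"
    using assms(2) by (intro sum.cong sum.mono_neutral_right refl) auto
  also have "\<dots> = F a b z"
    using assms(1,3) by simp
  finally show ?thesis ..
qed

lemma polynomial_rhs_add:
  assumes "polynomial_rhs D F" "polynomial_rhs D G"
  shows "polynomial_rhs D (\<lambda>a b z. F a b z + G a b z)"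
proof -
  obtain n c where F: "\<forall>z\<in>D. \<forall>a b. F a b z = (\<Sum>i\<le>n. \<Sum>j\<le>n. c i j z * a ^ i * b ^ j)"
    using assms(1) unfolding polynomial_rhs_def by blast
  obtain m d where G: "\<forall>z\<in>D. \<forall>a b. G a b z = (\<Sum>i\<le>m. \<Sum>j\<le>m. d i j z * a ^ i * b ^ j)"
    using assms(2) unfolding polynomial_rhs_def by blast
  let ?e = "\<lambda>i j z. (if i \<le> n \<and> j \<le> n then c i j z else 0) + (if i \<le> m \<and> j \<le> m then d i j z else 0)"
  have "F a b z + G a b z = (\<Sum>i\<le>max n m. \<Sum>j\<le>max n m. ?e i j z * a ^ i * b ^ j)" if "z \<in> D" for a b z
    using polynomial_rhs_extend[OF F _ that, of "max n m" a b]
      polynomial_rhs_extend[OF G _ that, of "max n m" a b]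
    by (simp only: max.cobounded1 max.cobounded2 sum.distrib distrib_right)
  then show ?thesis
    unfolding polynomial_rhs_def by (intro exI[of _ "max n m"] exI[of _ ?e]) blast
qed

lemma polynomial_rhs_cong:
  "polynomial_rhs D F \<Longrightarrow> (\<And>a b z. z \<in> D \<Longrightarrow> G a b z = F a b z) \<Longrightarrow> polynomial_rhs D G"
  unfolding polynomial_rhs_def by simp

lemma polynomial_rhs_uminus:
  assumes "polynomial_rhs D F"
  shows "polynomial_rhs D (\<lambda>a b z. - F a b z)"
proof -
  obtain n c where F: "\<forall>z\<in>D. \<forall>a b. F a b z = (\<Sum>i\<le>n. \<Sum>j\<le>n. c i j z * a ^ i * b ^ j)"
    using assms(1) unfolding polynomial_rhs_def by blast
  then have "\<forall>z\<in>D. \<forall>a b. - F a b z = (\<Sum>i\<le>n. \<Sum>j\<le>n. - c i j z * a ^ i * b ^ j)"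
    by (simp add: sum_negf)
  then show ?thesis
    unfolding polynomial_rhs_def by (intro exI[of _ n] exI[of _ "\<lambda>i j z. - c i j z"])
qed

lemma polynomial_rhs_minus:
  assumes "polynomial_rhs D F" "polynomial_rhs D G"
  shows "polynomial_rhs D (\<lambda>a b z. F a b z - G a b z)"
  using polynomial_rhs_add[OF assms(1) polynomial_rhs_uminus[OF assms(2)]] by simp

subsection \<open>The system in the charts at infinity\<close>

definition uw_shift :: "complex \<Rightarrow> pm \<Rightarrow> complex"
  where "uw_shift \<alpha> \<sigma> = 1/2 + pm_val \<sigma> * \<alpha>"

definition uw_field_u :: "complex \<Rightarrow> pm \<Rightarrow> rhs"
  where "uw_field_u \<alpha> \<sigma> u w z =
    (u * w^2 - uw_shift \<alpha> \<sigma> * w - pm_val \<sigma> * z / 2) * (2 * u * w - uw_shift \<alpha> \<sigma>)"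

definition uw_field_w :: "complex \<Rightarrow> pm \<Rightarrow> rhs"
  where "uw_field_w \<alpha> \<sigma> u w z =
    - (u * w^4) + pm_val \<sigma> + pm_val \<sigma> * z * w^2 / 2 + uw_shift \<alpha> \<sigma> * w^3"

definition coord_u_dy :: "complex \<Rightarrow> pm \<Rightarrow> complex \<Rightarrow> complex \<Rightarrow> complex \<Rightarrow> complex"
  where "coord_u_dy \<alpha> \<sigma> z x y =
    2 * x * y + 4 * pm_val \<sigma> * y^3 + pm_val \<sigma> * z * y + uw_shift \<alpha> \<sigma>"

lemma coord_u_curve:
  assumes "(x has_field_derivative X) (at z)" "(y has_field_derivative Y) (at z)"
  shows "((\<lambda>t. coord_u \<alpha> \<sigma> t (x t, y t)) has_field_derivative
    X * (y z)^2 + coord_u_dy \<alpha> \<sigma> z (x z) (y z) * Y + pm_val \<sigma> * (y z)^2 / 2) (at z)"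
  unfolding coord_u_def split_conv
  by (rule derivative_eq_intros assms refl | simp)+
    (simp add: coord_u_dy_def uw_shift_def algebra_simps power2_eq_square power3_eq_cube)

lemma coord_w_curve:
  assumes "(y has_field_derivative Y) (at z)" "y z \<noteq> 0"
  shows "((\<lambda>t. coord_w (x t, y t)) has_field_derivative - Y / (y z)^2) (at z)"
  unfolding coord_w_def split_conv
  by (rule derivative_eq_intros assms refl)+ (simp add: field_simps power2_eq_square)

text \<open>A straight line through (x, y) with the prescribed velocity is an admissible test curve,
  so the condition on curves amounts to the pointwise chain rule. The summand
  \<open>pm_val \<sigma> * y^2 / 2\<close> is the explicit z-derivative of u.\<close>

lemma expressed_in_uw_iff:
  "expressed_in_uw \<alpha> \<sigma> D f g F G \<longleftrightarrow>
    (\<forall>z\<in>D. \<forall>x y. y \<noteq> 0 \<longrightarrow>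
      F (coord_u \<alpha> \<sigma> z (x, y)) (inverse y) z =
        f x y z * y^2 + coord_u_dy \<alpha> \<sigma> z x y * g x y z + pm_val \<sigma> * y^2 / 2 \<and>
      G (coord_u \<alpha> \<sigma> z (x, y)) (inverse y) z = - g x y z / y^2)" (is "?l \<longleftrightarrow> ?r")
proof
  assume l: ?l
  show ?r
  proof (intro ballI allI impI)
    fix z x y :: complex assume z: "z \<in> D" "y \<noteq> 0"
    define xx where "xx t = x + f x y z * (t - z)" for t
    define yy where "yy t = y + g x y z * (t - z)" for t
    have e: "xx z = x" "yy z = y"
      by (simp_all add: xx_def yy_def)
    have dx: "(xx has_field_derivative f x y z) (at z)"
      unfolding xx_def by (auto intro!: derivative_eq_intros)
    have dy: "(yy has_field_derivative g x y z) (at z)"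
      unfolding yy_def by (auto intro!: derivative_eq_intros)
    have "((\<lambda>t. coord_u \<alpha> \<sigma> t (xx t, yy t)) has_field_derivative
          F (coord_u \<alpha> \<sigma> z (xx z, yy z)) (coord_w (xx z, yy z)) z) (at z)"
      "((\<lambda>t. coord_w (xx t, yy t)) has_field_derivative
          G (coord_u \<alpha> \<sigma> z (xx z, yy z)) (coord_w (xx z, yy z)) z) (at z)"
      using l[unfolded expressed_in_uw_def, rule_format, of z yy xx] dx dy z e by simp_all
    note F = DERIV_unique[OF this(1) coord_u_curve[OF dx dy]]
      and G = DERIV_unique[OF this(2) coord_w_curve[OF dy]]
    show "F (coord_u \<alpha> \<sigma> z (x, y)) (inverse y) z =
        f x y z * y^2 + coord_u_dy \<alpha> \<sigma> z x y * g x y z + pm_val \<sigma> * y^2 / 2 \<and>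
      G (coord_u \<alpha> \<sigma> z (x, y)) (inverse y) z = - g x y z / y^2"
      using F G z e by (simp add: coord_w_def)
  qed
next
  assume r: ?r
  show ?l
    unfolding expressed_in_uw_def
  proof (intro ballI allI impI, elim conjE)
    fix z and x y :: "complex \<Rightarrow> complex"
    assume z: "z \<in> D" and y: "y z \<noteq> 0"
      and dx: "(x has_field_derivative f (x z) (y z) z) (at z)"
      and dy: "(y has_field_derivative g (x z) (y z) z) (at z)"
    have cw: "coord_w (x z, y z) = inverse (y z)"
      by (simp add: coord_w_def)
    show "((\<lambda>t. coord_u \<alpha> \<sigma> t (x t, y t)) has_field_derivative
          F (coord_u \<alpha> \<sigma> z (x z, y z)) (coord_w (x z, y z)) z) (at z) \<and>
       ((\<lambda>t. coord_w (x t, y t)) has_field_derivative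
          G (coord_u \<alpha> \<sigma> z (x z, y z)) (coord_w (x z, y z)) z) (at z)"
      using coord_u_curve[OF dx dy] coord_w_curve[OF dy y] r z y by (simp add: cw)
  qed
qed

lemma expressed_in_uw_PII:
  "expressed_in_uw \<alpha> \<sigma> UNIV (PII_x \<alpha>) PII_y (uw_field_u \<alpha> \<sigma>) (uw_field_w \<alpha> \<sigma>)"
  unfolding expressed_in_uw_iff
proof (intro ballI allI impI)
  fix z x y :: complex assume y: "y \<noteq> 0"
  define w where "w = inverse y"
  define e where "e = pm_val \<sigma>"
  define c where "c = uw_shift \<alpha> \<sigma>"
  define h where "h = z / 2"
  have yw: "y * w = 1" and ee: "e * e = 1" and c2: "2 * e * c = e + 2 * \<alpha>"
    using y by (simp_all add: w_def e_def c_def uw_shift_def algebra_simps)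
  have z: "z = 2 * h" by (simp add: h_def)
  have u: "coord_u \<alpha> \<sigma> z (x, y) = x * y^2 + e * y^4 + e * h * y^2 + c * y"
    by (simp add: coord_u_def e_def h_def c_def uw_shift_def)
  \<comment> \<open>A is the first factor of \<open>uw_field_u\<close> and u w becomes A y + e h y +
    c, so all powers of w disappear. The identity below is doubled because c contains 1/2.\<close>
  define A where "A = x + e * y^2"
  have s: "(x * y^2 + e * y^4 + e * h * y^2 + c * y) * w^2 - c * w - e * h = A"
    using yw unfolding A_def by algebra
  have s1: "(x * y^2 + e * y^4 + e * h * y^2 + c * y) * w = A * y + e * h * y + c"
    using yw unfolding A_def by algebra
  have "uw_field_u \<alpha> \<sigma> (coord_u \<alpha> \<sigma> z (x, y)) w z = A * (2 * (A * y + e * h * y + c) - c)"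
  proof -
    have "coord_u \<alpha> \<sigma> z (x, y) * w^2 - uw_shift \<alpha> \<sigma> * w - pm_val \<sigma> * z / 2 = A"
      unfolding u using s by (simp add: e_def c_def h_def)
    moreover have "2 * coord_u \<alpha> \<sigma> z (x, y) * w - uw_shift \<alpha> \<sigma> = 2 * (A * y + e * h * y + c) - c"
      unfolding u mult.assoc[of 2] s1 by (simp add: c_def)
    ultimately show ?thesis
      unfolding uw_field_u_def by (simp only:)
  qed
  also have "2 * \<dots> = 2 * (2 * y^3 + y * (2 * h) + \<alpha>) * y^2 + 2 * (2 * x * y + 4 * e * y^3 + e * (2 * h) * y + c) * x + e * y^2"
    unfolding A_def using ee c2 by algebra
  finally have 1: "uw_field_u \<alpha> \<sigma> (coord_u \<alpha> \<sigma> z (x, y)) w z =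
      PII_x \<alpha> x y z * y^2 + coord_u_dy \<alpha> \<sigma> z x y * PII_y x y z + pm_val \<sigma> * y^2 / 2"
    by (simp add: PII_x_def PII_y_def coord_u_dy_def z e_def c_def field_simps)
  have "(x * y^2 + e * y^4 + e * h * y^2 + c * y) * w^4 = x * w^2 + e + e * h * w^2 + c * w^3"
    using yw by algebra
  then have 2: "uw_field_w \<alpha> \<sigma> (coord_u \<alpha> \<sigma> z (x, y)) w z = - x * w^2"
    unfolding uw_field_w_def u by (simp add: e_def c_def h_def)
  show "uw_field_u \<alpha> \<sigma> (coord_u \<alpha> \<sigma> z (x, y)) (inverse y) z =
      PII_x \<alpha> x y z * y^2 + coord_u_dy \<alpha> \<sigma> z x y * PII_y x y z + pm_val \<sigma> * y^2 / 2 \<and>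
    uw_field_w \<alpha> \<sigma> (coord_u \<alpha> \<sigma> z (x, y)) (inverse y) z = - PII_y x y z / y^2"
    using 1 2 by (simp add: w_def PII_y_def field_simps)
qed

lemma polynomial_uw_field_u: "polynomial_rhs D (uw_field_u \<alpha> \<sigma>)"
proof -
  let ?c = "uw_shift \<alpha> \<sigma>" and ?e = "pm_val \<sigma>"
  have "polynomial_rhs D (\<lambda>u w z. 2 * u^2 * w^3 + (- 3 * ?c) * u^1 * w^2 + (- ?e * z) * u^1 * w^1
      + ?c^2 * u^0 * w^1 + (?e * ?c * z / 2) * u^0 * w^0)"
    by (intro polynomial_rhs_add polynomial_rhs_monomial)
  then show ?thesis
    by (rule polynomial_rhs_cong)
      (simp add: uw_field_u_def field_simps power2_eq_square power3_eq_cube)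
qed

lemma polynomial_uw_field_w: "polynomial_rhs D (uw_field_w \<alpha> \<sigma>)"
proof -
  let ?c = "uw_shift \<alpha> \<sigma>" and ?e = "pm_val \<sigma>"
  have "polynomial_rhs D (\<lambda>u w z. (- 1) * u^1 * w^4 + ?e * u^0 * w^0 + (?e * z / 2) * u^0 * w^2
      + ?c * u^0 * w^3)"
    by (intro polynomial_rhs_add polynomial_rhs_monomial)
  then show ?thesis
    by (rule polynomial_rhs_cong) (simp add: uw_field_w_def)
qed

lemma hamiltonian_uw: "hamiltonian_system D (uw_field_u \<alpha> \<sigma>) (uw_field_w \<alpha> \<sigma>)"
proof -
  let ?c = "uw_shift \<alpha> \<sigma>" and ?e = "pm_val \<sigma>"
  \<comment> \<open>Up to a function of z this is the Hamiltonian of the (x, y)-plane minus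
    \<open>pm_val \<sigma> * y / 2\<close>. The extra term generates the explicit z-derivative
    \<open>pm_val \<sigma> / (2 * w^2)\<close> of u and cancels the last pole in w.\<close>
  let ?H = "\<lambda>u w z. u^2 * w^4 / 2 - ?e * u - ?e * z * w^2 * u / 2 - ?c * w^3 * u
    + ?c^2 * w^2 / 2 + ?e * z * ?c * w / 2"
  show ?thesis
    unfolding hamiltonian_system_def
  proof (intro exI[of _ ?H] ballI allI conjI)
    fix z u w :: complex
    show "((\<lambda>t. ?H u t z) has_field_derivative uw_field_u \<alpha> \<sigma> u w z) (at w)"
      by (rule derivative_eq_intros refl | simp)+
        (simp add: uw_field_u_def field_simps power2_eq_square power3_eq_cube)
    show "((\<lambda>t. ?H t w z) has_field_derivative - uw_field_w \<alpha> \<sigma> u w z) (at u)"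
      by (rule derivative_eq_intros refl | simp)+
        (simp add: uw_field_w_def field_simps)
  qed
qed

lemma PII_hamiltonian_xy: "polynomial_hamiltonian_xy D (PII_x \<alpha>) PII_y"
proof -
  have 1: "polynomial_rhs D (\<lambda>y x. PII_y x y)"
    by (rule polynomial_rhs_cong[OF polynomial_rhs_monomial[of D "\<lambda>_. 1" 0 1]])
      (simp add: PII_y_def)
  have 2: "polynomial_rhs D (\<lambda>y x. PII_x \<alpha> x y)"
  proof -
    have "polynomial_rhs D (\<lambda>y x z. 2 * y^3 * x^0 + z * y^1 * x^0 + \<alpha> * y^0 * x^0)"
      by (intro polynomial_rhs_add polynomial_rhs_monomial)
    then show ?thesis
      by (rule polynomial_rhs_cong) (simp add: PII_x_def)
  qed
  have 3: "hamiltonian_system D (\<lambda>y x. PII_y x y) (\<lambda>y x. PII_x \<alpha> x y)"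
    unfolding hamiltonian_system_def
  proof (intro exI[of _ "\<lambda>y x z. x^2 / 2 - y^4 / 2 - z * y^2 / 2 - \<alpha> * y"] ballI allI conjI)
    fix z y x :: complex
    show "((\<lambda>t. t^2 / 2 - y^4 / 2 - z * y^2 / 2 - \<alpha> * y) has_field_derivative PII_y x y z) (at x)"
      by (rule derivative_eq_intros refl | simp)+ (simp add: PII_y_def)
    show "((\<lambda>t. x^2 / 2 - t^4 / 2 - z * t^2 / 2 - \<alpha> * t) has_field_derivative - PII_x \<alpha> x y z) (at y)"
      by (rule derivative_eq_intros refl | simp)+ (simp add: PII_x_def)
  qed
  show ?thesis
    unfolding polynomial_hamiltonian_xy_def polynomial_hamiltonian_system_def using 1 2 3 by simp
qed

lemma PII_hamiltonian_uw: "polynomial_hamiltonian_uw \<alpha> \<sigma> UNIV (PII_x \<alpha>) PII_y"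
  unfolding polynomial_hamiltonian_uw_def polynomial_hamiltonian_system_def
  using expressed_in_uw_PII polynomial_uw_field_u polynomial_uw_field_w hamiltonian_uw by blast

text \<open>As dw = -dy / y^2, only the part y^2 dx of du survives in the wedge product, and the
  powers of y cancel.\<close>

lemma symplectic:
  assumes y: "y \<noteq> 0"
  shows "wedge_d snd fst (x, y) v v' = wedge_d (coord_u \<alpha> \<sigma> z) coord_w (x, y) v v'"
proof -
  have s: "frechet_derivative snd (at p) = snd" for p :: "complex \<times> complex"
    by (rule frechet_derivative_at[symmetric]) (auto intro!: derivative_eq_intros)
  have f: "frechet_derivative fst (at p) = fst" for p :: "complex \<times> complex"
    by (rule frechet_derivative_at[symmetric]) (auto intro!: derivative_eq_intros)
  have "(coord_u \<alpha> \<sigma> z has_derivative (\<lambda>v. fst v * y^2 + coord_u_dy \<alpha> \<sigma> z x y * snd v)) (at (x, y))"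
    unfolding coord_u_def split_def
    by (rule derivative_eq_intros refl | simp)+
      (simp add: coord_u_dy_def uw_shift_def fun_eq_iff algebra_simps power2_eq_square power3_eq_cube)
  note u = frechet_derivative_at[OF this, symmetric]
  have "(coord_w has_derivative (\<lambda>v. - snd v / y^2)) (at (x, y))"
    unfolding coord_w_def split_def using y
    by (auto intro!: derivative_eq_intros simp: fun_eq_iff field_simps power2_eq_square)
  note w = frechet_derivative_at[OF this, symmetric]
  show ?thesis
    unfolding wedge_d_def s f u w using y by (simp add: field_simps)
qed

subsection \<open>Hermite interpolation at two points\<close>

lemma coeff_pcompose_linear_top:
  fixes q :: "complex poly"
  assumes "degree q \<le> n"
  shows "coeff (pcompose q [:a, b:]) n = b ^ n * coeff q n"
  using assms
proof (induction q arbitrary: n)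
  case (pCons c q)
  show ?case
  proof (cases n)
    case 0
    then have "q = 0"
      using pCons.prems by (cases "q = 0") auto
    then show ?thesis using 0 by (simp add: pcompose_pCons)
  next
    case (Suc m)
    have d: "degree q \<le> m"
      using pCons.prems Suc by (cases "q = 0") auto
    have "degree (pcompose q [:a, b:]) \<le> m"
      using d degree_pcompose_le[of q "[:a, b:]"]
      by (metis (no_types, lifting) degree_pCons_le degree_0 le_trans mult.right_neutral mult_le_mono
          degree_pCons_eq_if One_nat_def order_refl)
    then have "coeff (pcompose q [:a, b:]) (Suc m) = 0"
      by (intro coeff_eq_0) auto
    then show ?thesis
      using pCons.IH[OF d] Suc by (simp add: pcompose_pCons mult_pCons_left)
  qed
qed simp

lemma coeff_pcompose_scale:
  fixes q :: "complex poly"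
  shows "coeff (pcompose q [:0, d:]) k = d ^ k * coeff q k"
proof (induction q arbitrary: k)
  case (pCons c q)
  then show ?case
    by (cases k) (simp_all add: pcompose_pCons mult_pCons_left)
qed simp

text \<open>Quantitative Hermite interpolation with i Taylor data at 0 and j at 1. The induction
  strips one datum at 0 by writing q = a + t q1. At 1 the data of q are, apart from a, sums of
  neighbouring data of q1, so those of q1 grow at most like k + 2.\<close>

lemma hermite_top_coeff:
  "\<exists>K\<ge>0. \<forall>q B. degree q < i + j \<longrightarrow> B \<ge> 0 \<longrightarrow> (\<forall>k<i. norm (coeff q k) \<le> B) \<longrightarrow>
     (\<forall>k<j. norm (coeff (pcompose q [:1, 1:]) k) \<le> B) \<longrightarrow>
     norm (coeff (q :: complex poly) (i + j - 1)) \<le> K * B"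
proof (induction i)
  case 0
  show ?case
  proof (intro exI[of _ 1] conjI allI impI)
    fix q :: "complex poly" and B :: real
    assume d: "degree q < 0 + j" and v: "\<forall>k<j. norm (coeff (pcompose q [:1, 1:]) k) \<le> B"
    have "norm (coeff (pcompose q [:1, 1:]) (j - 1)) \<le> B"
      using d v by simp
    then show "norm (coeff q (0 + j - 1)) \<le> 1 * B"
      using coeff_pcompose_linear_top[of q "j - 1" 1 1] d by simp
  qed simp
next
  case (Suc i)
  then obtain K where K: "K \<ge> 0" "\<And>q B. degree q < i + j \<Longrightarrow> B \<ge> 0 \<Longrightarrow>
      (\<forall>k<i. norm (coeff q k) \<le> B) \<Longrightarrow>
      (\<forall>k<j. norm (coeff (pcompose q [:1, 1:]) k) \<le> B) \<Longrightarrow>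
      norm (coeff (q :: complex poly) (i + j - 1)) \<le> K * B"
    by blast
  show ?case
  \<comment> \<open>The summand 1 covers i + j = 0, where q is the constant a; the factor j + 2
    bounds the data of q1 at 1.\<close>
  proof (intro exI[of _ "1 + K * (real j + 2)"] conjI allI impI)
    fix q :: "complex poly" and B :: real
    assume d: "degree q < Suc i + j" and B: "B \<ge> 0"
      and v0: "\<forall>k<Suc i. norm (coeff q k) \<le> B"
      and v1: "\<forall>k<j. norm (coeff (pcompose q [:1, 1:]) k) \<le> B"
    obtain a q1 where q: "q = pCons a q1" by (cases q)
    have a: "norm a \<le> B"
      using v0[rule_format, of 0] q by simp
    show "norm (coeff q (Suc i + j - 1)) \<le> (1 + K * (real j + 2)) * B"
    proof (cases "i + j = 0")
      case True
      have "norm (coeff q (Suc i + j - 1)) \<le> B" using a q True by simp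
      also have "\<dots> \<le> (1 + K * (real j + 2)) * B"
        using K(1) B by (simp add: algebra_simps)
      finally show ?thesis .
    next
      case False
      let ?s = "pcompose q1 [:1, 1:]"
      have "degree q1 < i + j"
        using d q False by (cases "q1 = 0") auto
      moreover have "\<forall>k<i. norm (coeff q1 k) \<le> (real j + 2) * B"
      proof (intro allI impI)
        fix k assume "k < i"
        then have "norm (coeff q1 k) \<le> B"
          using v0[rule_format, of "Suc k"] q by simp
        also have "\<dots> \<le> (real j + 2) * B"
          using B by (simp add: algebra_simps)
        finally show "norm (coeff q1 k) \<le> (real j + 2) * B" .
      qed
      moreover have s: "k < j \<Longrightarrow> norm (coeff ?s k) \<le> (real k + 2) * B" for k
      proof (induction k)
        case 0
        have "norm (a + coeff ?s 0) \<le> B"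
          using v1[rule_format, of 0] 0 q by (simp add: pcompose_pCons mult_pCons_left)
        then have "norm (coeff ?s 0) \<le> B + norm a"
          using norm_triangle_ineq4[of "a + coeff ?s 0" a] by simp
        then show ?case using a by simp
      next
        case (Suc k)
        have "norm (coeff ?s (Suc k) + coeff ?s k) \<le> B"
          using v1[rule_format, of "Suc k"] Suc.prems q
          by (simp add: pcompose_pCons mult_pCons_left)
        then have "norm (coeff ?s (Suc k)) \<le> B + norm (coeff ?s k)"
          using norm_triangle_ineq4[of "coeff ?s (Suc k) + coeff ?s k" "coeff ?s k"] by simp
        then show ?case using Suc by (simp add: algebra_simps)
      qed
      moreover have "\<forall>k<j. norm (coeff ?s k) \<le> (real j + 2) * B"
      proof (intro allI impI)
        fix k assume "k < j"
        then have "norm (coeff ?s k) \<le> (real k + 2) * B" by (rule s)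
        also have "\<dots> \<le> (real j + 2) * B"
          using B \<open>k < j\<close> by (intro mult_right_mono) auto
        finally show "norm (coeff ?s k) \<le> (real j + 2) * B" .
      qed
      ultimately have "norm (coeff q1 (i + j - 1)) \<le> K * ((real j + 2) * B)"
        using B by (intro K(2)) auto
      moreover have "coeff q (Suc i + j - 1) = coeff q1 (i + j - 1)"
        using q False by (cases "i + j") auto
      ultimately show ?thesis
        using B by (simp add: algebra_simps)
    qed
  qed (use K(1) in simp)
qed

text \<open>Substituting x = a + d t with d = b - a moves the two points to 0 and 1. The scaled data
  are at most of order y^(4 (m - 1)), while the top coefficient is multiplied by d^(2 m - 1), of
  order y^(4 m - 2). The surplus y^2 is the decay.\<close>

lemma top_coeff_two_points:
  "\<exists>K\<ge>0. \<forall>p a b y M. y \<ge> 1 \<longrightarrow> y^2 \<le> norm (b - a) \<longrightarrow> norm (b - a) \<le> 3 * y^2 \<longrightarrow>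
     M \<ge> 0 \<longrightarrow> degree (p :: complex poly) < 2 * m \<longrightarrow>
     (\<forall>k<m. norm (coeff (pcompose p [:a, 1:]) k) \<le> M * y ^ (2 * k)) \<longrightarrow>
     (\<forall>k<m. norm (coeff (pcompose p [:b, 1:]) k) \<le> M * y ^ (2 * k)) \<longrightarrow>
     norm (coeff p (2 * m - 1)) * y^2 \<le> K * M"
proof -
  obtain K where K: "K \<ge> 0" "\<And>q B. degree q < m + m \<Longrightarrow> B \<ge> 0 \<Longrightarrow>
      (\<forall>k<m. norm (coeff q k) \<le> B) \<Longrightarrow>
      (\<forall>k<m. norm (coeff (pcompose q [:1, 1:]) k) \<le> B) \<Longrightarrow>
      norm (coeff (q :: complex poly) (m + m - 1)) \<le> K * B"
    using hermite_top_coeff[of m m] by blast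
  show ?thesis
  proof (intro exI[of _ "K * 3 ^ m"] conjI allI impI)
    fix p :: "complex poly" and a b :: complex and y M :: real
    assume y: "y \<ge> 1" and d1: "y^2 \<le> norm (b - a)" and d2: "norm (b - a) \<le> 3 * y^2"
      and M: "M \<ge> 0" and deg: "degree p < 2 * m"
      and va: "\<forall>k<m. norm (coeff (pcompose p [:a, 1:]) k) \<le> M * y ^ (2 * k)"
      and vb: "\<forall>k<m. norm (coeff (pcompose p [:b, 1:]) k) \<le> M * y ^ (2 * k)"
    obtain m' where m: "m = Suc m'" using deg by (cases m) auto
    define d where "d = b - a"
    define q where "q = pcompose p [:a, d:]"
    \<comment> \<open>The exponent belongs to the worst order k = m - 1, which is
      \<open>m'\<close>.\<close>
    define B where "B = 3 ^ m * M * y ^ (4 * m')"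
    have qa: "q = pcompose (pcompose p [:a, 1:]) [:0, d:]"
      unfolding q_def by (simp add: pcompose_assoc[symmetric] pcompose_pCons)
    have qb: "pcompose q [:1, 1:] = pcompose (pcompose p [:b, 1:]) [:0, d:]"
      unfolding q_def by (simp add: pcompose_assoc[symmetric] pcompose_pCons d_def)
    have bd: "norm (d ^ k * T) \<le> B" if "k < m" "norm T \<le> M * y ^ (2 * k)" for k and T :: complex
    proof -
      have "norm (d ^ k * T) \<le> (3 * y^2) ^ k * (M * y ^ (2 * k))"
        unfolding norm_mult norm_power using d2 that y M
        by (intro mult_mono power_mono) (auto simp: d_def)
      also have "\<dots> = 3 ^ k * M * y ^ (4 * k)"
        by (simp add: power_mult_distrib power_mult[symmetric] power_add[symmetric] mult_ac)
      also have "\<dots> \<le> 3 ^ m * M * y ^ (4 * m')"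
        using that m y M by (intro mult_mono power_increasing) auto
      finally show ?thesis unfolding B_def .
    qed
    have "degree q < m + m"
    proof -
      have "degree q \<le> degree p * degree [:a, d:]"
        unfolding q_def by (rule degree_pcompose_le)
      also have "\<dots> \<le> degree p * 1"
        by (intro mult_le_mono) auto
      finally show ?thesis using deg by simp
    qed
    moreover have "B \<ge> 0"
      using M y by (simp add: B_def)
    moreover have "\<forall>k<m. norm (coeff q k) \<le> B"
      unfolding qa coeff_pcompose_scale using bd va by simp
    moreover have "\<forall>k<m. norm (coeff (pcompose q [:1, 1:]) k) \<le> B"
      unfolding qb coeff_pcompose_scale using bd vb by simp
    ultimately have "norm (coeff q (m + m - 1)) \<le> K * B"
      by (rule K(2))
    moreover have "coeff q (m + m - 1) = d ^ (m + m - 1) * coeff p (m + m - 1)"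
      unfolding q_def using deg by (intro coeff_pcompose_linear_top) auto
    moreover have "m + m - 1 = Suc (2 * m')" using m by simp
    ultimately have 1: "norm d ^ Suc (2 * m') * norm (coeff p (2 * m - 1)) \<le> K * B"
      using m by (simp add: norm_mult norm_power mult_2)
    have "y ^ (4 * m') * (norm (coeff p (2 * m - 1)) * y^2)
        = (y^2) ^ Suc (2 * m') * norm (coeff p (2 * m - 1))"
      by (simp add: power_mult[symmetric] mult_ac)
    also have "\<dots> \<le> norm d ^ Suc (2 * m') * norm (coeff p (2 * m - 1))"
      using d1 by (intro mult_right_mono power_mono) (auto simp: d_def)
    also have "\<dots> \<le> y ^ (4 * m') * (K * 3 ^ m * M)"
      using 1 by (simp add: B_def mult_ac)
    finally show "norm (coeff p (2 * m - 1)) * y^2 \<le> K * 3 ^ m * M"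
      using y by (simp add: mult_le_cancel_left_pos)
  qed (use K(1) in simp)
qed

text \<open>For P \<noteq> 0 the polynomial t P(t) is not constant, hence unbounded along the
  positive axis.\<close>

lemma poly_decay_imp_zero:
  fixes P :: "complex poly"
  assumes "\<And>y. y \<ge> r \<Longrightarrow> norm (poly P (of_real y)) * y \<le> C"
  shows "P = 0"
proof (rule ccontr)
  assume "P \<noteq> 0"
  then obtain s where s: "\<And>z. s \<le> norm z \<Longrightarrow> \<bar>C\<bar> + 1 \<le> norm (poly (pCons 0 P) z)"
    using poly_infinity[of P "\<bar>C\<bar> + 1" 0] by blast
  define y where "y = max (max r s) 0"
  have "\<bar>C\<bar> + 1 \<le> norm (poly (pCons 0 P) (of_real y))"
    by (rule s) (simp add: y_def)
  also have "\<dots> = norm (poly P (of_real y)) * y"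
    by (simp add: norm_mult y_def mult.commute)
  also have "\<dots> \<le> C"
    by (rule assms) (simp add: y_def)
  finally show False by linarith
qed

text \<open>The third claim concerns the coefficient of index 2 m - 1; the factor x supplied by
  \<open>pCons 0\<close> keeps the index meaningful at m = 0. Each further factor contributes one
  more s.\<close>

lemma quadratic_power:
  fixes p s :: complex
  defines "Q \<equiv> [:p, s, 1:]"
  shows "degree (Q ^ m) \<le> 2 * m" "coeff (Q ^ m) (2 * m) = 1"
    "coeff (pCons 0 (Q ^ m)) (2 * m) = of_nat m * s"
proof -
  have "degree (Q ^ m) \<le> degree Q * m"
    by (rule degree_power_le)
  then show deg: "degree (Q ^ m) \<le> 2 * m" for m
    using degree_power_le[of Q m] by (simp add: Q_def)
  have c: "coeff (Q * R) k = p * coeff R k + s * coeff (pCons 0 R) k + coeff (pCons 0 (pCons 0 R)) k"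
    for R k
    by (cases k) (simp_all add: Q_def mult_pCons_left)
  have z: "coeff (Q ^ m) (2 * m + 1) = 0" "coeff (Q ^ m) (2 * m + 2) = 0" for m
    using deg[of m] by (auto intro!: coeff_eq_0)
  show t: "coeff (Q ^ m) (2 * m) = 1" for m
  proof (induction m)
    case (Suc m)
    then show ?case using z[of m] by (simp add: c)
  qed simp
  show "coeff (pCons 0 (Q ^ m)) (2 * m) = of_nat m * s"
  proof (induction m)
    case (Suc m)
    have "coeff (Q ^ Suc m) (2 * m + 1) = s + of_nat m * s"
      using Suc z[of m] t[of m] by (simp add: c)
    then show ?case by (simp add: algebra_simps)
  qed simp
qed

subsection \<open>Rigidity of the Hamiltonian\<close>

text \<open>The two curves \<open>u\<^sup>\<plusminus> = 0\<close>, written as graphs \<open>x = zero_curve y\<close>.\<close>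

definition zero_curve :: "complex \<Rightarrow> pm \<Rightarrow> complex \<Rightarrow> complex \<Rightarrow> complex"
  where "zero_curve \<alpha> \<sigma> z y = - pm_val \<sigma> * y^2 - pm_val \<sigma> * z / 2 - uw_shift \<alpha> \<sigma> / y"

lemma zero_curve_sum: "zero_curve \<alpha> Plus z y + zero_curve \<alpha> Minus z y = - 1 / y"
  by (simp add: zero_curve_def uw_shift_def diff_divide_distrib add_divide_distrib)

lemma zero_curve_diff:
  "zero_curve \<alpha> Minus z y - zero_curve \<alpha> Plus z y = 2 * y^2 + z + 2 * \<alpha> / y"
  by (simp add: zero_curve_def uw_shift_def diff_divide_distrib add_divide_distrib)

lemma zero_curve_distance:
  assumes "y \<ge> 1" "y \<ge> norm z + 2 * norm \<alpha>"
  shows "y^2 \<le> norm (zero_curve \<alpha> Minus z (of_real y) - zero_curve \<alpha> Plus z (of_real y))"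
    "norm (zero_curve \<alpha> Minus z (of_real y) - zero_curve \<alpha> Plus z (of_real y)) \<le> 3 * y^2"
proof -
  have "norm (z + 2 * \<alpha> / of_real y) \<le> norm z + 2 * norm \<alpha> / y"
    using assms(1) by (intro order_trans[OF norm_triangle_ineq]) (simp add: norm_divide norm_mult)
  also have "\<dots> \<le> norm z + 2 * norm \<alpha>"
    using assms(1) by (simp add: divide_le_eq mult_left_le mult_le_cancel_left1)
  also have "\<dots> \<le> y" by (rule assms)
  also have "\<dots> \<le> y^2" using assms(1) by (simp add: power2_eq_square)
  finally have n: "norm (z + 2 * \<alpha> / of_real y) \<le> y^2" .
  have e: "zero_curve \<alpha> Minus z (of_real y) - zero_curve \<alpha> Plus z (of_real y)
      = 2 * (of_real y)^2 + (z + 2 * \<alpha> / of_real y)"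
    unfolding zero_curve_diff by simp
  have t: "norm (2 * (of_real y :: complex)^2) = 2 * y^2"
    by (simp add: norm_mult norm_power)
  show "y^2 \<le> norm (zero_curve \<alpha> Minus z (of_real y) - zero_curve \<alpha> Plus z (of_real y))"
    unfolding e using norm_diff_ineq[of "2 * (of_real y :: complex)^2" "z + 2 * \<alpha> / of_real y"] n t
    by linarith
  show "norm (zero_curve \<alpha> Minus z (of_real y) - zero_curve \<alpha> Plus z (of_real y)) \<le> 3 * y^2"
    unfolding e using norm_triangle_ineq[of "2 * (of_real y :: complex)^2" "z + 2 * \<alpha> / of_real y"] n t
    by linarith
qed

lemma pcompose_power: "pcompose (q ^ n) r = pcompose q r ^ n" for q :: "complex poly"
  by (induction n) (simp_all add: pcompose_1 pcompose_mult)

text \<open>Interpolation makes an odd top coefficient vanish, while an even one, \<open>C\<close>, is constant;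
  subtracting \<open>C ((x - a) (x - b))\<^sup>m\<close> with \<open>a + b = -1/y\<close> then leaves the next coefficient with
  the residue \<open>C m / y\<close>, which no polynomial in \<open>y\<close> can compensate.\<close>

lemma regular_imp_constant:
  fixes h :: "real \<Rightarrow> complex poly"
  assumes coeffs: "\<And>y j. coeff (h y) (Suc j) = poly (L j) (of_real y)"
    and fin: "\<And>j. j \<ge> N \<Longrightarrow> L j = 0"
    and reg: "\<And>\<sigma> k. \<exists>B. \<forall>y\<ge>1.
      norm (coeff (pcompose (h y) [:zero_curve \<alpha> \<sigma> z (of_real y), 1:]) k) \<le> B * y ^ (2 * k)"
  shows "L j = 0"
proof -
  \<comment> \<open>From \<open>y1\<close> on, the distance of the two curves lies between y^2 and 3
    y^2.\<close>
  define y1 where "y1 = max 1 (norm z + 2 * norm \<alpha>)"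
  have y1: "y \<ge> 1" "y \<ge> norm z + 2 * norm \<alpha>" if "y \<ge> y1" for y
    using that by (auto simp: y1_def)
  have regK: "\<exists>B\<ge>0. \<forall>y\<ge>1. \<forall>\<sigma>. \<forall>k<K.
      norm (coeff (pcompose (h y) [:zero_curve \<alpha> \<sigma> z (of_real y), 1:]) k) \<le> B * y ^ (2 * k)" for K
  proof -
    obtain b where b: "\<And>\<sigma> k y. y \<ge> 1 \<Longrightarrow>
        norm (coeff (pcompose (h y) [:zero_curve \<alpha> \<sigma> z (of_real y), 1:]) k) \<le> b \<sigma> k * y ^ (2 * k)"
      using reg by metis
    define B where "B = (\<Sum>k<K. \<bar>b Plus k\<bar> + \<bar>b Minus k\<bar>)"
    have le: "b \<sigma> k \<le> B" if "k < K" for \<sigma> k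
    proof -
      have "b \<sigma> k \<le> \<bar>b Plus k\<bar> + \<bar>b Minus k\<bar>"
        by (cases \<sigma>) auto
      also have "\<dots> \<le> B"
        unfolding B_def using that by (intro member_le_sum) auto
      finally show ?thesis .
    qed
    show ?thesis
    proof (intro exI[of _ B] conjI allI impI)
      show "B \<ge> 0" unfolding B_def by (intro sum_nonneg) auto
      fix y :: real and \<sigma> k assume y: "y \<ge> 1" and k: "k < K"
      show "norm (coeff (pcompose (h y) [:zero_curve \<alpha> \<sigma> z (of_real y), 1:]) k) \<le> B * y ^ (2 * k)"
        by (rule order_trans[OF b[OF y] mult_right_mono[OF le[OF k]]]) (use y in simp)
    qed
  qed
  have main: "L n = 0" if above: "\<And>j. j > n \<Longrightarrow> L j = 0" for n
  proof -
    have deg: "degree (h y) \<le> Suc n" for y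
    proof (rule degree_le, intro allI impI)
      fix i assume "Suc n < i"
      then obtain j where "i = Suc j" "j > n" by (cases i) auto
      then show "coeff (h y) i = 0" using coeffs above by simp
    qed
    show ?thesis
    proof (cases "even n")
      case True
      then obtain m where n: "n = 2 * m" by (elim evenE)
      \<comment> \<open>The bound n + 1 = 2 M - 1 on the degree is odd, so M data on each curve
        match it exactly and the surplus y^2 forces \<open>L n\<close> to vanish.\<close>
      define M where "M = Suc m"
      have M: "2 * M - 1 = Suc n" using n by (simp add: M_def)
      obtain K where K: "K \<ge> 0" "\<And>p a b y M'. y \<ge> 1 \<Longrightarrow> y^2 \<le> norm (b - a) \<Longrightarrow>
          norm (b - a) \<le> 3 * y^2 \<Longrightarrow> M' \<ge> 0 \<Longrightarrow> degree (p :: complex poly) < 2 * M \<Longrightarrow>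
          (\<forall>k<M. norm (coeff (pcompose p [:a, 1:]) k) \<le> M' * y ^ (2 * k)) \<Longrightarrow>
          (\<forall>k<M. norm (coeff (pcompose p [:b, 1:]) k) \<le> M' * y ^ (2 * k)) \<Longrightarrow>
          norm (coeff p (2 * M - 1)) * y^2 \<le> K * M'"
        using top_coeff_two_points[of M] by blast
      obtain B where B: "B \<ge> 0" "\<And>y \<sigma> k. y \<ge> 1 \<Longrightarrow> k < M \<Longrightarrow>
          norm (coeff (pcompose (h y) [:zero_curve \<alpha> \<sigma> z (of_real y), 1:]) k) \<le> B * y ^ (2 * k)"
        using regK[of M] by blast
      show "L n = 0"
      proof (rule poly_decay_imp_zero)
        fix y :: real assume y: "y \<ge> y1"
        have d: "degree (h y) < 2 * M"
          using deg[of y] n by (simp add: M_def)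
        have "norm (coeff (h y) (2 * M - 1)) * y^2 \<le> K * B"
          using y1[OF y] B zero_curve_distance[of y z \<alpha>] d
          by (intro K(2)[of y "zero_curve \<alpha> Minus z (of_real y)" "zero_curve \<alpha> Plus z (of_real y)"]) auto
        then have "norm (poly (L n) (of_real y)) * y^2 \<le> K * B"
          unfolding M coeffs .
        moreover have "norm (poly (L n) (of_real y)) * y \<le> norm (poly (L n) (of_real y)) * y^2"
          using y1[OF y] by (intro mult_left_mono) (auto simp: power2_eq_square)
        ultimately show "norm (poly (L n) (of_real y)) * y \<le> K * B"
          by linarith
      qed
    next
      case False
      then obtain m' where n: "n = 2 * m' + 1" by (elim oddE)
      define m where "m = Suc m'"
      have m: "Suc n = 2 * m" "2 * m - 1 = n" "m \<ge> 1" using n by (auto simp: m_def)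
      obtain K where K: "K \<ge> 0" "\<And>p a b y M'. y \<ge> 1 \<Longrightarrow> y^2 \<le> norm (b - a) \<Longrightarrow>
          norm (b - a) \<le> 3 * y^2 \<Longrightarrow> M' \<ge> 0 \<Longrightarrow> degree (p :: complex poly) < 2 * Suc m \<Longrightarrow>
          (\<forall>k<Suc m. norm (coeff (pcompose p [:a, 1:]) k) \<le> M' * y ^ (2 * k)) \<Longrightarrow>
          (\<forall>k<Suc m. norm (coeff (pcompose p [:b, 1:]) k) \<le> M' * y ^ (2 * k)) \<Longrightarrow>
          norm (coeff p (2 * Suc m - 1)) * y^2 \<le> K * M'"
        using top_coeff_two_points[of "Suc m"] by blast
      obtain K' where K': "K' \<ge> 0" "\<And>p a b y M'. y \<ge> 1 \<Longrightarrow> y^2 \<le> norm (b - a) \<Longrightarrow>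
          norm (b - a) \<le> 3 * y^2 \<Longrightarrow> M' \<ge> 0 \<Longrightarrow> degree (p :: complex poly) < 2 * m \<Longrightarrow>
          (\<forall>k<m. norm (coeff (pcompose p [:a, 1:]) k) \<le> M' * y ^ (2 * k)) \<Longrightarrow>
          (\<forall>k<m. norm (coeff (pcompose p [:b, 1:]) k) \<le> M' * y ^ (2 * k)) \<Longrightarrow>
          norm (coeff p (2 * m - 1)) * y^2 \<le> K' * M'"
        using top_coeff_two_points[of m] by blast
      obtain B where B: "B \<ge> 0" "\<And>y \<sigma> k. y \<ge> 1 \<Longrightarrow> k < Suc m \<Longrightarrow>
          norm (coeff (pcompose (h y) [:zero_curve \<alpha> \<sigma> z (of_real y), 1:]) k) \<le> B * y ^ (2 * k)"
        using regK[of "Suc m"] by blast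
      have bounded: "norm (poly (L n) (of_real y)) \<le> K * (4 * B)" if y: "y \<ge> y1" for y
      proof -
        let ?a = "zero_curve \<alpha> Plus z (of_real y)" and ?b = "zero_curve \<alpha> Minus z (of_real y)"
        \<comment> \<open>The even degree 2 m does not fit a symmetric interpolation. Multiplying by
          x - a raises it to 2 m + 1 and keeps the leading coefficient. At a the data only move up
          by one index; at b they gain b - a, of size y^2, which uses up the decay and leaves
          \<open>L n\<close> bounded.\<close>
        let ?p = "h y * [:- ?a, 1:]"
        note y = y1[OF y] zero_curve_distance[OF y1[OF y]]
        have y2: "1 \<le> y^2"
          using y(1) by (rule one_le_power)
        have lower: "norm (coeff (pCons 0 (pcompose (h y) [:zero_curve \<alpha> \<sigma> z (of_real y), 1:])) k)
            \<le> B * y ^ (2 * k)" if "k < Suc m" for \<sigma> k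
        proof (cases k)
          case (Suc i)
          have "B * y ^ (2 * i) \<le> B * y ^ (2 * k)"
            using y B(1) Suc by (intro mult_left_mono power_increasing) auto
          then show ?thesis
            using B(2)[of y i \<sigma>] Suc that y by simp
        qed (use B(1) in simp)
        have "norm (coeff ?p (2 * Suc m - 1)) * y^2 \<le> K * (4 * B * y^2)"
        proof (rule K(2)[of y ?b ?a])
          show "degree ?p < 2 * Suc m"
            using degree_mult_le[of "h y" "[:- ?a, 1:]"] deg[of y] m by simp
          show "\<forall>k<Suc m. norm (coeff (pcompose ?p [:?a, 1:]) k) \<le> 4 * B * y^2 * y ^ (2 * k)"
          proof (intro allI impI)
            fix k assume k: "k < Suc m"
            have "pcompose ?p [:?a, 1:] = pCons 0 (pcompose (h y) [:?a, 1:])"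
              by (simp add: pcompose_mult pcompose_pCons del: mult_pCons_right)
                (simp add: mult.commute)
            then have "norm (coeff (pcompose ?p [:?a, 1:]) k) \<le> B * y ^ (2 * k)"
              using lower[OF k, of Plus] by simp
            also have "\<dots> \<le> 4 * B * y^2 * y ^ (2 * k)"
              using y mult_left_mono[of 1 "4 * y^2" B] B(1) y2
              by (intro mult_right_mono) (simp_all add: mult_ac)
            finally show "norm (coeff (pcompose ?p [:?a, 1:]) k) \<le> 4 * B * y^2 * y ^ (2 * k)" .
          qed
          show "\<forall>k<Suc m. norm (coeff (pcompose ?p [:?b, 1:]) k) \<le> 4 * B * y^2 * y ^ (2 * k)"
          proof (intro allI impI)
            fix k assume k: "k < Suc m"
            let ?T = "pcompose (h y) [:?b, 1:]"
            have "pcompose ?p [:?b, 1:] = smult (?b - ?a) ?T + pCons 0 ?T"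
              by (simp add: pcompose_pCons pcompose_diff pcompose_smult smult_diff_left)
            then have "norm (coeff (pcompose ?p [:?b, 1:]) k)
                \<le> norm (?b - ?a) * norm (coeff ?T k) + norm (coeff (pCons 0 ?T) k)"
              using norm_triangle_ineq[of "(?b - ?a) * coeff ?T k" "coeff (pCons 0 ?T) k"]
              by (simp add: norm_mult)
            also have "\<dots> \<le> 3 * y^2 * (B * y ^ (2 * k)) + B * y ^ (2 * k)"
              using B(1) B(2)[of y k Minus] lower[OF k, of Minus] k y
              by (intro add_mono mult_mono) auto
            also have "\<dots> \<le> 3 * y^2 * (B * y ^ (2 * k)) + y^2 * (B * y ^ (2 * k))"
              using mult_right_mono[OF y2, of "B * y ^ (2 * k)"] B(1) y by (simp add: mult_ac)
            finally show "norm (coeff (pcompose ?p [:?b, 1:]) k) \<le> 4 * B * y^2 * y ^ (2 * k)"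
              by (simp add: algebra_simps)
          qed
        qed (use y B(1) in auto)
        moreover have "coeff ?p (2 * Suc m - 1) = poly (L n) (of_real y)"
        proof -
          have "coeff (h y) (Suc (Suc n)) = 0"
            using deg[of y] by (intro coeff_eq_0) simp
          then have "coeff ?p (Suc (Suc n)) = coeff (h y) (Suc n)"
            by simp
          moreover have "2 * Suc m - 1 = Suc (Suc n)" using m by simp
          ultimately show ?thesis by (simp only: coeffs)
        qed
        ultimately have "norm (poly (L n) (of_real y)) * y^2 \<le> (K * (4 * B)) * y^2"
          by (simp add: mult_ac)
        then show ?thesis using y(1) by simp
      qed
      have "\<exists>C. L n = [:C:]"
      proof -
        obtain C P where P: "L n = pCons C P" by (cases "L n")
        have "P = 0"
        proof (rule poly_decay_imp_zero)
          fix y :: real assume y: "y \<ge> y1"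
          have "norm (poly P (of_real y)) * y = norm (poly (L n) (of_real y) - C)"
            using y1[OF y] by (simp add: P norm_mult mult.commute)
          also have "\<dots> \<le> K * (4 * B) + norm C"
            using bounded[OF y] norm_triangle_ineq4[of "poly (L n) (of_real y)" C] by simp
          finally show "norm (poly P (of_real y)) * y \<le> K * (4 * B) + norm C" .
        qed
        then show ?thesis using P by auto
      qed
      then obtain C where C: "L n = [:C:]" by blast
      define L' where "L' = L (2 * m')"
      have L': "coeff (h y) (2 * m - 1) = poly L' (of_real y)" for y
        using coeffs[of y "2 * m'"] m n by (simp add: L'_def)
      \<comment> \<open>This is the polynomial y L'(y) - m C, that is, y times the coefficient of
        index 2 m - 1 after the subtraction. Its constant term yields m C = 0.\<close>
      have "pCons (- (of_nat m * C)) L' = 0"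
      proof (rule poly_decay_imp_zero)
        fix y :: real assume y: "y \<ge> y1"
        let ?a = "zero_curve \<alpha> Plus z (of_real y)" and ?b = "zero_curve \<alpha> Minus z (of_real y)"
        note y = y1[OF y] zero_curve_distance[OF y1[OF y]]
        let ?Q = "[:?a * ?b, - (?a + ?b), 1:]"
        let ?p = "h y - smult C (?Q ^ m)"
        note Q = quadratic_power[of "?a * ?b" "- (?a + ?b)" m]
        have f: "?Q = [:- ?a, 1:] * [:- ?b, 1:]"
          by (simp add: algebra_simps)
        \<comment> \<open>The quadratic vanishes on either curve, so its m-th power does not touch
          the first m Taylor data.\<close>
        have same: "coeff (pcompose ?p [:c, 1:]) k = coeff (pcompose (h y) [:c, 1:]) k"
          if "k < m" "c = ?a \<or> c = ?b" for k c
        proof -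
          have "\<exists>R. pcompose ?Q [:c, 1:] = monom 1 1 * R"
          proof -
            have "pcompose [:- c, 1:] [:c, 1:] = monom 1 1"
              by (simp add: pcompose_pCons monom_Suc)
            then show ?thesis
              using that(2) unfolding f pcompose_mult by (auto simp: mult.commute)
          qed
          then obtain R where "pcompose ?Q [:c, 1:] = monom 1 1 * R" by blast
          then have "pcompose (?Q ^ m) [:c, 1:] = monom 1 m * R ^ m"
            by (simp add: pcompose_power power_mult_distrib monom_power)
          then have "coeff (pcompose (?Q ^ m) [:c, 1:]) k = 0"
            using that(1) by (simp add: coeff_monom_mult)
          then show ?thesis
            by (simp add: pcompose_diff pcompose_smult)
        qed
        have "norm (coeff ?p (2 * m - 1)) * y^2 \<le> K' * B"
        proof (rule K'(2)[of y ?b ?a])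
          have "coeff ?p (2 * m) = 0"
            using coeffs[of y n] C Q(2) m by simp
          moreover have "degree ?p \<le> 2 * m"
            using deg[of y] m Q(1) by (intro degree_diff_le) (auto intro: order_trans[OF degree_smult_le])
          ultimately show "degree ?p < 2 * m"
            using m(3) eq_zero_or_degree_less[of ?p "2 * m"] by auto
          show "\<forall>k<m. norm (coeff (pcompose ?p [:?a, 1:]) k) \<le> B * y ^ (2 * k)"
            using same B(2)[of y _ Plus] y by simp
          show "\<forall>k<m. norm (coeff (pcompose ?p [:?b, 1:]) k) \<le> B * y ^ (2 * k)"
            using same B(2)[of y _ Minus] y by simp
        qed (use y B(1) in auto)
        moreover have e: "coeff ?p (2 * m - 1) * of_real y = poly (pCons (- (of_nat m * C)) L') (of_real y)"
        proof -
          have "coeff (?Q ^ m) (2 * m - 1) = of_nat m * (- (?a + ?b))"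
            using Q(3) m(3) by (simp add: coeff_pCons split: nat.splits)
          also have "\<dots> * of_real y = of_nat m"
            unfolding zero_curve_sum using y(1) by simp
          finally have t: "coeff (?Q ^ m) (2 * m - 1) * of_real y = of_nat m" .
          have "coeff ?p (2 * m - 1) * of_real y
              = poly L' (of_real y) * of_real y - C * (coeff (?Q ^ m) (2 * m - 1) * of_real y)"
            by (simp only: coeff_diff coeff_smult L' left_diff_distrib mult.assoc)
          then show ?thesis
            unfolding t by (simp add: mult_ac)
        qed
        ultimately show "norm (poly (pCons (- (of_nat m * C)) L') (of_real y)) * y \<le> K' * B"
          unfolding e[symmetric] using y(1) by (simp add: norm_mult power2_eq_square mult_ac)
      qed
      then have "C = 0" using m(3) by simp
      then show "L n = 0" using C by simp
    qed
  qed
  \<comment> \<open>Descending induction from N in terms of truncated subtraction; i = N reaches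
    every j.\<close>
  have "\<forall>j\<ge>N - i. L j = 0" for i
  proof (induction i)
    case 0
    show ?case using fin by simp
  next
    case (Suc i)
    show ?case
    proof (cases "N - i")
      case 0
      then show ?thesis using Suc by simp
    next
      case (Suc k)
      have "L k = 0"
        by (rule main) (use Suc \<open>\<forall>j\<ge>N - i. L j = 0\<close> in auto)
      show ?thesis
      proof (intro allI impI)
        fix j assume "N - Suc i \<le> j"
        then have "j = k \<or> N - i \<le> j" using Suc by auto
        then show "L j = 0"
          using \<open>L k = 0\<close> \<open>\<forall>j\<ge>N - i. L j = 0\<close> by auto
      qed
    qed
  qed
  from this[of N] show ?thesis by simp
qed

section \<open>Polynomial fields along the curves u = 0, and uniqueness of the system\<close>

lemma polynomial_rhs_at:
  assumes "polynomial_rhs D F" "z \<in> D"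
  obtains n and c :: "nat \<Rightarrow> nat \<Rightarrow> complex"
  where "\<And>a b. F a b z = (\<Sum>i\<le>n. \<Sum>j\<le>n. c i j * a ^ i * b ^ j)"
proof -
  obtain n and c :: "nat \<Rightarrow> nat \<Rightarrow> complex \<Rightarrow> complex" where
    "\<forall>z\<in>D. \<forall>a b. F a b z = (\<Sum>i\<le>n. \<Sum>j\<le>n. c i j z * a ^ i * b ^ j)"
    using assms(1) unfolding polynomial_rhs_def by blast
  then show ?thesis
    using that[of "\<lambda>i j. c i j z" n] assms(2) by simp
qed

lemma polynomial_rhs_bounded:
  assumes "polynomial_rhs D F" "z \<in> D"
  obtains C where "\<And>b. norm b \<le> 1 \<Longrightarrow> norm (F 0 b z) \<le> C"
proof -
  obtain n c where F: "\<And>a b. F a b z = (\<Sum>i\<le>n. \<Sum>j\<le>n. c i j * a ^ i * b ^ j)"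
    by (rule polynomial_rhs_at[OF assms], rule that)
  show ?thesis
  proof (rule that)
    fix b :: complex assume b: "norm b \<le> 1"
    have "norm (F 0 b z) \<le> (\<Sum>i\<le>n. \<Sum>j\<le>n. norm (c i j * 0 ^ i * b ^ j))"
      unfolding F by (intro order_trans[OF norm_sum] sum_mono norm_sum)
    also have "\<dots> \<le> (\<Sum>i\<le>n. \<Sum>j\<le>n. norm (c i j))"
    proof (intro sum_mono)
      fix i j
      have "norm ((0::complex) ^ i * b ^ j) \<le> 1 * 1"
        unfolding norm_mult norm_power using b
        by (intro mult_mono power_le_one) (auto simp: power_0_left)
      then show "norm (c i j * 0 ^ i * b ^ j) \<le> norm (c i j)"
        using mult_left_mono[of "norm (0 ^ i * b ^ j)" 1 "norm (c i j)"]
        by (simp add: norm_mult mult.assoc)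
    qed
    finally show "norm (F 0 b z) \<le> (\<Sum>i\<le>n. \<Sum>j\<le>n. norm (c i j))" .
  qed
qed

text \<open>For fixed y the coordinate u is affine in x with slope y^2. A function that is regular
  in (u, w) may therefore have a Taylor coefficient of order k in x that grows like y^(2 k), which
  is the growth allowed in the interpolation.\<close>

lemma coord_u_above_zero_curve:
  assumes "y \<noteq> 0"
  shows "coord_u \<alpha> \<sigma> z (zero_curve \<alpha> \<sigma> z y + u / y^2, y) = u"
  using assms
  by (simp add: coord_u_def zero_curve_def uw_shift_def field_simps power2_eq_square eval_nat_numeral)

text \<open>Implicit differentiation of u = 0: y^2 dx + (du/dy) dy = 0, where dy/dw = -y^2.\<close>

lemma zero_curve_dy:
  assumes "w \<noteq> 0"
  shows "((\<lambda>w. zero_curve \<alpha> \<sigma> z (inverse w)) has_field_derivative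
    coord_u_dy \<alpha> \<sigma> z (zero_curve \<alpha> \<sigma> z (inverse w)) (inverse w)) (at w)"
proof -
  have "((\<lambda>w. - pm_val \<sigma> * inverse w ^ 2 - pm_val \<sigma> * z / 2 - uw_shift \<alpha> \<sigma> * w) has_field_derivative
    2 * pm_val \<sigma> * inverse w ^ 3 - uw_shift \<alpha> \<sigma>) (at w)"
    using assms
    by (auto intro!: derivative_eq_intros simp: field_simps power2_eq_square eval_nat_numeral)
  moreover have "2 * pm_val \<sigma> * inverse w ^ 3 - uw_shift \<alpha> \<sigma>
      = coord_u_dy \<alpha> \<sigma> z (zero_curve \<alpha> \<sigma> z (inverse w)) (inverse w)"
    using assms by (simp add: coord_u_dy_def zero_curve_def field_simps eval_nat_numeral)
  moreover have "(\<lambda>w. zero_curve \<alpha> \<sigma> z (inverse w))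
      = (\<lambda>w. - pm_val \<sigma> * inverse w ^ 2 - pm_val \<sigma> * z / 2 - uw_shift \<alpha> \<sigma> * w)"
    by (rule ext) (simp add: zero_curve_def inverse_eq_divide)
  ultimately show ?thesis
    by (simp only:)
qed

lemma constant_of_deriv_0:
  fixes f :: "complex \<Rightarrow> complex"
  assumes "\<And>x. (f has_field_derivative 0) (at x)"
  shows "f x = f 0"
proof -
  have "\<exists>c. \<forall>x\<in>UNIV. f x = c"
    by (rule has_field_derivative_zero_constant) (simp_all add: assms)
  then show ?thesis by auto
qed

theorem PII_rigidity:
  fixes f g :: rhs
  assumes xy: "polynomial_hamiltonian_xy D f g"
    and uw: "\<And>\<sigma>. polynomial_hamiltonian_uw \<alpha> \<sigma> D f g"
    and z: "z \<in> D"
  shows "f x y z = PII_x \<alpha> x y z \<and> g x y z = PII_y x y z"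
proof -
  define df where "df y x z = f x y z - PII_x \<alpha> x y z" for y x z
  define dg where "dg y x z = g x y z - PII_y x y z" for y x z
  note xy' = xy[unfolded polynomial_hamiltonian_xy_def polynomial_hamiltonian_system_def]
  note PII' = PII_hamiltonian_xy[of D \<alpha>, unfolded polynomial_hamiltonian_xy_def
      polynomial_hamiltonian_system_def]
  have pdf: "polynomial_rhs D df" and pdg: "polynomial_rhs D dg"
    unfolding df_def dg_def using xy' PII' by (auto intro: polynomial_rhs_minus)
  obtain h where hx: "\<And>y x. ((\<lambda>t. h y t) has_field_derivative dg y x z) (at x)"
    and hy: "\<And>y x. ((\<lambda>t. h t x) has_field_derivative - df y x z) (at y)"
  proof -
    obtain H where H: "\<forall>z\<in>D. \<forall>y x. ((\<lambda>t. H y t z) has_field_derivative g x y z) (at x) \<and>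
        ((\<lambda>t. H t x z) has_field_derivative - f x y z) (at y)"
      using xy' unfolding hamiltonian_system_def by blast
    obtain H' where H': "\<forall>z\<in>D. \<forall>y x. ((\<lambda>t. H' y t z) has_field_derivative PII_y x y z) (at x) \<and>
        ((\<lambda>t. H' t x z) has_field_derivative - PII_x \<alpha> x y z) (at y)"
      using PII' unfolding hamiltonian_system_def by blast
    show ?thesis
    proof (rule that[of "\<lambda>y x. H y x z - H' y x z"])
      show "((\<lambda>t. H y t z - H' y t z) has_field_derivative dg y x z) (at x)" for y x
        unfolding dg_def using H H' z by (intro DERIV_diff) auto
      have "((\<lambda>t. H t x z - H' t x z) has_field_derivative - f x y z - - PII_x \<alpha> x y z) (at y)" for y x
        using H H' z by (intro DERIV_diff) auto
      then show "((\<lambda>t. H t x z - H' t x z) has_field_derivative - df y x z) (at y)" for y x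
        by (simp add: df_def)
    qed
  qed
  obtain n c where c: "\<And>y x. dg y x z = (\<Sum>i\<le>n. \<Sum>j\<le>n. c i j * y ^ i * x ^ j)"
    by (rule polynomial_rhs_at[OF pdg z], rule that)
  define l where "l j = (if j \<le> n then \<Sum>i\<le>n. monom (c i j) i else 0)" for j
  define L where "L j = smult (1 / of_nat (Suc j)) (l j)" for j
  \<comment> \<open>h as a polynomial in x. The coefficients of positive powers come from
    integrating \<open>dg\<close> in x and are polynomials in y; the constant term
    \<open>h y 0\<close> is so far just some function of y.\<close>
  define hp where "hp y = [:h y 0:] + (\<Sum>j\<le>n. monom (poly (L j) y) (Suc j))" for y
  have dg: "dg y x z = (\<Sum>j\<le>n. poly (l j) y * x ^ j)" for y x
  proof -
    have "dg y x z = (\<Sum>j\<le>n. \<Sum>i\<le>n. c i j * y ^ i * x ^ j)"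
      unfolding c by (rule sum.swap)
    also have "\<dots> = (\<Sum>j\<le>n. poly (l j) y * x ^ j)"
      by (intro sum.cong refl) (simp add: l_def poly_sum poly_monom sum_distrib_right)
    finally show ?thesis .
  qed
  have coeff_hp: "coeff (hp y) (Suc j) = poly (L j) y" for y j
    by (auto simp: hp_def coeff_sum L_def l_def)
  have pderiv_hp: "poly (pderiv (hp y)) x = dg y x z" for y x
  proof -
    have "pderiv (hp y) = (\<Sum>j\<le>n. monom (poly (l j) y) j)"
    proof (rule poly_eqI)
      fix k
      have "coeff (pderiv (hp y)) k = poly (l k) y"
        unfolding coeff_pderiv coeff_hp by (simp add: L_def del: of_nat_Suc)
      also have "\<dots> = coeff (\<Sum>j\<le>n. monom (poly (l j) y) j) k"
        by (simp add: coeff_sum l_def)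
      finally show "coeff (pderiv (hp y)) k = coeff (\<Sum>j\<le>n. monom (poly (l j) y) j) k" .
    qed
    then show ?thesis
      by (simp add: dg poly_sum poly_monom)
  qed
  have poly_hp: "poly (hp y) x = h y x" for y x
  proof -
    have "((\<lambda>t. poly (hp y) t - h y t) has_field_derivative 0) (at x)" for x
      using DERIV_diff[OF poly_DERIV[of "hp y" x] hx[of y x]] by (simp add: pderiv_hp)
    then have "poly (hp y) x - h y x = poly (hp y) 0 - h y 0"
      by (rule constant_of_deriv_0)
    also have "\<dots> = 0"
      by (simp add: hp_def poly_sum poly_monom)
    finally show ?thesis by simp
  qed
  \<comment> \<open>J and K are the components of the difference field at infinity. The explicit
    z-derivative of u has cancelled, so they are the plain pushforward of (\<open>df\<close>,
    \<open>dg\<close>).\<close>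
  have "\<exists>J K. polynomial_rhs D J \<and> polynomial_rhs D K \<and> (\<forall>x y. y \<noteq> 0 \<longrightarrow>
      J (coord_u \<alpha> \<sigma> z (x, y)) (inverse y) z = df y x z * y^2 + coord_u_dy \<alpha> \<sigma> z x y * dg y x z \<and>
      K (coord_u \<alpha> \<sigma> z (x, y)) (inverse y) z = - dg y x z / y^2)" for \<sigma>
  proof -
    obtain F G where FG: "expressed_in_uw \<alpha> \<sigma> D f g F G" "polynomial_rhs D F" "polynomial_rhs D G"
      using uw[of \<sigma>] unfolding polynomial_hamiltonian_uw_def polynomial_hamiltonian_system_def by blast
    show ?thesis
    proof (intro exI conjI allI impI)
      show "polynomial_rhs D (\<lambda>u w z. F u w z - uw_field_u \<alpha> \<sigma> u w z)"
        "polynomial_rhs D (\<lambda>u w z. G u w z - uw_field_w \<alpha> \<sigma> u w z)"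
        by (intro polynomial_rhs_minus FG polynomial_uw_field_u polynomial_uw_field_w)+
      fix x y :: complex assume y: "y \<noteq> 0"
      note e1 = FG(1)[unfolded expressed_in_uw_iff, rule_format, OF z y, of x]
        and e2 = expressed_in_uw_PII[of \<alpha> \<sigma>, unfolded expressed_in_uw_iff, rule_format, OF UNIV_I y, of z x]
      show "F (coord_u \<alpha> \<sigma> z (x, y)) (inverse y) z - uw_field_u \<alpha> \<sigma> (coord_u \<alpha> \<sigma> z (x, y)) (inverse y) z
          = df y x z * y^2 + coord_u_dy \<alpha> \<sigma> z x y * dg y x z"
        using e1 e2 by (simp add: df_def dg_def algebra_simps)
      show "G (coord_u \<alpha> \<sigma> z (x, y)) (inverse y) z - uw_field_w \<alpha> \<sigma> (coord_u \<alpha> \<sigma> z (x, y)) (inverse y) z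
          = - dg y x z / y^2"
        using e1 e2 by (simp add: dg_def diff_divide_distrib)
    qed
  qed
  then obtain J K where J: "\<And>\<sigma>. polynomial_rhs D (J \<sigma>)" and K: "\<And>\<sigma>. polynomial_rhs D (K \<sigma>)"
    and JK: "\<And>\<sigma> x y. y \<noteq> 0 \<Longrightarrow> J \<sigma> (coord_u \<alpha> \<sigma> z (x, y)) (inverse y) z
        = df y x z * y^2 + coord_u_dy \<alpha> \<sigma> z x y * dg y x z"
      "\<And>\<sigma> x y. y \<noteq> 0 \<Longrightarrow> K \<sigma> (coord_u \<alpha> \<sigma> z (x, y)) (inverse y) z = - dg y x z / y^2"
    by metis
  have reg: "\<exists>B. \<forall>y\<ge>1. norm (coeff (pcompose (hp (of_real y))
      [:zero_curve \<alpha> \<sigma> z (of_real y), 1:]) k) \<le> B * y ^ (2 * k)" for \<sigma> k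
  proof (cases k)
    \<comment> \<open>On u = 0 the w-derivative of h is \<open>J \<sigma> 0 w z\<close>, a
      polynomial in w. It is bounded near w = 0, hence so is h along the curve.\<close>
    case 0
    obtain C where C: "\<And>w. norm w \<le> 1 \<Longrightarrow> norm (J \<sigma> 0 w z) \<le> C"
      by (rule polynomial_rhs_bounded[OF J[of \<sigma>] z], rule that)
    define X where "X w = zero_curve \<alpha> \<sigma> z (inverse w)" for w
    \<comment> \<open>A convex set that avoids w = 0 and contains 1 and all values 1/y with real y
      \<ge> 1.\<close>
    let ?S = "{w. Re w > 0} \<inter> cball (0::complex) 1"
    have deriv: "((\<lambda>w. h (inverse w) (X w)) has_field_derivative J \<sigma> 0 w z) (at w within ?S)"
      if "w \<in> ?S" for w
    proof -
      have w: "w \<noteq> 0" using that by auto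
      define y where "y = inverse w"
      have y: "y \<noteq> 0" using w by (simp add: y_def)
      \<comment> \<open>Partial derivatives of h alone give no chain rule along a curve. Splitting
        off the polynomial P leaves \<open>h y 0\<close>, a function of one variable.\<close>
      define P where "P y x = (\<Sum>j\<le>n. poly (L j) y * x ^ Suc j)" for y x
      have hP: "h y x = h y 0 + P y x" for y x
        unfolding poly_hp[symmetric, of y x]
        by (simp add: hp_def P_def poly_sum poly_monom)
      define Py where "Py = (\<Sum>j\<le>n. poly (pderiv (L j)) y * X w ^ Suc j)"
      have dPx: "dg y x z = (\<Sum>j\<le>n. poly (L j) y * (of_nat (Suc j) * x ^ j))" for x
        unfolding dg by (intro sum.cong refl) (simp add: L_def del: of_nat_Suc)
      have dP: "((\<lambda>t. P (a t) (b t)) has_field_derivative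
          (\<Sum>j\<le>n. poly (pderiv (L j)) y * a' * X w ^ Suc j +
            poly (L j) y * (of_nat (Suc j) * X w ^ j * b'))) (at t)"
        if "(a has_field_derivative a') (at t)" "(b has_field_derivative b') (at t)"
          "a t = y" "b t = X w" for a b a' b' t
        unfolding P_def
        by (rule derivative_eq_intros DERIV_chain2[OF poly_DERIV] that refl)+
          (simp add: that algebra_simps)
      \<comment> \<open>\<open>h t 0\<close> is differentiated as the difference of
        \<open>h t (X w)\<close> and \<open>P t (X w)\<close>, so that \<open>df\<close> is
        evaluated at the point of the curve; the contributions of \<open>Py\<close> cancel
        later.\<close>
      have "((\<lambda>t. P t (X w)) has_field_derivative Py) (at y)"
        using dP[OF DERIV_ident DERIV_const, of y "X w"] by (simp add: Py_def)
      from DERIV_diff[OF hy[of "X w" y] this]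
      have h0: "((\<lambda>t. h t 0) has_field_derivative - df y (X w) z - Py) (at y)"
        by (simp add: hP[of _ "X w"])
      have di: "(inverse has_field_derivative (- (y^2))) (at w)"
        using DERIV_inverse[OF w] by (simp add: y_def power2_eq_square)
      have dX: "(X has_field_derivative coord_u_dy \<alpha> \<sigma> z (X w) y) (at w)"
        using zero_curve_dy[OF w] unfolding X_def y_def .
      have "((\<lambda>w. h (inverse w) 0) has_field_derivative (- df y (X w) z - Py) * (- (y^2))) (at w)"
        by (rule DERIV_chain2[OF _ di]) (use h0 y_def in simp)
      from DERIV_add[OF this dP[OF di dX y_def[symmetric] refl]]
      have "((\<lambda>w. h (inverse w) (X w)) has_field_derivative
          (- df y (X w) z - Py) * (- (y^2)) + (\<Sum>j\<le>n. poly (pderiv (L j)) y * (- (y^2)) * X w ^ Suc j +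
            poly (L j) y * (of_nat (Suc j) * X w ^ j * coord_u_dy \<alpha> \<sigma> z (X w) y))) (at w)"
        by (simp only: hP[symmetric])
      moreover have "(\<Sum>j\<le>n. poly (pderiv (L j)) y * (- (y^2)) * X w ^ Suc j +
            poly (L j) y * (of_nat (Suc j) * X w ^ j * coord_u_dy \<alpha> \<sigma> z (X w) y))
          = Py * (- (y^2)) + dg y (X w) z * coord_u_dy \<alpha> \<sigma> z (X w) y"
        unfolding dPx Py_def sum.distrib sum_distrib_right
        by (intro arg_cong2[where f = "(+)"] sum.cong refl) (simp_all only: mult_ac)
      moreover have "(- df y (X w) z - Py) * (- (y^2)) + (Py * (- (y^2)) + dg y (X w) z * coord_u_dy \<alpha> \<sigma> z (X w) y)
          = df y (X w) z * y^2 + coord_u_dy \<alpha> \<sigma> z (X w) y * dg y (X w) z"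
        by (simp add: algebra_simps)
      moreover have "\<dots> = J \<sigma> 0 w z"
      proof -
        have "coord_u \<alpha> \<sigma> z (X w, y) = 0"
          using coord_u_above_zero_curve[OF y, of \<alpha> \<sigma> z 0] by (simp add: X_def y_def)
        then show ?thesis
          using JK(1)[OF y, of \<sigma> "X w"] by (simp add: y_def)
      qed
      ultimately show ?thesis
        by (simp add: has_field_derivative_at_within)
    qed
    have conv: "convex ?S"
      by (intro convex_Int convex_cball convex_halfspace_Re_gt)
    show ?thesis
    proof (intro exI[of _ "C * 2 + norm (h 1 (X 1))"] allI impI)
      fix y :: real assume y: "y \<ge> 1"
      define w where "w = complex_of_real (inverse y)"
      have w: "w \<in> ?S" "1 \<in> ?S"
        using y by (auto simp: w_def norm_divide inverse_eq_divide)
      have "norm (h (inverse w) (X w) - h (inverse 1) (X 1)) \<le> C * norm (w - 1)"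
        by (rule field_differentiable_bound[OF conv deriv]) (use w C in \<open>auto simp: dist_norm\<close>)
      also have "\<dots> \<le> C * 2"
      proof (rule mult_left_mono)
        show "norm (w - 1) \<le> 2"
          using norm_triangle_ineq4[of w 1] w by auto
        show "0 \<le> C" using order_trans[OF norm_ge_zero C[of 0]] by simp
      qed
      finally have "norm (h (inverse w) (X w)) \<le> C * 2 + norm (h 1 (X 1))"
        using norm_triangle_ineq2[of "h (inverse w) (X w)" "h (inverse 1) (X 1)"] by simp
      moreover have "coeff (pcompose (hp (of_real y)) [:zero_curve \<alpha> \<sigma> z (of_real y), 1:]) 0
          = h (inverse w) (X w)"
        by (simp add: pcompose_coeff_0 poly_hp w_def X_def)
      ultimately show "norm (coeff (pcompose (hp (of_real y)) [:zero_curve \<alpha> \<sigma> z (of_real y), 1:]) k)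
          \<le> (C * 2 + norm (h 1 (X 1))) * y ^ (2 * k)"
        using 0 by simp
    qed
  next
    \<comment> \<open>Here K equals -w^2 times the x-derivative of h at x = a + w^2 u. Both sides
      are polynomials in u, and the coefficient of u^(k - 1) is, up to sign, k w^(2 k) times the
      Taylor coefficient of order k.\<close>
    case (Suc k')
    obtain m d where d: "\<And>u w. K \<sigma> u w z = (\<Sum>i\<le>m. \<Sum>j\<le>m. d i j * u ^ i * w ^ j)"
      by (rule polynomial_rhs_at[OF K[of \<sigma>] z], rule that)
    let ?B = "if k' \<le> m then \<Sum>j\<le>m. norm (d k' j) else 0"
    show ?thesis
    proof (intro exI[of _ ?B] allI impI)
      fix y :: real assume y: "y \<ge> 1"
      let ?y = "complex_of_real y"
      define w where "w = inverse ?y"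
      have y0: "?y \<noteq> 0" using y by auto
      let ?X = "zero_curve \<alpha> \<sigma> z ?y"
      let ?T = "pcompose (hp ?y) [:?X, 1:]"
      have "smult (- (w^2)) (pcompose (pderiv ?T) [:0, w^2:]) =
          (\<Sum>i\<le>m. monom (\<Sum>j\<le>m. d i j * w ^ j) i)" (is "?l = ?r")
      proof (rule poly_eq_poly_eq_iff[THEN iffD1], rule ext)
        fix u
        have "poly ?l u = - (w^2) * dg ?y (?X + u / ?y^2) z"
          by (simp add: pderiv_pcompose pderiv_pCons poly_pcompose pderiv_hp w_def divide_inverse
              power_inverse)
        also have "\<dots> = K \<sigma> u w z"
          using JK(2)[OF y0, of \<sigma> "?X + u / ?y^2"] coord_u_above_zero_curve[OF y0, of \<alpha> \<sigma> z u]
          by (simp add: w_def divide_inverse power_inverse mult.commute)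
        also have "\<dots> = poly ?r u"
          unfolding d by (simp add: poly_sum poly_monom sum_distrib_left sum_distrib_right mult_ac)
        finally show "poly ?l u = poly ?r u" .
      qed
      then have lr: "coeff ?l k' = coeff ?r k'" by (rule arg_cong)
      let ?Z = "w^2 * (w^2) ^ k' * (of_nat (Suc k') * coeff ?T (Suc k'))"
      have "coeff ?l k' = - ?Z"
        by (simp add: coeff_pcompose_scale coeff_pderiv mult.assoc del: of_nat_Suc)
      then have "norm ?Z = norm (coeff ?r k')"
        unfolding lr by (simp only: norm_minus_cancel)
      also have "\<dots> \<le> ?B"
      proof -
        have "norm (\<Sum>j\<le>m. d k' j * w ^ j) \<le> (\<Sum>j\<le>m. norm (d k' j))"
        proof (rule order_trans[OF norm_sum], rule sum_mono)
          fix j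
          have "norm w ^ j \<le> 1"
            using y by (intro power_le_one) (auto simp: w_def norm_divide inverse_eq_divide)
          then show "norm (d k' j * w ^ j) \<le> norm (d k' j)"
            using mult_left_mono[of "norm w ^ j" 1 "norm (d k' j)"]
            by (simp add: norm_mult norm_power)
        qed
        then show ?thesis by (simp add: coeff_sum)
      qed
      finally have "norm ?Z \<le> ?B" .
      moreover have "norm ?Z = norm w ^ (2 * k) * (real (Suc k') * norm (coeff ?T k))"
        unfolding Suc power_mult power_Suc norm_mult norm_power norm_of_nat ..
      ultimately have 1: "norm w ^ (2 * k) * (real (Suc k') * norm (coeff ?T k)) \<le> ?B"
        by (simp only:)
      have "norm w ^ (2 * k) * norm (coeff ?T k) \<le> norm w ^ (2 * k) * (real (Suc k') * norm (coeff ?T k))"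
        by (intro mult_left_mono) (auto simp: mult_le_cancel_right1)
      with 1 have "norm w ^ (2 * k) * norm (coeff ?T k) \<le> ?B" by linarith
      then have "y ^ (2 * k) * (norm w ^ (2 * k) * norm (coeff ?T k)) \<le> y ^ (2 * k) * ?B"
        using y by (intro mult_left_mono) auto
      moreover have "y ^ (2 * k) * norm w ^ (2 * k) = 1"
        using y by (simp add: w_def norm_inverse power_mult_distrib[symmetric])
      ultimately show "norm (coeff ?T k) \<le> ?B * y ^ (2 * k)"
        by (simp only: mult.assoc[symmetric] mult_1 mult.commute[of ?B])
    qed
  qed
  have L: "L j = 0" for j
  proof (rule regular_imp_constant[where h = "\<lambda>y. hp (of_real y)" and N = "Suc n" and z = z and \<alpha> = \<alpha>])
    show "coeff (hp (of_real y)) (Suc j) = poly (L j) (of_real y)" for y j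
      by (rule coeff_hp)
    show "L j = 0" if "j \<ge> Suc n" for j
      using that by (simp add: L_def l_def)
  qed (rule reg)
  have "l j = 0" for j
    using L[of j] by (simp add: L_def del: of_nat_Suc)
  then have dg0: "dg y x z = 0" for y x
    by (simp add: dg)
  have h_indep: "h y x = h y 0" for y x
    using constant_of_deriv_0[of "h y"] hx[of y] dg0 by simp
  have df_indep: "df y x z = df y 0 z" for y x
  proof -
    have "(\<lambda>t. h t x) = (\<lambda>t. h t 0)"
      by (rule ext) (rule h_indep)
    then show ?thesis
      using DERIV_unique[OF hy[of x y], of "- df y 0 z"] hy[of 0 y] by simp
  qed
  obtain m e where e: "\<And>y x. df y x z = (\<Sum>i\<le>m. \<Sum>j\<le>m. e i j * y ^ i * x ^ j)"
    by (rule polynomial_rhs_at[OF pdf z], rule that)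
  define Q where "Q = (\<Sum>i\<le>m. monom (e i 0) i)"
  have Q: "df y 0 z = poly Q y" for y
  proof -
    have "(\<Sum>j\<le>m. e i j * y ^ i * 0 ^ j) = e i 0 * y ^ i" for i
    proof -
      have "(\<Sum>j\<le>m. e i j * y ^ i * 0 ^ j) = (\<Sum>j\<le>m. if j = 0 then e i j * y ^ i else 0)"
        by (intro sum.cong) (auto simp: power_0_left)
      then show ?thesis by simp
    qed
    then show ?thesis by (simp add: e Q_def poly_sum poly_monom)
  qed
  \<comment> \<open>What remains of the difference is the component Q(y) y^2 in the direction of u;
    it equals \<open>J Plus 0 w z\<close> on u = 0 and must stay bounded as w tends to 0.\<close>
  have "Q = 0"
  proof -
    obtain C where C: "\<And>w. norm w \<le> 1 \<Longrightarrow> norm (J Plus 0 w z) \<le> C"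
      by (rule polynomial_rhs_bounded[OF J[of Plus] z], rule that)
    show ?thesis
    proof (rule poly_decay_imp_zero)
      fix y :: real assume y: "y \<ge> 1"
      let ?y = "complex_of_real y"
      have y0: "?y \<noteq> 0" using y by auto
      have "J Plus 0 (inverse ?y) z = poly Q ?y * ?y^2"
        using JK(1)[OF y0, of Plus "zero_curve \<alpha> Plus z ?y"] coord_u_above_zero_curve[OF y0, of \<alpha> Plus z 0]
          dg0 df_indep Q by simp
      then have "norm (poly Q ?y) * y^2 \<le> C"
        using C[of "inverse ?y"] y by (simp add: norm_mult norm_power norm_divide inverse_eq_divide)
      moreover have "norm (poly Q ?y) * y \<le> norm (poly Q ?y) * y^2"
        using y by (intro mult_left_mono) (auto simp: power2_eq_square)
      ultimately show "norm (poly Q ?y) * y \<le> C" by linarith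
    qed
  qed
  then have "df y x z = 0"
    using df_indep Q by simp
  then show ?thesis
    using dg0[of y x] by (simp add: df_def dg_def)
qed

subsection \<open>Local solutions of polynomial systems\<close>

text \<open>In contrast to \<open>polynomial_rhs\<close>, the dependence on z is polynomial as well,
  which gives holomorphy along curves and bounds uniform in z on discs. Both follow by induction
  over the construction.\<close>

inductive polynomial_field :: "rhs \<Rightarrow> bool"
  where
    const: "polynomial_field (\<lambda>a b z. c)"
  | first: "polynomial_field (\<lambda>a b z. a)"
  | second: "polynomial_field (\<lambda>a b z. b)"
  | time: "polynomial_field (\<lambda>a b z. z)"
  | add: "polynomial_field f \<Longrightarrow> polynomial_field g \<Longrightarrow> polynomial_field (\<lambda>a b z. f a b z + g a b z)"
  | mult: "polynomial_field f \<Longrightarrow> polynomial_field g \<Longrightarrow> polynomial_field (\<lambda>a b z. f a b z * g a b z)"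

lemma polynomial_field_power:
  assumes "polynomial_field f"
  shows "polynomial_field (\<lambda>a b z. f a b z ^ n)"
proof (induction n)
  case 0
  show ?case using polynomial_field.const[of 1] by simp
next
  case (Suc n)
  show ?case using polynomial_field.mult[OF assms Suc] by simp
qed

lemma polynomial_field_minus:
  assumes "polynomial_field f" "polynomial_field g"
  shows "polynomial_field (\<lambda>a b z. f a b z - g a b z)"
  using polynomial_field.add[OF assms(1) polynomial_field.mult[OF polynomial_field.const[of "-1"] assms(2)]]
  by simp

lemma polynomial_field_holomorphic:
  assumes "polynomial_field f" "x holomorphic_on S" "y holomorphic_on S"
  shows "(\<lambda>z. f (x z) (y z) z) holomorphic_on S"
  using assms by (induction rule: polynomial_field.induct) (auto intro: holomorphic_intros)

text \<open>The size is bounded along with the increments because the Lipschitz estimate of a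
  product needs the sizes of its factors.\<close>

definition lipschitz_below :: "rhs \<Rightarrow> real \<Rightarrow> real \<Rightarrow> bool"
  where "lipschitz_below f K M \<longleftrightarrow> (\<forall>a b a' b' z. norm a \<le> K \<and> norm b \<le> K \<and> norm a' \<le> K \<and>
    norm b' \<le> K \<and> norm z \<le> K \<longrightarrow>
    norm (f a b z) \<le> M \<and> norm (f a b z - f a' b' z) \<le> M * (norm (a - a') + norm (b - b')))"

lemma lipschitz_below_bound:
  assumes "lipschitz_below f K M" "norm a \<le> K" "norm b \<le> K" "norm z \<le> K"
  shows "norm (f a b z) \<le> M"
  using assms(1)[unfolded lipschitz_below_def, rule_format, of a b a b z] assms(2-) by simp

lemma lipschitz_below_diff:
  assumes "lipschitz_below f K M" "norm a \<le> K" "norm b \<le> K" "norm a' \<le> K" "norm b' \<le> K"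
    "norm z \<le> K"
  shows "norm (f a b z - f a' b' z) \<le> M * (norm (a - a') + norm (b - b'))"
  using assms(1)[unfolded lipschitz_below_def, rule_format, of a b a' b' z] assms(2-) by simp

lemma lipschitz_below_mono:
  assumes "lipschitz_below f K M" "M \<le> M'"
  shows "lipschitz_below f K M'"
  unfolding lipschitz_below_def
proof (intro allI impI conjI)
  fix a b a' b' z :: complex
  assume h: "norm a \<le> K \<and> norm b \<le> K \<and> norm a' \<le> K \<and> norm b' \<le> K \<and> norm z \<le> K"
  note f = assms(1)[unfolded lipschitz_below_def, rule_format, OF h]
  show "norm (f a b z) \<le> M'"
    using f assms(2) by linarith
  show "norm (f a b z - f a' b' z) \<le> M' * (norm (a - a') + norm (b - b'))"
    using f assms(2) mult_right_mono[of M M' "norm (a - a') + norm (b - b')"] by simp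
qed

lemma polynomial_field_lipschitz:
  assumes "polynomial_field f" "K \<ge> 0"
  shows "\<exists>M\<ge>0. lipschitz_below f K M"
  using assms(1)
proof (induction rule: polynomial_field.induct)
  case (const c)
  show ?case
    by (intro exI[of _ "norm c"]) (auto simp: lipschitz_below_def)
next
  case first
  \<comment> \<open>K + 1 majorises both the size bound K and the Lipschitz constant 1.\<close>
  show ?case
    by (intro exI[of _ "K + 1"]) (use assms(2) in \<open>auto simp: lipschitz_below_def algebra_simps add_increasing\<close>)
next
  case second
  show ?case
    by (intro exI[of _ "K + 1"]) (use assms(2) in \<open>auto simp: lipschitz_below_def algebra_simps add_increasing\<close>)
next
  case time
  show ?case
    by (intro exI[of _ K]) (use assms(2) in \<open>auto simp: lipschitz_below_def\<close>)
next
  case (add f g)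
  then obtain M N where MN: "M \<ge> 0" "lipschitz_below f K M" "N \<ge> 0" "lipschitz_below g K N"
    by blast
  show ?case
  proof (intro exI[of _ "M + N"] conjI)
    show "lipschitz_below (\<lambda>a b z. f a b z + g a b z) K (M + N)"
      unfolding lipschitz_below_def
    proof (intro allI impI conjI)
      fix a b a' b' z :: complex
      assume h: "norm a \<le> K \<and> norm b \<le> K \<and> norm a' \<le> K \<and> norm b' \<le> K \<and> norm z \<le> K"
      note f = MN(2)[unfolded lipschitz_below_def, rule_format, OF h]
      note g = MN(4)[unfolded lipschitz_below_def, rule_format, OF h]
      show "norm (f a b z + g a b z) \<le> M + N"
        using f g norm_triangle_ineq[of "f a b z" "g a b z"] by linarith
      have "norm ((f a b z - f a' b' z) + (g a b z - g a' b' z))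
          \<le> M * (norm (a - a') + norm (b - b')) + N * (norm (a - a') + norm (b - b'))"
        using f g by (intro norm_triangle_mono) auto
      then show "norm (f a b z + g a b z - (f a' b' z + g a' b' z))
          \<le> (M + N) * (norm (a - a') + norm (b - b'))"
        by (simp add: algebra_simps)
    qed
  qed (use MN in simp)
next
  case (mult f g)
  then obtain M N where MN: "M \<ge> 0" "lipschitz_below f K M" "N \<ge> 0" "lipschitz_below g K N"
    by blast
  show ?case
  proof (intro exI[of _ "2 * M * N"] conjI)
    show "lipschitz_below (\<lambda>a b z. f a b z * g a b z) K (2 * M * N)"
      unfolding lipschitz_below_def
    proof (intro allI impI conjI)
      fix a b a' b' z :: complex
      assume h: "norm a \<le> K \<and> norm b \<le> K \<and> norm a' \<le> K \<and> norm b' \<le> K \<and> norm z \<le> K"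
      then have h': "norm a' \<le> K \<and> norm b' \<le> K \<and> norm a \<le> K \<and> norm b \<le> K \<and> norm z \<le> K"
        by simp
      note f = MN(2)[unfolded lipschitz_below_def, rule_format, OF h]
      note g = MN(4)[unfolded lipschitz_below_def, rule_format, OF h]
      note g' = MN(4)[unfolded lipschitz_below_def, rule_format, OF h']
      let ?d = "norm (a - a') + norm (b - b')"
      have "norm (f a b z * g a b z) \<le> M * N"
        unfolding norm_mult using f g MN by (intro mult_mono) auto
      also have "\<dots> \<le> 2 * M * N" using MN by simp
      finally show "norm (f a b z * g a b z) \<le> 2 * M * N" .
      have "norm (f a b z * (g a b z - g a' b' z) + (f a b z - f a' b' z) * g a' b' z)
          \<le> M * (N * ?d) + (M * ?d) * N"
        using f g g' MN by (intro norm_triangle_mono) (auto simp: norm_mult intro!: mult_mono)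
      then show "norm (f a b z * g a b z - f a' b' z * g a' b' z) \<le> 2 * M * N * ?d"
        by (simp add: algebra_simps)
    qed
  qed (use MN in simp)
qed

text \<open>Each component of the image changes by at most M e r, where e bounds the sum of both
  errors. With M r \<le> 1/4 the error sum is halved. Keeping the inputs apart from their images
  lets the same estimate serve the iteration and uniqueness, where a solution is its own
  image.\<close>

lemma picard_contraction:
  assumes lip: "lipschitz_below f K M" "M \<ge> 0" "M * r \<le> 1/4" "0 < r"
    and bd: "\<And>z. z \<in> ball z0 r \<Longrightarrow> norm z \<le> K \<and> norm (x1 z) \<le> K \<and> norm (y1 z) \<le> K \<and>
      norm (x2 z) \<le> K \<and> norm (y2 z) \<le> K"
    and e: "\<And>z. z \<in> ball z0 r \<Longrightarrow> norm (x1 z - x2 z) + norm (y1 z - y2 z) \<le> e"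
    and d1: "\<And>z. z \<in> ball z0 r \<Longrightarrow> (X1 has_field_derivative f (x1 z) (y1 z) z) (at z)"
    and d2: "\<And>z. z \<in> ball z0 r \<Longrightarrow> (X2 has_field_derivative f (x2 z) (y2 z) z) (at z)"
    and init: "X1 z0 = X2 z0" and z: "z \<in> ball z0 r"
  shows "norm (X1 z - X2 z) \<le> e / 4"
proof -
  have e0: "e \<ge> 0"
    using e[OF z] norm_ge_zero[of "x1 z - x2 z"] norm_ge_zero[of "y1 z - y2 z"] by linarith
  have z0: "z0 \<in> ball z0 r" using \<open>0 < r\<close> by simp
  have "norm ((X1 z - X2 z) - (X1 z0 - X2 z0)) \<le> (M * e) * norm (z - z0)"
  proof (rule field_differentiable_bound[where S = "ball z0 r"])
    fix t assume t: "t \<in> ball z0 r"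
    show "((\<lambda>t. X1 t - X2 t) has_field_derivative f (x1 t) (y1 t) t - f (x2 t) (y2 t) t) (at t within ball z0 r)"
      by (rule has_field_derivative_at_within[OF DERIV_diff[OF d1[OF t] d2[OF t]]])
    have "norm (f (x1 t) (y1 t) t - f (x2 t) (y2 t) t) \<le> M * (norm (x1 t - x2 t) + norm (y1 t - y2 t))"
      using bd[OF t] by (intro lipschitz_below_diff[OF lip(1)]) auto
    also have "\<dots> \<le> M * e"
      using e[OF t] lip(2) by (rule mult_left_mono)
    finally show "norm (f (x1 t) (y1 t) t - f (x2 t) (y2 t) t) \<le> M * e" .
  qed (use z z0 in auto)
  also have "\<dots> \<le> (M * e) * r"
    using z e0 lip(2) by (intro mult_left_mono) (auto simp: dist_norm norm_minus_commute)
  also have "\<dots> \<le> e * (1/4)"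
    using mult_left_mono[OF lip(3) e0] by (simp add: mult_ac)
  finally show ?thesis using init by simp
qed

text \<open>The integral operator is realised by a holomorphic primitive on the disc, and M r \<le>
  1/4 keeps the image within distance 1 of its initial value.\<close>

lemma picard_step:
  assumes pf: "polynomial_field f" and lip: "lipschitz_below f K M" "M \<ge> 0" "M * r \<le> 1/4" "0 < r"
    and hol: "x holomorphic_on ball z0 r" "y holomorphic_on ball z0 r"
    and bd: "\<And>z. z \<in> ball z0 r \<Longrightarrow> norm z \<le> K \<and> norm (x z) \<le> K \<and> norm (y z) \<le> K"
  shows "\<exists>X. X z0 = a \<and> (\<forall>z\<in>ball z0 r. (X has_field_derivative f (x z) (y z) z) (at z) \<and>
    norm (X z - a) \<le> 1)"
proof -
  have hol': "(\<lambda>z. f (x z) (y z) z) holomorphic_on ball z0 r"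
    using pf hol by (rule polynomial_field_holomorphic)
  obtain X0 where X0: "\<And>z. z \<in> ball z0 r \<Longrightarrow>
      (X0 has_field_derivative f (x z) (y z) z) (at z within ball z0 r)"
    by (rule holomorphic_convex_primitive'[OF convex_ball open_ball hol'], rule that)
  define X where "X z = X0 z - X0 z0 + a" for z
  have X: "(X has_field_derivative f (x z) (y z) z) (at z)" if "z \<in> ball z0 r" for z
  proof -
    have "(X0 has_field_derivative f (x z) (y z) z) (at z)"
      using X0[OF that] that by (simp add: at_within_open[OF that open_ball])
    then show ?thesis
      unfolding X_def by (auto intro!: derivative_eq_intros)
  qed
  have "norm (X z - a) \<le> 1" if z: "z \<in> ball z0 r" for z
  proof -
    have z0: "z0 \<in> ball z0 r" using \<open>0 < r\<close> by simp
    have "norm (X z - X z0) \<le> M * norm (z - z0)"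
    proof (rule field_differentiable_bound[where S = "ball z0 r"])
      fix t assume t: "t \<in> ball z0 r"
      show "(X has_field_derivative f (x t) (y t) t) (at t within ball z0 r)"
        using X[OF t] by (rule has_field_derivative_at_within)
      show "norm (f (x t) (y t) t) \<le> M"
        using bd[OF t] by (intro lipschitz_below_bound[OF lip(1)]) auto
    qed (use z z0 in auto)
    also have "\<dots> \<le> M * r"
      using z lip(2) by (intro mult_left_mono) (auto simp: dist_norm norm_minus_commute)
    finally show ?thesis using lip(3) by (simp add: X_def)
  qed
  then show ?thesis
    using X by (intro exI[of _ X]) (simp add: X_def)
qed

text \<open>The radius depends only on K and not on the initial data; continuation rests on this
  uniformity. Iterates stay within distance 1 of the initial values, hence the Lipschitz constant is
  taken at K + 1.\<close>

theorem local_solution: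
  assumes pf: "polynomial_field f" "polynomial_field g" and K: "K \<ge> 0"
  shows "\<exists>r>0. \<forall>z0 a b. norm z0 \<le> K \<and> norm a \<le> K \<and> norm b \<le> K \<longrightarrow>
    (\<exists>x y. solution_on f g (ball z0 r) x y \<and> x z0 = a \<and> y z0 = b)"
proof -
  obtain M1 M2 where M12: "M1 \<ge> 0" "lipschitz_below f (K + 1) M1" "M2 \<ge> 0" "lipschitz_below g (K + 1) M2"
    using polynomial_field_lipschitz[OF pf(1), of "K + 1"] polynomial_field_lipschitz[OF pf(2), of "K + 1"] K
    by auto
  define M where "M = M1 + M2"
  have lf: "lipschitz_below f (K + 1) M" and lg: "lipschitz_below g (K + 1) M" and M: "M \<ge> 0"
    using lipschitz_below_mono[OF M12(2), of M] lipschitz_below_mono[OF M12(4), of M] M12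
    by (auto simp: M_def)
  define r where "r = 1 / (4 * (M + 1))"
  have r: "r > 0" "M * r \<le> 1/4" "r \<le> 1"
    using M by (auto simp: r_def divide_simps)
  show ?thesis
  proof (intro exI[of _ r] conjI allI impI)
    fix z0 a b :: complex assume h: "norm z0 \<le> K \<and> norm a \<le> K \<and> norm b \<le> K"
    let ?B = "ball z0 r"
    have zK: "norm z \<le> K + 1" if "z \<in> ?B" for z
      using that h r norm_triangle_sub[of z z0] by (simp add: dist_norm norm_minus_commute)
    define good where "good P \<longleftrightarrow> fst P holomorphic_on ?B \<and> snd P holomorphic_on ?B \<and>
        (\<forall>z\<in>?B. norm (fst P z - a) \<le> 1 \<and> norm (snd P z - b) \<le> 1)"
      for P :: "(complex \<Rightarrow> complex) \<times> (complex \<Rightarrow> complex)"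
    define nxt where "nxt P Q \<longleftrightarrow> fst Q z0 = a \<and> snd Q z0 = b \<and> (\<forall>z\<in>?B.
        (fst Q has_field_derivative f (fst P z) (snd P z) z) (at z) \<and>
        (snd Q has_field_derivative g (fst P z) (snd P z) z) (at z))"
      for P Q :: "(complex \<Rightarrow> complex) \<times> (complex \<Rightarrow> complex)"
    have bd: "norm z \<le> K + 1 \<and> norm (fst P z) \<le> K + 1 \<and> norm (snd P z) \<le> K + 1"
      if "good P" "z \<in> ?B" for P z
      using that zK[OF that(2)] h norm_triangle_sub[of "fst P z" a] norm_triangle_sub[of "snd P z" b]
      unfolding good_def by fastforce
    have "\<exists>Q. good Q \<and> nxt P Q" if P: "good P" for P
    proof -
      have hol: "fst P holomorphic_on ?B" "snd P holomorphic_on ?B"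
        using P by (auto simp: good_def)
      obtain X where X: "X z0 = a" "\<forall>z\<in>?B. (X has_field_derivative f (fst P z) (snd P z) z) (at z) \<and> norm (X z - a) \<le> 1"
        using picard_step[OF pf(1) lf M r(2,1) hol bd[OF P]] by blast
      obtain Y where Y: "Y z0 = b" "\<forall>z\<in>?B. (Y has_field_derivative g (fst P z) (snd P z) z) (at z) \<and> norm (Y z - b) \<le> 1"
        using picard_step[OF pf(2) lg M r(2,1) hol bd[OF P]] by blast
      have "X holomorphic_on ?B" "Y holomorphic_on ?B"
        using X(2) Y(2) by (auto simp: holomorphic_on_open)
      then show ?thesis
        using X Y by (intro exI[of _ "(X, Y)"]) (simp add: good_def nxt_def)
    qed
    moreover have "good ((\<lambda>_. a), (\<lambda>_. b))"
      by (simp add: good_def)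
    ultimately have "\<exists>P. \<forall>n. good (P n) \<and> nxt (P n) (P (Suc n))"
      by (intro dependent_nat_choice) auto
    then obtain P where P: "\<And>n. good (P n)" "\<And>n. nxt (P n) (P (Suc n))"
      by auto
    \<comment> \<open>Two functions within 1 of the same constant differ by at most 2. Afterwards
      each component error is a quarter of an error sum that is at most twice its
      predecessor.\<close>
    have close: "norm (fst (P (Suc n)) z - fst (P n) z) \<le> 2 * (1/2) ^ n \<and>
        norm (snd (P (Suc n)) z - snd (P n) z) \<le> 2 * (1/2) ^ n" if "z \<in> ?B" for n z
      using that
    proof (induction n arbitrary: z)
      case 0
      have "norm (fst (P i) z - a) \<le> 1" "norm (snd (P i) z - b) \<le> 1" for i
        using P(1)[of i] 0 by (auto simp: good_def)
      from this[of 0] this[of 1] show ?case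
        using norm_triangle_ineq4[of "fst (P 1) z - a" "fst (P 0) z - a"]
          norm_triangle_ineq4[of "snd (P 1) z - b" "snd (P 0) z - b"] by simp
    next
      case (Suc n)
      have e: "norm (fst (P (Suc n)) t - fst (P n) t) + norm (snd (P (Suc n)) t - snd (P n) t)
          \<le> 4 * (1/2) ^ n" if "t \<in> ?B" for t
        using Suc.IH[OF that] by linarith
      have b: "norm t \<le> K + 1 \<and> norm (fst (P (Suc n)) t) \<le> K + 1 \<and> norm (snd (P (Suc n)) t) \<le> K + 1 \<and>
          norm (fst (P n) t) \<le> K + 1 \<and> norm (snd (P n) t) \<le> K + 1" if "t \<in> ?B" for t
        using bd[OF P(1) that, of n] bd[OF P(1) that, of "Suc n"] by simp
      have "norm (fst (P (Suc (Suc n))) z - fst (P (Suc n)) z) \<le> 4 * (1/2) ^ n / 4"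
        by (rule picard_contraction[OF lf M r(2,1) b e])
          (use P(2)[of n] P(2)[of "Suc n"] Suc.prems in \<open>auto simp: nxt_def\<close>)
      moreover have "norm (snd (P (Suc (Suc n))) z - snd (P (Suc n)) z) \<le> 4 * (1/2) ^ n / 4"
        by (rule picard_contraction[OF lg M r(2,1) b e])
          (use P(2)[of n] P(2)[of "Suc n"] Suc.prems in \<open>auto simp: nxt_def\<close>)
      ultimately show ?case by simp
    qed
    have summ: "summable (\<lambda>n. 2 * (1/2 :: real) ^ n)"
      by (intro summable_mult summable_geometric) simp
    have lim: "\<exists>x. uniform_limit ?B (\<lambda>n. p (P n)) x sequentially"
      if p: "\<And>n z. z \<in> ?B \<Longrightarrow> norm (p (P (Suc n)) z - p (P n) z) \<le> 2 * (1/2) ^ n"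
      for p :: "_ \<Rightarrow> complex \<Rightarrow> complex"
    proof -
      have "uniform_limit ?B (\<lambda>n z. \<Sum>i<n. p (P (Suc i)) z - p (P i) z)
          (\<lambda>z. suminf (\<lambda>i. p (P (Suc i)) z - p (P i) z)) sequentially"
        by (rule Weierstrass_m_test[OF p summ])
      then have "uniform_limit ?B (\<lambda>n z. (\<Sum>i<n. p (P (Suc i)) z - p (P i) z) + p (P 0) z)
          (\<lambda>z. suminf (\<lambda>i. p (P (Suc i)) z - p (P i) z) + p (P 0) z) sequentially"
        by (intro uniform_limit_add uniform_limit_const)
      moreover have "(\<Sum>i<n. p (P (Suc i)) z - p (P i) z) + p (P 0) z = p (P n) z" for n z
        by (simp add: sum_lessThan_telescope[of "\<lambda>i. p (P i) z"])
      ultimately show ?thesis by auto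
    qed
    obtain x where x: "uniform_limit ?B (\<lambda>n. fst (P n)) x sequentially"
      using lim[of fst] close by blast
    obtain y where y: "uniform_limit ?B (\<lambda>n. snd (P n)) y sequentially"
      using lim[of snd] close by blast
    have xl: "(\<lambda>n. fst (P n) z) \<longlonglongrightarrow> x z" and yl: "(\<lambda>n. snd (P n) z) \<longlonglongrightarrow> y z" if "z \<in> ?B" for z
      using tendsto_uniform_limitI[OF x that] tendsto_uniform_limitI[OF y that] by auto
    have bxy: "norm (x z) \<le> K + 1 \<and> norm (y z) \<le> K + 1" if "z \<in> ?B" for z
    proof -
      have "norm (x z) \<le> K + 1"
        by (rule Lim_bounded[OF tendsto_norm[OF xl[OF that]], of 0]) (use bd[OF P(1) that] in auto)
      moreover have "norm (y z) \<le> K + 1"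
        by (rule Lim_bounded[OF tendsto_norm[OF yl[OF that]], of 0]) (use bd[OF P(1) that] in auto)
      ultimately show ?thesis ..
    qed
    have conv: "(\<lambda>n. h (fst (P n) z) (snd (P n) z) z) \<longlonglongrightarrow> h (x z) (y z) z"
      if z: "z \<in> ?B" and lh: "lipschitz_below h (K + 1) M" for z h
    proof (rule LIM_zero_cancel, rule Lim_null_comparison[OF always_eventually], rule allI)
      fix n
      show "norm (h (fst (P n) z) (snd (P n) z) z - h (x z) (y z) z)
          \<le> M * (norm (fst (P n) z - x z) + norm (snd (P n) z - y z))"
        using bd[OF P(1) z, of n] bxy[OF z] by (intro lipschitz_below_diff[OF lh]) auto
    next
      have "(\<lambda>n. M * (norm (fst (P n) z - x z) + norm (snd (P n) z - y z))) \<longlonglongrightarrow> M * (norm (x z - x z) + norm (y z - y z))"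
        by (intro tendsto_intros xl yl z)
      then show "(\<lambda>n. M * (norm (fst (P n) z - x z) + norm (snd (P n) z - y z))) \<longlonglongrightarrow> 0"
        by simp
    qed
    have cball: "\<exists>d. 0 < d \<and> cball z d \<subseteq> ?B" if "z \<in> ?B" for z
      using open_contains_cball[of ?B] that by blast
    have ux: "\<exists>d. 0 < d \<and> cball z d \<subseteq> ?B \<and> uniform_limit (cball z d) (\<lambda>n. fst (P (Suc n))) x sequentially"
      and uy: "\<exists>d. 0 < d \<and> cball z d \<subseteq> ?B \<and> uniform_limit (cball z d) (\<lambda>n. snd (P (Suc n))) y sequentially"
      if "z \<in> ?B" for z
    proof -
      note zB = that
      obtain d where d: "0 < d" "cball z d \<subseteq> ?B" using cball[OF zB] by blast
      show "\<exists>d. 0 < d \<and> cball z d \<subseteq> ?B \<and> uniform_limit (cball z d) (\<lambda>n. fst (P (Suc n))) x sequentially"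
        by (intro exI[of _ d] conjI d uniform_limit_on_subset[OF filterlim_compose[OF x filterlim_Suc]])
      show "\<exists>d. 0 < d \<and> cball z d \<subseteq> ?B \<and> uniform_limit (cball z d) (\<lambda>n. snd (P (Suc n))) y sequentially"
        by (intro exI[of _ d] conjI d uniform_limit_on_subset[OF filterlim_compose[OF y filterlim_Suc]])
    qed
    have "\<exists>x'. \<forall>z\<in>?B. (x has_field_derivative x' z) (at z) \<and>
        (\<lambda>n. f (fst (P n) z) (snd (P n) z) z) \<longlonglongrightarrow> x' z"
      by (rule has_complex_derivative_uniform_sequence[OF open_ball _ ux])
        (use P(2) in \<open>auto simp: nxt_def\<close>)
    then obtain x' where x': "\<forall>z\<in>?B. (x has_field_derivative x' z) (at z) \<and>
        (\<lambda>n. f (fst (P n) z) (snd (P n) z) z) \<longlonglongrightarrow> x' z" ..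
    have "\<exists>y'. \<forall>z\<in>?B. (y has_field_derivative y' z) (at z) \<and>
        (\<lambda>n. g (fst (P n) z) (snd (P n) z) z) \<longlonglongrightarrow> y' z"
      by (rule has_complex_derivative_uniform_sequence[OF open_ball _ uy])
        (use P(2) in \<open>auto simp: nxt_def\<close>)
    then obtain y' where y': "\<forall>z\<in>?B. (y has_field_derivative y' z) (at z) \<and>
        (\<lambda>n. g (fst (P n) z) (snd (P n) z) z) \<longlonglongrightarrow> y' z" ..
    have "x' z = f (x z) (y z) z" "y' z = g (x z) (y z) z" if "z \<in> ?B" for z
      by (rule LIMSEQ_unique[OF conjunct2[OF x'[rule_format, OF that]] conv[OF that lf]],
          rule LIMSEQ_unique[OF conjunct2[OF y'[rule_format, OF that]] conv[OF that lg]])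
    then have "solution_on f g ?B x y"
      using x' y' by (auto simp: solution_on_def)
    moreover have "x z0 = a" "y z0 = b"
    proof -
      have z0: "z0 \<in> ?B" using r by simp
      have "(\<lambda>n. fst (P (Suc n)) z0) \<longlonglongrightarrow> x z0" "(\<lambda>n. snd (P (Suc n)) z0) \<longlonglongrightarrow> y z0"
        using xl[OF z0] yl[OF z0] by (auto intro: LIMSEQ_Suc)
      moreover have "fst (P (Suc n)) z0 = a" "snd (P (Suc n)) z0 = b" for n
        using P(2)[of n] by (auto simp: nxt_def)
      ultimately show "x z0 = a" "y z0 = b"
        by (auto dest: LIMSEQ_const_iff[THEN iffD1])
    qed
    ultimately show "\<exists>x y. solution_on f g ?B x y \<and> x z0 = a \<and> y z0 = b"
      by blast
  qed (rule r)
qed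

text \<open>Both solutions are fixed by the integral operator, so the contraction estimate can be
  repeated on the pair itself and their distance is below every 4 K / 2^n.\<close>

theorem local_uniqueness:
  assumes pf: "polynomial_field f" "polynomial_field g"
    and S: "open S" "z0 \<in> S"
    and s1: "solution_on f g S x1 y1" and s2: "solution_on f g S x2 y2"
    and init: "x1 z0 = x2 z0" "y1 z0 = y2 z0"
  shows "\<exists>r>0. ball z0 r \<subseteq> S \<and> (\<forall>z\<in>ball z0 r. x1 z = x2 z \<and> y1 z = y2 z)"
proof -
  have cont: "continuous_on S x1" "continuous_on S y1" "continuous_on S x2" "continuous_on S y2"
    using s1 s2 unfolding solution_on_def
    by (auto intro!: continuous_at_imp_continuous_on dest: DERIV_isCont)
  obtain d where d: "d > 0" "cball z0 d \<subseteq> S"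
    using open_contains_cball S by blast
  have bdd: "\<exists>C. \<forall>z\<in>cball z0 d. norm (h z) \<le> C" if "continuous_on S h" for h :: "complex \<Rightarrow> complex"
    using compact_continuous_image[OF continuous_on_subset[OF that d(2)] compact_cball]
    by (auto dest!: compact_imp_bounded simp: bounded_iff)
  obtain C1 C2 C3 C4 where C: "\<And>z. z \<in> cball z0 d \<Longrightarrow> norm (x1 z) \<le> C1"
      "\<And>z. z \<in> cball z0 d \<Longrightarrow> norm (y1 z) \<le> C2" "\<And>z. z \<in> cball z0 d \<Longrightarrow> norm (x2 z) \<le> C3"
      "\<And>z. z \<in> cball z0 d \<Longrightarrow> norm (y2 z) \<le> C4"
    using bdd[OF cont(1)] bdd[OF cont(2)] bdd[OF cont(3)] bdd[OF cont(4)] by blast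
  define K where "K = \<bar>C1\<bar> + \<bar>C2\<bar> + \<bar>C3\<bar> + \<bar>C4\<bar> + norm z0 + d"
  have K: "K \<ge> 0" using d by (simp add: K_def)
  obtain M1 M2 where M12: "M1 \<ge> 0" "lipschitz_below f K M1" "M2 \<ge> 0" "lipschitz_below g K M2"
    using polynomial_field_lipschitz[OF pf(1) K] polynomial_field_lipschitz[OF pf(2) K] by auto
  define M where "M = M1 + M2"
  have lf: "lipschitz_below f K M" and lg: "lipschitz_below g K M" and M: "M \<ge> 0"
    using lipschitz_below_mono[OF M12(2), of M] lipschitz_below_mono[OF M12(4), of M] M12
    by (auto simp: M_def)
  define r where "r = min d (1 / (4 * (M + 1)))"
  have "M * r \<le> M * (1 / (4 * (M + 1)))"
    using M by (intro mult_left_mono) (auto simp: r_def)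
  also have "\<dots> \<le> 1/4" using M by (simp add: divide_simps)
  finally have r: "r > 0" "M * r \<le> 1/4" "r \<le> d"
    using M d by (auto simp: r_def)
  have bd: "norm z \<le> K \<and> norm (x1 z) \<le> K \<and> norm (y1 z) \<le> K \<and> norm (x2 z) \<le> K \<and> norm (y2 z) \<le> K"
    if z: "z \<in> ball z0 r" for z
  proof -
    have zc: "z \<in> cball z0 d" using that r by auto
    have "norm z \<le> norm z0 + d"
      using zc norm_triangle_sub[of z z0] by (simp add: dist_norm norm_minus_commute)
    then show ?thesis
      using C[OF zc] d(1) norm_ge_zero[of z0] unfolding K_def by linarith
  qed
  have sub: "ball z0 r \<subseteq> S" using r d by auto
  have D: "norm (x1 z - x2 z) + norm (y1 z - y2 z) \<le> 4 * K * (1/2) ^ n" if "z \<in> ball z0 r" for z n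
    using that
  proof (induction n arbitrary: z)
    case 0
    then show ?case
      using bd[OF 0] norm_triangle_ineq4[of "x1 z" "x2 z"] norm_triangle_ineq4[of "y1 z" "y2 z"]
      by simp
  next
    case (Suc n)
    have "norm (x1 z - x2 z) \<le> 4 * K * (1/2) ^ n / 4"
      by (rule picard_contraction[OF lf M r(2,1) bd Suc.IH])
        (use s1 s2 sub init Suc.prems in \<open>auto simp: solution_on_def\<close>)
    moreover have "norm (y1 z - y2 z) \<le> 4 * K * (1/2) ^ n / 4"
      by (rule picard_contraction[OF lg M r(2,1) bd Suc.IH])
        (use s1 s2 sub init Suc.prems in \<open>auto simp: solution_on_def\<close>)
    ultimately show ?case by simp
  qed
  have "norm (x1 z - x2 z) + norm (y1 z - y2 z) \<le> 0" if "z \<in> ball z0 r" for z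
  proof (rule LIMSEQ_le_const)
    have "(\<lambda>n. 4 * K * (1/2) ^ n) \<longlonglongrightarrow> 4 * K * 0"
      by (intro tendsto_intros LIMSEQ_realpow_zero) auto
    then show "(\<lambda>n. 4 * K * (1/2) ^ n) \<longlonglongrightarrow> 0" by simp
  qed (use D[OF that] in blast)
  note le0 = this
  have "x1 z = x2 z \<and> y1 z = y2 z" if "z \<in> ball z0 r" for z
  proof -
    have "norm (x1 z - x2 z) \<le> 0 \<and> norm (y1 z - y2 z) \<le> 0"
      using le0[OF that] norm_ge_zero[of "x1 z - x2 z"] norm_ge_zero[of "y1 z - y2 z"]
      by linarith
    then show ?thesis by simp
  qed
  then show ?thesis
    using r sub by blast
qed

subsection \<open>Holomorphic sections that solve the system\<close>

fun chart_field_fst :: "complex \<Rightarrow> chart \<Rightarrow> rhs"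
  where
    "chart_field_fst \<alpha> XY = PII_x \<alpha>"
  | "chart_field_fst \<alpha> (UW \<sigma>) = uw_field_u \<alpha> \<sigma>"

fun chart_field_snd :: "complex \<Rightarrow> chart \<Rightarrow> rhs"
  where
    "chart_field_snd \<alpha> XY = PII_y"
  | "chart_field_snd \<alpha> (UW \<sigma>) = uw_field_w \<alpha> \<sigma>"

abbreviation chart_solution :: "complex \<Rightarrow> chart \<Rightarrow> complex set \<Rightarrow> (complex \<Rightarrow> complex) \<Rightarrow>
    (complex \<Rightarrow> complex) \<Rightarrow> bool"
  where "chart_solution \<alpha> i \<equiv> solution_on (chart_field_fst \<alpha> i) (chart_field_snd \<alpha> i)"

lemma polynomial_chart_field:
  "polynomial_field (chart_field_fst \<alpha> i)" "polynomial_field (chart_field_snd \<alpha> i)"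
proof -
  note intros = polynomial_field.intros polynomial_field_power polynomial_field_minus
  have "polynomial_field (\<lambda>x y z. 2 * y^3 + y * z + \<alpha>)"
    by (intro intros)
  moreover have "polynomial_field (\<lambda>x y z. x)"
    by (intro intros)
  moreover have "polynomial_field (\<lambda>u w z. (u * w^2 - uw_shift \<alpha> \<sigma> * w - pm_val \<sigma> / 2 * z)
      * (2 * u * w - uw_shift \<alpha> \<sigma>))" for \<sigma>
    by (intro intros)
  moreover have "polynomial_field (\<lambda>u w z. (-1) * (u * w^4) + pm_val \<sigma> + pm_val \<sigma> / 2 * z * w^2
      + uw_shift \<alpha> \<sigma> * w^3)" for \<sigma>
    by (intro intros)
  ultimately show "polynomial_field (chart_field_fst \<alpha> i)" "polynomial_field (chart_field_snd \<alpha> i)"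
    by (cases i; simp add: PII_x_def[abs_def] PII_y_def[abs_def] uw_field_u_def[abs_def]
        uw_field_w_def[abs_def])+
qed

lemma solution_on_subset: "solution_on f g S x y \<Longrightarrow> T \<subseteq> S \<Longrightarrow> solution_on f g T x y"
  by (auto simp: solution_on_def)

lemma solution_on_continuous:
  assumes "solution_on f g S x y"
  shows "continuous_on S x" "continuous_on S y"
  using assms by (auto simp: solution_on_def intro!: continuous_at_imp_continuous_on dest: DERIV_isCont)

lemma solution_XY_to_UW:
  assumes "chart_solution \<alpha> XY N x y" "\<And>t. t \<in> N \<Longrightarrow> y t \<noteq> 0"
  shows "chart_solution \<alpha> (UW \<sigma>) N (\<lambda>t. fst (xy_to_uw \<alpha> \<sigma> t (x t, y t)))
    (\<lambda>t. snd (xy_to_uw \<alpha> \<sigma> t (x t, y t)))"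
  unfolding solution_on_def
proof
  fix z assume z: "z \<in> N"
  have d: "(x has_field_derivative PII_x \<alpha> (x z) (y z) z) (at z)"
    "(y has_field_derivative PII_y (x z) (y z) z) (at z)"
    using assms(1) z by (auto simp: solution_on_def)
  have "((\<lambda>t. coord_u \<alpha> \<sigma> t (x t, y t)) has_field_derivative
      uw_field_u \<alpha> \<sigma> (coord_u \<alpha> \<sigma> z (x z, y z)) (coord_w (x z, y z)) z) (at z) \<and>
    ((\<lambda>t. coord_w (x t, y t)) has_field_derivative
      uw_field_w \<alpha> \<sigma> (coord_u \<alpha> \<sigma> z (x z, y z)) (coord_w (x z, y z)) z) (at z)"
    by (rule expressed_in_uw_PII[of \<alpha> \<sigma>, unfolded expressed_in_uw_def, rule_format])
      (use d assms(2)[OF z] in simp_all)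
  then show "((\<lambda>t. fst (xy_to_uw \<alpha> \<sigma> t (x t, y t))) has_field_derivative
      chart_field_fst \<alpha> (UW \<sigma>) (fst (xy_to_uw \<alpha> \<sigma> z (x z, y z))) (snd (xy_to_uw \<alpha> \<sigma> z (x z, y z))) z) (at z) \<and>
    ((\<lambda>t. snd (xy_to_uw \<alpha> \<sigma> t (x t, y t))) has_field_derivative
      chart_field_snd \<alpha> (UW \<sigma>) (fst (xy_to_uw \<alpha> \<sigma> z (x z, y z))) (snd (xy_to_uw \<alpha> \<sigma> z (x z, y z))) z) (at z)"
    unfolding xy_to_uw_def fst_conv snd_conv chart_field_fst.simps chart_field_snd.simps .
qed

text \<open>It suffices that the derivatives X and Y exist. The forward chain rule along the
  transformed curve gives two linear equations for them, triangular with coefficients that are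
  powers of y, and these determine X and Y because y does not vanish.\<close>

lemma solution_UW_to_XY:
  assumes "chart_solution \<alpha> (UW \<sigma>) N u w" "\<And>t. t \<in> N \<Longrightarrow> w t \<noteq> 0" "open N"
  shows "chart_solution \<alpha> XY N (\<lambda>t. fst (uw_to_xy \<alpha> \<sigma> t (u t, w t)))
    (\<lambda>t. snd (uw_to_xy \<alpha> \<sigma> t (u t, w t)))" (is "chart_solution \<alpha> XY N ?x ?y")
  unfolding solution_on_def
proof
  fix z assume z: "z \<in> N"
  have w: "w z \<noteq> 0" using assms(2) z .
  have du: "(u has_field_derivative uw_field_u \<alpha> \<sigma> (u z) (w z) z) (at z)"
    and dw: "(w has_field_derivative uw_field_w \<alpha> \<sigma> (u z) (w z) z) (at z)"
    using assms(1) z by (auto simp: solution_on_def)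
  have "\<exists>X. (?x has_field_derivative X) (at z)"
    unfolding uw_to_xy_def fst_conv snd_conv using w
    by (intro exI) (rule derivative_eq_intros du dw refl | assumption)+
  then obtain X where X: "(?x has_field_derivative X) (at z)" by blast
  have "\<exists>Y. (?y has_field_derivative Y) (at z)"
    unfolding uw_to_xy_def fst_conv snd_conv using w
    by (intro exI) (rule derivative_eq_intros du dw refl | assumption)+
  then obtain Y where Y: "(?y has_field_derivative Y) (at z)" by blast
  have y: "?y z \<noteq> 0" using w by simp
  have inv: "coord_u \<alpha> \<sigma> t (?x t, ?y t) = u t" "coord_w (?x t, ?y t) = w t" if "t \<in> N" for t
    using xy_to_uw_uw_to_xy[of "(u t, w t)" \<alpha> \<sigma> t] assms(2)[OF that]
    unfolding prod.collapse by (simp_all add: xy_to_uw_def)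
  have "((\<lambda>t. coord_u \<alpha> \<sigma> t (?x t, ?y t)) has_field_derivative uw_field_u \<alpha> \<sigma> (u z) (w z) z) (at z)"
    by (rule has_field_derivative_transform_within_open[OF du assms(3) z]) (simp only: inv)
  from DERIV_unique[OF this coord_u_curve[OF X Y]]
  have 1: "uw_field_u \<alpha> \<sigma> (u z) (w z) z =
      X * (?y z)^2 + coord_u_dy \<alpha> \<sigma> z (?x z) (?y z) * Y + pm_val \<sigma> * (?y z)^2 / 2" .
  have "((\<lambda>t. coord_w (?x t, ?y t)) has_field_derivative uw_field_w \<alpha> \<sigma> (u z) (w z) z) (at z)"
    by (rule has_field_derivative_transform_within_open[OF dw assms(3) z]) (simp only: inv)
  from DERIV_unique[OF this coord_w_curve[OF Y y]]
  have 2: "uw_field_w \<alpha> \<sigma> (u z) (w z) z = - Y / (?y z)^2" .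
  note e = expressed_in_uw_PII[of \<alpha> \<sigma>, unfolded expressed_in_uw_iff, rule_format, OF UNIV_I y, of z "?x z"]
  have iw: "inverse (?y z) = w z" by simp
  have y2: "(?y z)^2 \<noteq> 0" using y by simp
  note e = e[unfolded inv(1)[OF z] iw 1 2]
  have Y': "Y = PII_y (?x z) (?y z) z"
    using e y2 by (simp only: divide_cancel_right minus_equation_iff[of Y] minus_minus) simp
  moreover have "X = PII_x \<alpha> (?x z) (?y z) z"
    using e y2 unfolding Y' by (simp only: add_right_cancel mult_cancel_right) simp
  ultimately show "(?x has_field_derivative chart_field_fst \<alpha> XY (?x z) (?y z) z) (at z) \<and>
    (?y has_field_derivative chart_field_snd \<alpha> XY (?x z) (?y z) z) (at z)"
    using X Y by simp
qed

lemma solution_transition: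
  assumes s: "chart_solution \<alpha> i N a b" and ov: "\<And>t. t \<in> N \<Longrightarrow> (a t, b t) \<in> overlap i j"
    and N: "open N"
  shows "chart_solution \<alpha> j N (\<lambda>t. fst (transition_map \<alpha> t i j (a t, b t)))
    (\<lambda>t. snd (transition_map \<alpha> t i j (a t, b t)))"
proof (cases "i = j")
  case True
  then have "transition_map \<alpha> t i j p = p" for t p by (cases i) auto
  then show ?thesis using s True by simp
next
  case False
  then have nz: "b t \<noteq> 0" if "t \<in> N" for t
    using ov[OF that] by (simp add: overlap_def)
  show ?thesis
  proof (cases i)
    case XY
    then obtain \<tau> where j: "j = UW \<tau>" using False by (cases j) auto
    show ?thesis
      using solution_XY_to_UW[of \<alpha> N a b \<tau>] s nz XY j by simp
  next
    case (UW \<sigma>)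
    have xy: "chart_solution \<alpha> XY N (\<lambda>t. fst (uw_to_xy \<alpha> \<sigma> t (a t, b t)))
        (\<lambda>t. snd (uw_to_xy \<alpha> \<sigma> t (a t, b t)))"
      using solution_UW_to_XY[of \<alpha> \<sigma> N a b] s nz N UW by simp
    show ?thesis
    proof (cases j)
      case XY
      then show ?thesis using xy UW by simp
    next
      case (UW \<tau>)
      then have "\<sigma> \<noteq> \<tau>" using False \<open>i = UW \<sigma>\<close> by simp
      have "chart_solution \<alpha> (UW \<tau>) N
          (\<lambda>t. fst (xy_to_uw \<alpha> \<tau> t (fst (uw_to_xy \<alpha> \<sigma> t (a t, b t)), snd (uw_to_xy \<alpha> \<sigma> t (a t, b t)))))
          (\<lambda>t. snd (xy_to_uw \<alpha> \<tau> t (fst (uw_to_xy \<alpha> \<sigma> t (a t, b t)), snd (uw_to_xy \<alpha> \<sigma> t (a t, b t)))))"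
        by (rule solution_XY_to_UW[OF xy]) (use nz in simp)
      then show ?thesis
        using UW \<open>i = UW \<sigma>\<close> \<open>\<sigma> \<noteq> \<tau>\<close> unfolding prod.collapse by simp
    qed
  qed
qed

text \<open>Solutions continued through their poles. Values are normal forms instead of classes, so
  points of a fibre are compared by plain equality while the chart may change from place to
  place.\<close>

definition section_on :: "complex \<Rightarrow> complex set \<Rightarrow> (complex \<Rightarrow> chart_point) \<Rightarrow> bool"
  where "section_on \<alpha> S s \<longleftrightarrow> (\<forall>z\<in>S. \<exists>N i a b. open N \<and> z \<in> N \<and> N \<subseteq> S \<and>
    chart_solution \<alpha> i N a b \<and> (\<forall>t\<in>N. s t = normal_form \<alpha> t (i, (a t, b t))))"

lemma section_onE:
  assumes "section_on \<alpha> S s" "z \<in> S"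
  obtains N i a b where "open N" "z \<in> N" "N \<subseteq> S" "chart_solution \<alpha> i N a b"
    "\<And>t. t \<in> N \<Longrightarrow> s t = normal_form \<alpha> t (i, (a t, b t))"
proof -
  have "\<exists>N i a b. open N \<and> z \<in> N \<and> N \<subseteq> S \<and> chart_solution \<alpha> i N a b \<and>
      (\<forall>t\<in>N. s t = normal_form \<alpha> t (i, (a t, b t)))"
    using assms by (simp add: section_on_def)
  then show thesis
    by (elim exE conjE) (rule that; (assumption | erule (1) bspec))
qed

lemma section_on_chart:
  assumes "chart_solution \<alpha> i N a b" "open N"
  shows "section_on \<alpha> N (\<lambda>t. normal_form \<alpha> t (i, (a t, b t)))"
  unfolding section_on_def
proof
  fix z assume "z \<in> N"
  then show "\<exists>M j c d. open M \<and> z \<in> M \<and> M \<subseteq> N \<and> chart_solution \<alpha> j M c d \<and>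
      (\<forall>t\<in>M. normal_form \<alpha> t (i, (a t, b t)) = normal_form \<alpha> t (j, (c t, d t)))"
    using assms
    by - (rule exI[of _ N], rule exI[of _ i], rule exI[of _ a], rule exI[of _ b], simp)
qed

lemma section_on_subset:
  assumes "section_on \<alpha> S s" "open T" "T \<subseteq> S"
  shows "section_on \<alpha> T s"
  unfolding section_on_def
proof
  fix z assume z: "z \<in> T"
  obtain N i a b where N: "open N" "z \<in> N" "N \<subseteq> S" "chart_solution \<alpha> i N a b"
    "\<And>t. t \<in> N \<Longrightarrow> s t = normal_form \<alpha> t (i, (a t, b t))"
    by (rule section_onE[OF assms(1), of z]) (use z assms(3) in auto)
  have "chart_solution \<alpha> i (N \<inter> T) a b"
    using N(4) by (rule solution_on_subset) simp
  then show "\<exists>N i a b. open N \<and> z \<in> N \<and> N \<subseteq> T \<and> chart_solution \<alpha> i N a b \<and>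
      (\<forall>t\<in>N. s t = normal_form \<alpha> t (i, (a t, b t)))"
    using N z assms(2)
    by - (rule exI[of _ "N \<inter> T"], rule exI[of _ i], rule exI[of _ a], rule exI[of _ b], auto)
qed

lemma section_on_cong:
  assumes "section_on \<alpha> S s" "\<And>t. t \<in> S \<Longrightarrow> s' t = s t"
  shows "section_on \<alpha> S s'"
  unfolding section_on_def
proof
  fix z assume z: "z \<in> S"
  obtain N i a b where N: "open N" "z \<in> N" "N \<subseteq> S" "chart_solution \<alpha> i N a b"
    "\<And>t. t \<in> N \<Longrightarrow> s t = normal_form \<alpha> t (i, (a t, b t))"
    by (rule section_onE[OF assms(1) z]) auto
  then show "\<exists>N i a b. open N \<and> z \<in> N \<and> N \<subseteq> S \<and> chart_solution \<alpha> i N a b \<and>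
      (\<forall>t\<in>N. s' t = normal_form \<alpha> t (i, (a t, b t)))"
    using assms(2)
    by - (rule exI[of _ N], rule exI[of _ i], rule exI[of _ a], rule exI[of _ b], auto)
qed

lemma section_on_local:
  assumes "\<And>z. z \<in> S \<Longrightarrow> \<exists>T. open T \<and> z \<in> T \<and> T \<subseteq> S \<and> section_on \<alpha> T s"
  shows "section_on \<alpha> S s"
  unfolding section_on_def
proof
  fix z assume "z \<in> S"
  then obtain T where T: "open T" "z \<in> T" "T \<subseteq> S" "section_on \<alpha> T s"
    using assms by blast
  obtain N i a b where N: "open N" "z \<in> N" "N \<subseteq> T" "chart_solution \<alpha> i N a b"
    "\<And>t. t \<in> N \<Longrightarrow> s t = normal_form \<alpha> t (i, (a t, b t))"
    by (rule section_onE[OF T(4,2)]) auto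
  then show "\<exists>N i a b. open N \<and> z \<in> N \<and> N \<subseteq> S \<and> chart_solution \<alpha> i N a b \<and>
      (\<forall>t\<in>N. s t = normal_form \<alpha> t (i, (a t, b t)))"
    using T(3)
    by - (rule exI[of _ N], rule exI[of _ i], rule exI[of _ a], rule exI[of _ b], auto)
qed

text \<open>Overlaps are open, so near z a local solution can be rewritten in any chart that
  contains its value at z.\<close>

lemma section_in_chart:
  assumes s: "section_on \<alpha> S s" and z: "z \<in> S" and q: "s z = normal_form \<alpha> z (j, q)"
  obtains N a b where "open N" "z \<in> N" "N \<subseteq> S" "chart_solution \<alpha> j N a b"
    "\<And>t. t \<in> N \<Longrightarrow> s t = normal_form \<alpha> t (j, (a t, b t))" "(a z, b z) = q"
proof -
  obtain N i a b where N: "open N" "z \<in> N" "N \<subseteq> S" "chart_solution \<alpha> i N a b"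
    "\<And>t. t \<in> N \<Longrightarrow> s t = normal_form \<alpha> t (i, (a t, b t))"
    by (rule section_onE[OF s z]) auto
  have zq: "(a z, b z) \<in> overlap i j" "q = transition_map \<alpha> z i j (a z, b z)"
    using N(5)[OF N(2)] q normal_form_eq_iff[of \<alpha> z i "(a z, b z)" j q] by simp_all
  define M where "M = {t \<in> N. (a t, b t) \<in> overlap i j}"
  have "continuous_on N (\<lambda>t. (a t, b t))"
    using solution_on_continuous[OF N(4)] by (intro continuous_on_Pair)
  then have M: "open M"
    using continuous_open_preimage[OF _ N(1) open_overlap, of "\<lambda>t. (a t, b t)" i j]
    by (simp add: M_def vimage_def Int_def)
  have sub: "M \<subseteq> N" by (auto simp: M_def)
  show ?thesis
  proof (rule that[OF M])
    show "z \<in> M" using N(2) zq by (simp add: M_def)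
    show "M \<subseteq> S" using sub N(3) by blast
    show "chart_solution \<alpha> j M (\<lambda>t. fst (transition_map \<alpha> t i j (a t, b t)))
        (\<lambda>t. snd (transition_map \<alpha> t i j (a t, b t)))"
      by (rule solution_transition[OF solution_on_subset[OF N(4) sub] _ M]) (simp add: M_def)
    show "(fst (transition_map \<alpha> z i j (a z, b z)), snd (transition_map \<alpha> z i j (a z, b z))) = q"
      using zq by simp
    fix t assume t: "t \<in> M"
    then have "s t = normal_form \<alpha> t (i, (a t, b t))"
      using N(5) sub by auto
    also have "\<dots> = normal_form \<alpha> t (j, transition_map \<alpha> t i j (a t, b t))"
      unfolding normal_form_eq_iff using t by (simp add: M_def)
    finally show "s t = normal_form \<alpha> t (j, (fst (transition_map \<alpha> t i j (a t, b t)),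
        snd (transition_map \<alpha> t i j (a t, b t))))"
      by simp
  qed
qed

text \<open>The agreement set is open by local uniqueness in a common chart. Its complement is open
  because the total space is Hausdorff, which also covers values that lie in different
  charts.\<close>

theorem section_unique:
  assumes S: "open S" "connected S" and s: "section_on \<alpha> S s1" "section_on \<alpha> S s2"
    and z0: "z0 \<in> S" "s1 z0 = s2 z0" and z: "z \<in> S"
  shows "s1 z = s2 z"
proof -
  let ?A = "{z \<in> S. s1 z = s2 z}" and ?B = "{z \<in> S. s1 z \<noteq> s2 z}"
  have "\<exists>T. open T \<and> t \<in> T \<and> T \<subseteq> ?A" if t: "t \<in> ?A" for t
  proof -
    have tS: "t \<in> S" and eq: "s1 t = s2 t" using t by auto
    obtain N1 i a1 b1 where N1: "open N1" "t \<in> N1" "N1 \<subseteq> S" "chart_solution \<alpha> i N1 a1 b1"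
      "\<And>t. t \<in> N1 \<Longrightarrow> s1 t = normal_form \<alpha> t (i, (a1 t, b1 t))"
      by (rule section_onE[OF s(1) tS]) auto
    have "s2 t = normal_form \<alpha> t (i, (a1 t, b1 t))"
      using eq N1(2,5) by simp
    then obtain N2 a2 b2 where N2: "open N2" "t \<in> N2" "N2 \<subseteq> S" "chart_solution \<alpha> i N2 a2 b2"
      "\<And>t. t \<in> N2 \<Longrightarrow> s2 t = normal_form \<alpha> t (i, (a2 t, b2 t))" "(a2 t, b2 t) = (a1 t, b1 t)"
      by (rule section_in_chart[OF s(2) tS]) auto
    have "\<exists>r>0. ball t r \<subseteq> N1 \<inter> N2 \<and> (\<forall>z\<in>ball t r. a1 z = a2 z \<and> b1 z = b2 z)"
      by (rule local_uniqueness[OF polynomial_chart_field[of \<alpha> i]])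
        (use N1(1,2) N2(1,2,6) solution_on_subset[OF N1(4)] solution_on_subset[OF N2(4)] in auto)
    then obtain r where r: "r > 0" "ball t r \<subseteq> N1 \<inter> N2" "\<And>z. z \<in> ball t r \<Longrightarrow> a1 z = a2 z \<and> b1 z = b2 z"
      by blast
    have "ball t r \<subseteq> ?A"
    proof
      fix z assume z: "z \<in> ball t r"
      then have "z \<in> N1" "z \<in> N2" using r(2) by blast+
      then show "z \<in> ?A"
        using r(3)[OF z] N1(3) N1(5)[of z] N2(5)[of z] by auto
    qed
    then show ?thesis
      using r(1) by (intro exI[of _ "ball t r"]) simp
  qed
  then have A: "open ?A" by (subst open_subopen) blast
  have "\<exists>T. open T \<and> t \<in> T \<and> T \<subseteq> ?B" if t: "t \<in> ?B" for t
  proof -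
    have tS: "t \<in> S" and ne: "s1 t \<noteq> s2 t" using t by auto
    obtain N1 i a1 b1 where N1: "open N1" "t \<in> N1" "N1 \<subseteq> S" "chart_solution \<alpha> i N1 a1 b1"
      "\<And>t. t \<in> N1 \<Longrightarrow> s1 t = normal_form \<alpha> t (i, (a1 t, b1 t))"
      by (rule section_onE[OF s(1) tS]) auto
    obtain N2 j a2 b2 where N2: "open N2" "t \<in> N2" "N2 \<subseteq> S" "chart_solution \<alpha> j N2 a2 b2"
      "\<And>t. t \<in> N2 \<Longrightarrow> s2 t = normal_form \<alpha> t (j, (a2 t, b2 t))"
      by (rule section_onE[OF s(2) tS]) auto
    have tc: "total_chart (PII_chart \<alpha>) i (p, z) = total_chart (PII_chart \<alpha>) j (q, z) \<longleftrightarrow>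
        normal_form \<alpha> z (i, p) = normal_form \<alpha> z (j, q)" for p q z
      by (simp add: total_chart_def PII_chart_eq_iff)
    have "total_chart (PII_chart \<alpha>) i ((a1 t, b1 t), t) \<noteq> total_chart (PII_chart \<alpha>) j ((a2 t, b2 t), t)"
      unfolding tc using ne N1(2,5) N2(2,5) by simp
    from holomorphic_gluing.separate[OF holomorphic_gluing_total this]
    obtain A B where AB: "open A" "open B" "((a1 t, b1 t), t) \<in> A" "((a2 t, b2 t), t) \<in> B"
      "total_chart (PII_chart \<alpha>) i ` A \<inter> total_chart (PII_chart \<alpha>) j ` B = {}"
      by blast
    define T1 where "T1 = N1 \<inter> (\<lambda>z. ((a1 z, b1 z), z)) -` A"
    define T2 where "T2 = N2 \<inter> (\<lambda>z. ((a2 z, b2 z), z)) -` B"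
    have "open T1"
      unfolding T1_def
      by (intro continuous_open_preimage continuous_intros solution_on_continuous[OF N1(4)] N1(1) AB(1))
    moreover have "open T2"
      unfolding T2_def
      by (intro continuous_open_preimage continuous_intros solution_on_continuous[OF N2(4)] N2(1) AB(2))
    moreover have "t \<in> T1 \<inter> T2"
      using N1(2) N2(2) AB by (simp add: T1_def T2_def)
    moreover have "T1 \<inter> T2 \<subseteq> ?B"
    proof
      fix z assume z: "z \<in> T1 \<inter> T2"
      have "total_chart (PII_chart \<alpha>) i ((a1 z, b1 z), z) \<noteq> total_chart (PII_chart \<alpha>) j ((a2 z, b2 z), z)"
        using z AB(5) unfolding T1_def T2_def by blast
      then show "z \<in> ?B"
        using z N1(3) N1(5)[of z] N2(5)[of z] unfolding tc by (auto simp: T1_def T2_def)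
    qed
    ultimately show ?thesis
      by (intro exI[of _ "T1 \<inter> T2"]) auto
  qed
  then have B: "open ?B" by (subst open_subopen) blast
  have "?A \<inter> S = {} \<or> ?B \<inter> S = {}"
    using connectedD[OF S(2) A B] by blast
  then show ?thesis using z0 z by auto
qed

subsection \<open>A Lyapunov function\<close>

text \<open>\<open>pole_cutoff\<close> below is \<open>1/y\<close> with its pole at \<open>0\<close> removed. Matching \<open>1/s\<close> to
  first order at \<open>s = 1\<close> makes it continuously differentiable.\<close>

definition cutoff_factor :: "real \<Rightarrow> real"
  where "cutoff_factor s = (if s \<le> 1 then 2 - s else 1 / s)"

definition cutoff_factor' :: "real \<Rightarrow> real"
  where "cutoff_factor' s = (if s \<le> 1 then - 1 else - 1 / s^2)"

lemma cutoff_factor_deriv: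
  assumes "s \<ge> 0"
  shows "(cutoff_factor has_real_derivative cutoff_factor' s) (at s)"
proof -
  have 1: "((\<lambda>s. 2 - s) has_real_derivative - 1) (at s)"
    by (auto intro!: derivative_eq_intros)
  have 2: "((\<lambda>s. 1 / s) has_real_derivative - 1 / s^2) (at s)" if "s > 0"
    using that by (auto intro!: derivative_eq_intros simp: power2_eq_square)
  consider "s < 1" | "s = 1" | "s > 1" by linarith
  then show ?thesis
  proof cases
    case 1
    have "(cutoff_factor has_real_derivative - 1) (at s)"
      by (rule has_field_derivative_transform_within_open[OF \<open>((\<lambda>s. 2 - s) has_real_derivative - 1) (at s)\<close>,
            of "{..<1}"]) (use \<open>s < 1\<close> in \<open>auto simp: cutoff_factor_def\<close>)
    then show ?thesis using \<open>s < 1\<close> by (simp add: cutoff_factor'_def)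
  next
    case 3
    have "(cutoff_factor has_real_derivative - 1 / s^2) (at s)"
      by (rule has_field_derivative_transform_within_open[OF 2, of "{1<..}"])
        (use \<open>s > 1\<close> in \<open>auto simp: cutoff_factor_def\<close>)
    then show ?thesis using \<open>s > 1\<close> by (simp add: cutoff_factor'_def)
  next
    case 2
    have l: "(cutoff_factor has_real_derivative - 1) (at 1 within {..1})"
      by (rule has_field_derivative_transform_within[of "\<lambda>s. 2 - s" _ _ _ 1])
        (auto intro!: derivative_eq_intros simp: cutoff_factor_def)
    have r: "(cutoff_factor has_real_derivative - 1) (at 1 within {1..})"
      by (rule has_field_derivative_transform_within[of "\<lambda>s. 1 / s" _ _ _ 1])
        (auto intro!: derivative_eq_intros simp: cutoff_factor_def)
    have "(cutoff_factor has_real_derivative - 1) (at 1 within {..1} \<union> {1..})"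
      using l r unfolding has_field_derivative_iff by (simp add: at_within_union filterlim_sup)
    moreover have "{..1} \<union> {1..} = (UNIV :: real set)" by auto
    ultimately show ?thesis using \<open>s = 1\<close> by (simp add: cutoff_factor'_def)
  qed
qed

definition pole_cutoff :: "complex \<Rightarrow> complex"
  where "pole_cutoff y = cnj y * of_real (cutoff_factor ((norm y)^2))"

lemma pole_cutoff_large:
  assumes "norm y \<ge> 1"
  shows "pole_cutoff y = 1 / y"
proof -
  have y: "y \<noteq> 0" using assms by auto
  have "(norm y)^2 \<ge> 1" using assms by (rule one_le_power)
  then have "cutoff_factor ((norm y)^2) = 1 / (norm y)^2"
    by (auto simp: cutoff_factor_def)
  then have "pole_cutoff y = cnj y / (of_real (norm y))^2"
    by (simp add: pole_cutoff_def)
  also have "\<dots> = 1 / y"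
    using y complex_norm_square[of y] by (simp add: field_simps)
  finally show ?thesis .
qed

lemma norm_pole_cutoff: "norm (pole_cutoff y) \<le> 2"
proof (cases "norm y \<ge> 1")
  case True
  then show ?thesis
    by (simp add: pole_cutoff_large norm_divide divide_le_eq)
next
  case False
  then have s: "(norm y)^2 \<le> 1" by (simp add: power_le_one)
  have c: "cutoff_factor ((norm y)^2) = 2 - (norm y)^2"
    using s by (simp add: cutoff_factor_def)
  have "norm (pole_cutoff y) = norm y * \<bar>2 - (norm y)^2\<bar>"
    unfolding pole_cutoff_def norm_mult c complex_mod_cnj norm_of_real ..
  also have "\<dots> \<le> 1 * 2"
    using s False by (intro mult_mono) auto
  finally show ?thesis by simp
qed

text \<open>The cutoff is not holomorphic, so it is differentiated along a real parameter. For |y| =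
  1 the curve may cross the seam, and the derivative of \<open>cutoff_factor\<close> at 1 enters. Of
  the constant 4, one half comes from differentiating the factor and one half from the factor
  itself.\<close>

lemma pole_cutoff_vector_derivative:
  assumes "(y has_vector_derivative v) (at t)" "norm (y t) \<le> 1"
  shows "\<exists>v'. ((\<lambda>t. pole_cutoff (y t)) has_vector_derivative v') (at t) \<and> norm v' \<le> 4 * norm v"
proof -
  have sq: "((\<lambda>t. (norm (y t))^2) has_real_derivative 2 * (y t \<bullet> v)) (at t)"
  proof -
    have "((\<lambda>t. y t \<bullet> y t) has_real_derivative 2 * (y t \<bullet> v)) (at t)"
      using assms(1) unfolding has_vector_derivative_def has_field_derivative_def
      by (auto intro!: derivative_eq_intros simp: fun_eq_iff inner_commute)
    then show ?thesis by (simp add: power2_norm_eq_inner)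
  qed
  let ?s = "(norm (y t))^2"
  have s: "?s \<le> 1" "?s \<ge> 0" using assms(2) by (auto simp: power_le_one)
  have k: "((\<lambda>t. cutoff_factor ((norm (y t))^2)) has_real_derivative cutoff_factor' ?s * (2 * (y t \<bullet> v))) (at t)"
    by (rule DERIV_chain2[OF cutoff_factor_deriv sq]) simp
  have ko: "((\<lambda>t. complex_of_real (cutoff_factor ((norm (y t))^2))) has_vector_derivative
      of_real (cutoff_factor' ?s * (2 * (y t \<bullet> v)))) (at t)"
    using k by (intro has_vector_derivative_of_real) (simp add: has_real_derivative_iff_has_vector_derivative)
  have cy: "((\<lambda>t. cnj (y t)) has_vector_derivative cnj v) (at t)"
    using assms(1) by (rule has_vector_derivative_cnj)
  let ?v' = "cnj (y t) * of_real (cutoff_factor' ?s * (2 * (y t \<bullet> v))) + cnj v * of_real (cutoff_factor ?s)"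
  have "((\<lambda>t. pole_cutoff (y t)) has_vector_derivative ?v') (at t)"
    unfolding pole_cutoff_def by (rule has_vector_derivative_mult[OF cy ko])
  moreover have "norm ?v' \<le> 4 * norm v"
  proof -
    have c: "cutoff_factor ?s = 2 - ?s" "cutoff_factor' ?s = - 1"
      using s by (simp_all add: cutoff_factor_def cutoff_factor'_def)
    have "norm ?v' \<le> norm (y t) * \<bar>- 1 * (2 * (y t \<bullet> v))\<bar> + norm v * \<bar>2 - ?s\<bar>"
      using norm_triangle_ineq[of "cnj (y t) * of_real (cutoff_factor' ?s * (2 * (y t \<bullet> v)))"
          "cnj v * of_real (cutoff_factor ?s)"]
      unfolding norm_mult complex_mod_cnj norm_of_real c .
    also have "\<dots> = norm (y t) * \<bar>2 * (y t \<bullet> v)\<bar> + norm v * (2 - ?s)"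
      using s by simp
    also have "\<dots> \<le> 1 * (2 * (1 * norm v)) + norm v * 2"
    proof (intro add_mono mult_mono)
      have "\<bar>y t \<bullet> v\<bar> \<le> norm (y t) * norm v" by (rule Cauchy_Schwarz_ineq2)
      also have "\<dots> \<le> 1 * norm v" using assms(2) by (intro mult_right_mono) auto
      finally show "\<bar>2 * (y t \<bullet> v)\<bar> \<le> 2 * (1 * norm v)" by (simp add: abs_mult)
    qed (use assms(2) s in auto)
    finally show ?thesis by simp
  qed
  ultimately show ?thesis by blast
qed

definition energy :: "complex \<Rightarrow> complex \<Rightarrow> complex \<Rightarrow> complex \<Rightarrow> complex"
  where "energy \<alpha> z x y = x^2 - y^4 - z * y^2 - 2 * \<alpha> * y"

text \<open>Along solutions the energy changes by \<open>- y\<^sup>2\<close>, which has a double pole; adding \<open>x / y\<close>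
  compensates it and makes the function holomorphic in the charts at infinity.\<close>

definition lyapunov :: "complex \<Rightarrow> complex \<Rightarrow> chart_point \<Rightarrow> complex"
  where "lyapunov \<alpha> z q = (case fst q of
      XY \<Rightarrow> energy \<alpha> z (fst (snd q)) (snd (snd q)) + fst (snd q) * pole_cutoff (snd (snd q))
    | UW \<sigma> \<Rightarrow> - 2 * pm_val \<sigma> * fst (snd q) + z^2 / 4)"

text \<open>Energy plus x/y in the coordinates at infinity. As a polynomial in w it extends over w =
  0, where it takes the value that \<open>lyapunov\<close> gives to points at infinity.\<close>

definition lyapunov_uw :: "complex \<Rightarrow> pm \<Rightarrow> complex \<Rightarrow> complex \<Rightarrow> complex \<Rightarrow> complex"
  where "lyapunov_uw \<alpha> \<sigma> z u w = u^2 * w^4 - 2 * pm_val \<sigma> * u - pm_val \<sigma> * z * u * w^2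
    - 2 * pm_val \<sigma> * \<alpha> * u * w^3 + z^2 / 4 + \<alpha> * z * w - (1/4 - \<alpha>^2) * w^2"

lemma lyapunov_normal_form_UW:
  assumes "norm w < 1"
  shows "lyapunov \<alpha> z (normal_form \<alpha> z (UW \<sigma>, (u, w))) = lyapunov_uw \<alpha> \<sigma> z u w"
proof (cases "w = 0")
  case True
  then show ?thesis by (simp add: normal_form_UW lyapunov_def lyapunov_uw_def)
next
  case False
  define y where "y = inverse w"
  define e where "e = pm_val \<sigma>"
  define h where "h = z / 2"
  define k where "k = (1/2 :: complex)"
  have yw: "y * w = 1" and ee: "e * e = 1" and k2: "2 * k = 1"
    using False by (simp_all add: y_def e_def k_def)
  have z: "z = 2 * h" by (simp add: h_def)
  define x where "x = u * w^2 - e * y^2 - e * h - (k + e * \<alpha>) * w"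
  have "norm y \<ge> 1"
    using assms False by (simp add: y_def norm_inverse one_le_inverse)
  then have "pole_cutoff y = 1 / y"
    by (rule pole_cutoff_large)
  then have "pole_cutoff y = w"
    by (simp add: y_def inverse_eq_divide)
  then have "lyapunov \<alpha> z (normal_form \<alpha> z (UW \<sigma>, (u, w))) = energy \<alpha> z x y + x * w"
    using False by (simp add: normal_form_UW lyapunov_def uw_to_xy_def x_def y_def e_def h_def k_def mult.assoc)
  also have "\<dots> = u^2 * w^4 - 2 * e * u - e * (2 * h) * u * w^2
    - 2 * e * \<alpha> * u * w^3 + h^2 + \<alpha> * (2 * h) * w - (k^2 - \<alpha>^2) * w^2"
    unfolding energy_def x_def z using yw ee k2 by algebra
  also have "\<dots> = lyapunov_uw \<alpha> \<sigma> z u w"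
    by (simp add: lyapunov_uw_def e_def h_def k_def power_divide)
  finally show ?thesis .
qed

lemma quadratic_bound:
  fixes q A :: real
  assumes "q^2 \<le> A + B * q" "A \<ge> 0" "B \<ge> 0" "q \<ge> 0"
  shows "q \<le> A + B + 1"
proof (rule ccontr)
  assume "\<not> q \<le> A + B + 1"
  then have "q * (A + B + 1) < q * q"
    using assms by (intro mult_strict_left_mono) auto
  moreover have "A \<le> q * A"
    using \<open>\<not> q \<le> A + B + 1\<close> assms mult_right_mono[of 1 q A] by simp
  ultimately have "A + B * q < q * q"
    using assms(4) by (simp add: algebra_simps)
  then show False using assms(1) by (simp add: power2_eq_square)
qed

text \<open>The factor 100 is not sharp; it dominates the coefficients of both derivative estimates,
  the larger of which is 8 |W| + 29 + 10 R + 18 |\<alpha>|.\<close>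

definition growth_const :: "complex \<Rightarrow> real \<Rightarrow> real"
  where "growth_const \<alpha> R = 100 * (1 + R + norm \<alpha>)"

text \<open>Along solutions W' = -W/y^2 - \<alpha>/y + x/y^3. For |y| \<ge> 1 only the last term
  needs an argument, and it is at most q = |x| / |y|^2.\<close>

lemma lyapunov_derivative_large:
  assumes dx: "(x has_field_derivative PII_x \<alpha> (x z) (y z) z) (at z)"
    and dy: "(y has_field_derivative PII_y (x z) (y z) z) (at z)"
    and y: "norm (y z) \<ge> 1" and z: "norm z \<le> R"
  shows "\<exists>D. ((\<lambda>t. energy \<alpha> t (x t) (y t) + x t * (1 / y t)) has_field_derivative D) (at z) \<and>
    norm D \<le> growth_const \<alpha> R * (1 + norm (energy \<alpha> z (x z) (y z) + x z * (1 / y z)))"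
proof -
  have y0: "y z \<noteq> 0" using y by auto
  have R: "R \<ge> 0" using order_trans[OF norm_ge_zero z] .
  let ?x = "x z" and ?y = "y z"
  define W where "W = energy \<alpha> z ?x ?y + ?x * (1 / ?y)"
  let ?D = "- W / ?y^2 - \<alpha> / ?y + ?x / ?y^3"
  have "((\<lambda>t. energy \<alpha> t (x t) (y t) + x t * (1 / y t)) has_field_derivative
    (- (?y^2) + ((2 * ?y^3 + ?y * z + \<alpha>) / ?y - ?x^2 / ?y^2))) (at z)"
    unfolding energy_def using y0
    by (auto intro!: derivative_eq_intros dx dy simp: PII_x_def PII_y_def field_simps power2_eq_square
        power3_eq_cube eval_nat_numeral)
  moreover have "- (?y^2) + ((2 * ?y^3 + ?y * z + \<alpha>) / ?y - ?x^2 / ?y^2) = ?D"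
    unfolding W_def energy_def using y0 by (simp add: field_simps eval_nat_numeral)
  moreover have "norm ?D \<le> growth_const \<alpha> R * (1 + norm W)"
  proof -
    define q where "q = norm ?x / (norm ?y)^2"
    have y2: "(norm ?y)^2 \<ge> 1" using y by (rule one_le_power)
    have q0: "q \<ge> 0" by (simp add: q_def)
    have sm: "c / norm ?y ^ n \<le> c" if "c \<ge> 0" for c n
      using y that by (simp add: divide_le_eq mult_le_cancel_left1 one_le_power)
    \<comment> \<open>Dividing the definition of W by y^4 yields a quadratic inequality for q, which
      makes q at most linear in |W|.\<close>
    have "?x^2 / ?y^4 = W / ?y^4 + 1 + z / ?y^2 + 2 * \<alpha> / ?y^3 - ?x / ?y^5"
      unfolding W_def energy_def using y0 by (simp add: field_simps eval_nat_numeral)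
    then have "norm (?x^2 / ?y^4) \<le> norm (W / ?y^4) + 1 + norm (z / ?y^2) + norm (2 * \<alpha> / ?y^3) + norm (?x / ?y^5)"
      by (simp only:) (intro norm_triangle_le_diff add_mono norm_triangle_le norm_ge_zero; simp)
    also have "\<dots> \<le> norm W + 1 + norm z + 2 * norm \<alpha> + q"
    proof (intro add_mono order_refl)
      show "norm (W / ?y^4) \<le> norm W" "norm (z / ?y^2) \<le> norm z"
        using sm by (auto simp: norm_divide norm_power)
      show "norm (2 * \<alpha> / ?y^3) \<le> 2 * norm \<alpha>"
        using sm[of "2 * norm \<alpha>" 3] by (simp add: norm_divide norm_power norm_mult)
      have "norm (?x / ?y^5) = q / norm ?y ^ 3"
        by (simp add: norm_divide norm_power q_def power_add[symmetric])
      then show "norm (?x / ?y^5) \<le> q" using sm[OF q0, of 3] by simp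
    qed
    also have "norm (?x^2 / ?y^4) = q^2"
      by (simp add: q_def norm_divide norm_power power_divide power_mult[symmetric])
    finally have "q^2 \<le> (norm W + 1 + R + 2 * norm \<alpha>) + 1 * q"
      using z by simp
    then have q: "q \<le> (norm W + 1 + R + 2 * norm \<alpha>) + 1 + 1"
      by (rule quadratic_bound) (use R q0 in auto)
    have "norm ?D \<le> norm (W / ?y^2) + norm (\<alpha> / ?y) + norm (?x / ?y^3)"
      using norm_triangle_ineq4[of "- W / ?y^2" "\<alpha> / ?y"]
        norm_triangle_ineq[of "- W / ?y^2 - \<alpha> / ?y" "?x / ?y^3"] by (simp add: norm_divide)
    also have "\<dots> \<le> norm W + norm \<alpha> + q"
    proof (intro add_mono)
      show "norm (W / ?y^2) \<le> norm W"
        using sm by (auto simp: norm_divide norm_power)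
      show "norm (\<alpha> / ?y) \<le> norm \<alpha>"
        using sm[of "norm \<alpha>" 1] by (simp add: norm_divide)
      have "norm (?x / ?y^3) = q / norm ?y ^ 1"
        unfolding norm_divide norm_power q_def by (simp add: power2_eq_square power3_eq_cube)
      then show "norm (?x / ?y^3) \<le> q" using sm[OF q0, of 1] by simp
    qed
    also have "\<dots> \<le> 2 * norm W + 3 + R + 3 * norm \<alpha>"
      using q by simp
    also have "\<dots> \<le> growth_const \<alpha> R * (1 + norm W)"
    proof -
      have "2 * norm W \<le> 100 * norm W" "0 \<le> R * norm W" "0 \<le> norm \<alpha> * norm W"
        using R by auto
      then show ?thesis
        unfolding growth_const_def using R norm_ge_zero[of \<alpha>] by (simp add: algebra_simps)
    qed
    finally show ?thesis .
  qed
  ultimately show ?thesis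
    unfolding W_def by (intro exI[of _ ?D]) (simp add: W_def)
qed

section \<open>Growth of the Lyapunov function along rays\<close>

lemma has_vector_derivative_compose_line:
  assumes "(f has_field_derivative D) (at (z0 + of_real t * \<theta>))"
  shows "((\<lambda>\<tau>. f (z0 + of_real \<tau> * \<theta>)) has_vector_derivative \<theta> * D) (at t)"
proof -
  have "((\<lambda>\<tau>. z0 + of_real \<tau> * \<theta>) has_vector_derivative \<theta>) (at t)"
    by (auto intro!: derivative_eq_intros simp: has_vector_derivative_def scaleR_conv_of_real)
  from field_vector_diff_chain_at[OF this assms] show ?thesis
    by (simp add: o_def)
qed

lemma has_vector_derivative_transform_line:
  fixes f g :: "complex \<Rightarrow> complex"
  assumes "((\<lambda>\<tau>. f (z0 + of_real \<tau> * \<theta>)) has_vector_derivative D) (at t)"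
    and "open N" "z0 + of_real t * \<theta> \<in> N" "\<And>z. z \<in> N \<Longrightarrow> f z = g z"
  shows "((\<lambda>\<tau>. g (z0 + of_real \<tau> * \<theta>)) has_vector_derivative D) (at t)"
proof -
  have "open ((\<lambda>\<tau>. z0 + of_real \<tau> * \<theta>) -` N)"
    using assms(2) by (intro open_vimage continuous_intros)
  from has_vector_derivative_transform_within_open[OF assms(1) this] show ?thesis
    using assms(3,4) by auto
qed

lemma lyapunov_growth:
  assumes s: "section_on \<alpha> S s" and zS: "z0 + of_real t * \<theta> \<in> S" and \<theta>: "norm \<theta> = 1"
    and R: "norm (z0 + of_real t * \<theta>) \<le> R"
  defines "\<phi> \<equiv> \<lambda>\<tau>. lyapunov \<alpha> (z0 + of_real \<tau> * \<theta>) (s (z0 + of_real \<tau> * \<theta>))"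
  shows "\<exists>D. (\<phi> has_vector_derivative D) (at t) \<and> norm D \<le> growth_const \<alpha> R * (1 + norm (\<phi> t))"
proof -
  define z where "z = z0 + of_real t * \<theta>"
  note zS = zS[folded z_def] and R = R[folded z_def]
  have R0: "R \<ge> 0" using order_trans[OF norm_ge_zero R] .
  have g0: "growth_const \<alpha> R \<ge> 0" using R0 by (simp add: growth_const_def)
  let ?F = "\<lambda>z. lyapunov \<alpha> z (s z)"
  have \<phi>t: "\<phi> t = ?F z" by (simp add: \<phi>_def z_def)
  obtain N0 i a0 b0 where N0: "open N0" "z \<in> N0" "N0 \<subseteq> S" "chart_solution \<alpha> i N0 a0 b0"
    "\<And>t. t \<in> N0 \<Longrightarrow> s t = normal_form \<alpha> t (i, (a0 t, b0 t))"
    by (rule section_onE[OF s zS]) auto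
  show ?thesis
  proof (cases "fst (s z)")
    case XY
    define q where "q = snd (s z)"
    have "s z = normal_form \<alpha> z (XY, q)"
      using XY by (simp add: q_def prod_eq_iff)
    then obtain N x y where N: "open N" "z \<in> N" "N \<subseteq> S" "chart_solution \<alpha> XY N x y"
      "\<And>t. t \<in> N \<Longrightarrow> s t = normal_form \<alpha> t (XY, (x t, y t))" "(x z, y z) = q"
      by (rule section_in_chart[OF s zS]) auto
    have dx: "(x has_field_derivative PII_x \<alpha> (x z) (y z) z) (at z)"
      and dy: "(y has_field_derivative PII_y (x z) (y z) z) (at z)"
      using N(2,4) by (auto simp: solution_on_def)
    have F: "?F t = energy \<alpha> t (x t) (y t) + x t * pole_cutoff (y t)" if "t \<in> N" for t
      using N(5)[OF that] by (simp add: lyapunov_def)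
    show ?thesis
    proof (cases "norm (y z) > 1")
      case True
      define M where "M = N \<inter> y -` {v. norm v > 1}"
      have M: "open M" "z \<in> M"
      proof -
        show "open M"
          unfolding M_def
          by (rule continuous_open_preimage[OF solution_on_continuous(2)[OF N(4)] N(1)])
            (intro open_Collect_less continuous_intros)
        show "z \<in> M" using N(2) True by (simp add: M_def)
      qed
      obtain D where D: "((\<lambda>t. energy \<alpha> t (x t) (y t) + x t * (1 / y t)) has_field_derivative D) (at z)"
        "norm D \<le> growth_const \<alpha> R * (1 + norm (energy \<alpha> z (x z) (y z) + x z * (1 / y z)))"
        using lyapunov_derivative_large[OF dx dy _ R] True by auto
      have FM: "energy \<alpha> t (x t) (y t) + x t * (1 / y t) = ?F t" if "t \<in> M" for t
        using F[of t] that by (simp add: M_def pole_cutoff_large)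
      have "((\<lambda>\<tau>. ?F (z0 + of_real \<tau> * \<theta>)) has_vector_derivative \<theta> * D) (at t)"
        by (rule has_vector_derivative_transform_line[OF has_vector_derivative_compose_line[OF D(1)[unfolded z_def]] M(1) M(2)[unfolded z_def] FM])
      moreover have "norm (\<theta> * D) \<le> growth_const \<alpha> R * (1 + norm (\<phi> t))"
        using D(2) \<theta> FM[OF M(2)] by (simp add: norm_mult \<phi>t)
      ultimately show ?thesis unfolding \<phi>_def by blast
    next
      case False
      then have y: "norm (y z) \<le> 1" by simp
      let ?l = "\<lambda>\<tau>. z0 + of_real \<tau> * \<theta>"
      have "((\<lambda>\<tau>. y (?l \<tau>)) has_vector_derivative \<theta> * x z) (at t)"
        using has_vector_derivative_compose_line[OF dy[unfolded z_def]] by (simp add: PII_y_def z_def)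
      from pole_cutoff_vector_derivative[OF this] y
      obtain k where k: "((\<lambda>\<tau>. pole_cutoff (y (?l \<tau>))) has_vector_derivative k) (at t)"
        "norm k \<le> 4 * norm (\<theta> * x z)"
        by (auto simp: z_def)
      have x': "((\<lambda>\<tau>. x (?l \<tau>)) has_vector_derivative \<theta> * PII_x \<alpha> (x z) (y z) z) (at t)"
        using has_vector_derivative_compose_line[OF dx[unfolded z_def]] by (simp add: z_def)
      have "((\<lambda>t. energy \<alpha> t (x t) (y t)) has_field_derivative (- ((y z)^2))) (at z)"
        unfolding energy_def
        by (auto intro!: derivative_eq_intros dx dy simp: PII_x_def PII_y_def algebra_simps eval_nat_numeral)
      from has_vector_derivative_compose_line[OF this[unfolded z_def]]
      have E: "((\<lambda>\<tau>. energy \<alpha> (?l \<tau>) (x (?l \<tau>)) (y (?l \<tau>))) has_vector_derivative \<theta> * (- ((y z)^2))) (at t)"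
        by (simp add: z_def)
      define D where "D = \<theta> * (- ((y z)^2)) + (x z * k + \<theta> * PII_x \<alpha> (x z) (y z) z * pole_cutoff (y z))"
      have "((\<lambda>\<tau>. energy \<alpha> (?l \<tau>) (x (?l \<tau>)) (y (?l \<tau>)) + x (?l \<tau>) * pole_cutoff (y (?l \<tau>)))
          has_vector_derivative D) (at t)"
        using has_vector_derivative_add[OF E has_vector_derivative_mult[OF x' k(1)]]
        by (simp add: D_def z_def)
      from has_vector_derivative_transform_line[of "\<lambda>z. energy \<alpha> z (x z) (y z) + x z * pole_cutoff (y z)",
          OF this N(1) N(2)[unfolded z_def] F[symmetric]]
      have "(\<phi> has_vector_derivative D) (at t)" unfolding \<phi>_def .
      moreover have "norm D \<le> growth_const \<alpha> R * (1 + norm (\<phi> t))"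
      proof -
        let ?x = "norm (x z)" and ?W = "norm (\<phi> t)"
        have yp: "norm (y z) ^ n \<le> 1" for n using y by (simp add: power_le_one)
        have sub: "norm (- (y z ^ 4) - z * y z ^ 2 - 2 * \<alpha> * y z) \<le> 1 + R + 2 * norm \<alpha>"
        proof -
          have "norm (z * y z ^ 2) \<le> R * 1"
            unfolding norm_mult norm_power using R yp R0 by (intro mult_mono) auto
          moreover have "norm (2 * \<alpha> * y z) \<le> (2 * norm \<alpha>) * 1"
            unfolding norm_mult using y by (intro mult_mono) auto
          moreover have "norm (- (y z ^ 4)) \<le> 1" using yp[of 4] by (simp add: norm_power)
          ultimately show ?thesis
            using norm_triangle_ineq4[of "- (y z ^ 4)" "z * y z ^ 2"]
              norm_triangle_ineq4[of "- (y z ^ 4) - z * y z ^ 2" "2 * \<alpha> * y z"] by linarith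
        qed
        have "x z ^ 2 = \<phi> t - (- (y z ^ 4) - z * y z ^ 2 - 2 * \<alpha> * y z) - x z * pole_cutoff (y z)"
          unfolding \<phi>t F[OF N(2)] energy_def by simp
        then have "norm (x z ^ 2) \<le> ?W + (1 + R + 2 * norm \<alpha>) + ?x * 2"
          using sub norm_triangle_ineq4[of "\<phi> t" "- (y z ^ 4) - z * y z ^ 2 - 2 * \<alpha> * y z"]
            norm_triangle_ineq4[of "\<phi> t - (- (y z ^ 4) - z * y z ^ 2 - 2 * \<alpha> * y z)" "x z * pole_cutoff (y z)"]
            mult_left_mono[OF norm_pole_cutoff[of "y z"] norm_ge_zero[of "x z"]]
          by (simp add: norm_mult)
        \<comment> \<open>Absorbs the linear term, caused by the bound 2 on the cutoff, into half of
          |x|^2.\<close>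
        moreover have "?x * 2 \<le> ?x^2 / 2 + 2"
          using zero_le_power2[of "?x - 2"] by (simp add: power2_diff algebra_simps)
        ultimately have x2: "?x^2 \<le> 2 * ?W + 2 * (3 + R + 2 * norm \<alpha>)"
          by (simp add: norm_power)
        have P: "norm (PII_x \<alpha> (x z) (y z) z) \<le> 2 + R + norm \<alpha>"
        proof -
          have "norm (y z * z) \<le> 1 * R"
            unfolding norm_mult using y R by (intro mult_mono) auto
          moreover have "norm (2 * y z ^ 3) \<le> 2" using yp[of 3] by (simp add: norm_mult norm_power)
          ultimately show ?thesis
            unfolding PII_x_def
            using norm_triangle_ineq[of "2 * y z ^ 3" "y z * z"]
              norm_triangle_ineq[of "2 * y z ^ 3 + y z * z" \<alpha>] by linarith
        qed
        have "norm D \<le> norm (\<theta> * (- ((y z)^2))) + (norm (x z * k) + norm (\<theta> * PII_x \<alpha> (x z) (y z) z * pole_cutoff (y z)))"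
          unfolding D_def by (intro norm_triangle_mono norm_triangle_ineq order_refl)
        also have "\<dots> \<le> 1 + (?x * (4 * ?x) + (2 + R + norm \<alpha>) * 2)"
        proof (intro add_mono)
          show "norm (\<theta> * (- ((y z)^2))) \<le> 1" using yp[of 2] \<theta> by (simp add: norm_mult norm_power)
          show "norm (x z * k) \<le> ?x * (4 * ?x)"
            using k(2) \<theta> by (simp add: norm_mult mult_left_mono)
          show "norm (\<theta> * PII_x \<alpha> (x z) (y z) z * pole_cutoff (y z)) \<le> (2 + R + norm \<alpha>) * 2"
            unfolding norm_mult \<theta> mult_1 using P norm_pole_cutoff R0 by (intro mult_mono) auto
        qed
        also have "\<dots> = 4 * ?x^2 + (5 + 2 * R + 2 * norm \<alpha>)"
          by (simp add: power2_eq_square)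
        also have "\<dots> \<le> 8 * ?W + (29 + 10 * R + 18 * norm \<alpha>)"
          using x2 by simp
        also have "\<dots> \<le> growth_const \<alpha> R * (1 + ?W)"
        proof -
          have "0 \<le> R * ?W" "0 \<le> norm \<alpha> * ?W" using R0 by auto
          then show ?thesis
            unfolding growth_const_def using R0 norm_ge_zero[of \<alpha>] norm_ge_zero[of "\<phi> t"]
            by (simp add: algebra_simps)
        qed
        finally show ?thesis .
      qed
      ultimately show ?thesis by blast
    qed
  next
    case (UW \<sigma>)
    have nf: "s z = normal_form \<alpha> z (i, (a0 z, b0 z))" using N0 by blast
    obtain u0 where su: "s z = normal_form \<alpha> z (UW \<sigma>, (u0, 0))"
    proof -
      have i: "i = UW \<sigma>" "b0 z = 0"
        using nf UW by (cases i; auto simp: normal_form_UW split: if_splits)+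
      show thesis
        by (rule that[of "a0 z"]) (use nf i in simp)
    qed
    obtain N u w where N: "open N" "z \<in> N" "N \<subseteq> S" "chart_solution \<alpha> (UW \<sigma>) N u w"
      "\<And>t. t \<in> N \<Longrightarrow> s t = normal_form \<alpha> t (UW \<sigma>, (u t, w t))" "(u z, w z) = (u0, 0)"
      by (rule section_in_chart[OF s zS su]) auto
    have du: "(u has_field_derivative uw_field_u \<alpha> \<sigma> (u z) (w z) z) (at z)"
      and dw: "(w has_field_derivative uw_field_w \<alpha> \<sigma> (u z) (w z) z) (at z)"
      using N(2,4) by (auto simp: solution_on_def)
    have w0: "w z = 0" using N(6) by simp
    have "((\<lambda>t. lyapunov_uw \<alpha> \<sigma> t (u t) (w t)) has_field_derivative
      (- 2 * pm_val \<sigma> * uw_field_u \<alpha> \<sigma> (u z) (w z) z + z / 2 + \<alpha> * z * uw_field_w \<alpha> \<sigma> (u z) (w z) z)) (at z)"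
      unfolding lyapunov_uw_def
      by (rule derivative_eq_intros du dw refl | simp)+ (simp add: w0)
    \<comment> \<open>At w = 0 one has w' = \<sigma> and u' = \<sigma> z c / 2 with c =
      \<open>uw_shift \<alpha> \<sigma>\<close> and \<sigma> read as its sign. Since c = 1/2 +
      \<sigma> \<alpha>, the three terms cancel.\<close>
    moreover have "- 2 * pm_val \<sigma> * uw_field_u \<alpha> \<sigma> (u z) (w z) z + z / 2 + \<alpha> * z * uw_field_w \<alpha> \<sigma> (u z) (w z) z = 0"
      by (cases \<sigma>) (simp_all add: uw_field_u_def uw_field_w_def w0 uw_shift_def field_simps)
    ultimately have d: "((\<lambda>t. lyapunov_uw \<alpha> \<sigma> t (u t) (w t)) has_field_derivative 0) (at z)"
      by simp
    define M where "M = N \<inter> w -` ball 0 1"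
    have M: "open M" "z \<in> M"
    proof -
      show "open M"
        unfolding M_def
        by (rule continuous_open_preimage[OF solution_on_continuous(2)[OF N(4)] N(1) open_ball])
      show "z \<in> M" using N(2) w0 by (simp add: M_def)
    qed
    have FM: "lyapunov_uw \<alpha> \<sigma> t (u t) (w t) = ?F t" if "t \<in> M" for t
      using that N(5)[of t] lyapunov_normal_form_UW[of "w t" \<alpha> t \<sigma> "u t"] by (simp add: M_def)
    have "((\<lambda>\<tau>. ?F (z0 + of_real \<tau> * \<theta>)) has_vector_derivative \<theta> * 0) (at t)"
      by (rule has_vector_derivative_transform_line[OF has_vector_derivative_compose_line[OF d[unfolded z_def]] M(1) M(2)[unfolded z_def] FM])
    moreover have "norm (\<theta> * 0) \<le> growth_const \<alpha> R * (1 + norm (\<phi> t))"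
      using g0 by simp
    ultimately show ?thesis unfolding \<phi>_def by blast
  qed
qed

text \<open>The Gronwall argument is run on 1 + |\<phi>|^2, which, unlike |\<phi>|, is
  differentiable at zeros of \<phi>. With n = |\<phi>| its derivative is at most 2 C (n + n^2), and
  n + n^2 \<le> 2 (1 + n^2) gives the rate 4 C.\<close>

lemma exponential_growth:
  fixes \<phi> :: "real \<Rightarrow> complex"
  assumes d: "\<And>t. 0 \<le> t \<Longrightarrow> t \<le> T \<Longrightarrow> \<exists>D. (\<phi> has_vector_derivative D) (at t) \<and> norm D \<le> C * (1 + norm (\<phi> t))"
    and T: "T \<ge> 0" and C: "C \<ge> 0"
  shows "1 + (norm (\<phi> T))^2 \<le> exp (4 * C * T) * (1 + (norm (\<phi> 0))^2)"
proof -
  define \<psi> where "\<psi> t = exp (- (4 * C * t)) * (1 + \<phi> t \<bullet> \<phi> t)" for t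
  have "\<psi> T \<le> \<psi> 0"
  proof (rule DERIV_nonpos_imp_nonincreasing[OF T])
    fix t assume t: "0 \<le> t" "t \<le> T"
    obtain D where D: "(\<phi> has_vector_derivative D) (at t)" "norm D \<le> C * (1 + norm (\<phi> t))"
      using d[OF t] by blast
    have "((\<lambda>t. \<phi> t \<bullet> \<phi> t) has_real_derivative 2 * (\<phi> t \<bullet> D)) (at t)"
      using D(1) unfolding has_vector_derivative_def has_field_derivative_def
      by (auto intro!: derivative_eq_intros simp: fun_eq_iff inner_commute)
    then have "(\<psi> has_real_derivative exp (- (4 * C * t)) * (2 * (\<phi> t \<bullet> D) - 4 * C * (1 + \<phi> t \<bullet> \<phi> t))) (at t)"
      unfolding \<psi>_def by (auto intro!: derivative_eq_intros simp: algebra_simps)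
    moreover have "2 * (\<phi> t \<bullet> D) \<le> 4 * C * (1 + \<phi> t \<bullet> \<phi> t)"
    proof -
      let ?n = "norm (\<phi> t)"
      have "\<phi> t \<bullet> D \<le> ?n * norm D" by (rule norm_cauchy_schwarz)
      also have "\<dots> \<le> ?n * (C * (1 + ?n))" using D(2) by (intro mult_left_mono) auto
      also have "\<dots> = C * (?n + ?n^2)" by (simp add: algebra_simps power2_eq_square)
      also have "\<dots> \<le> C * (2 * (1 + ?n^2))"
      proof (rule mult_left_mono[OF _ C])
        show "?n + ?n^2 \<le> 2 * (1 + ?n^2)"
        proof -
          have "2 * ?n \<le> ?n^2 + 1" using zero_le_power2[of "?n - 1"] by (simp add: power2_diff)
          moreover have "0 \<le> ?n^2" by simp
          moreover have "n + m \<le> 2 * (1 + m)" if "2 * n \<le> m + 1" "0 \<le> m" for n m :: real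
            using that by argo
          ultimately show ?thesis by blast
        qed
      qed
      finally have "\<phi> t \<bullet> D \<le> C * (2 * (1 + ?n^2))" .
      then show ?thesis by (simp add: power2_norm_eq_inner algebra_simps)
    qed
    ultimately show "\<exists>y. (\<psi> has_real_derivative y) (at t) \<and> y \<le> 0"
      by (intro exI conjI) (auto simp: mult_le_0_iff)
  qed
  then have "exp (4 * C * T) * \<psi> T \<le> exp (4 * C * T) * \<psi> 0"
    by (intro mult_left_mono) auto
  then show ?thesis
    by (simp add: \<psi>_def power2_norm_eq_inner mult.assoc[symmetric] exp_add[symmetric])
qed

theorem lyapunov_bound:
  assumes s: "section_on \<alpha> (ball z0 r) s" and z: "z \<in> ball z0 r" and R: "norm z0 + r \<le> R"
  shows "(norm (lyapunov \<alpha> z (s z)))^2 \<le>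
    exp (4 * growth_const \<alpha> R * r) * (1 + (norm (lyapunov \<alpha> z0 (s z0)))^2)"
proof -
  define T where "T = norm (z - z0)"
  \<comment> \<open>For z = z0 any unit direction will do.\<close>
  define \<theta> where "\<theta> = (if z = z0 then 1 else (z - z0) / of_real T)"
  have T: "0 \<le> T" "T < r" using z by (auto simp: T_def dist_norm norm_minus_commute)
  have \<theta>: "norm \<theta> = 1" by (auto simp: \<theta>_def T_def norm_divide)
  have zT: "z0 + of_real T * \<theta> = z" by (auto simp: \<theta>_def T_def)
  define \<phi> where "\<phi> \<tau> = lyapunov \<alpha> (z0 + of_real \<tau> * \<theta>) (s (z0 + of_real \<tau> * \<theta>))" for \<tau>
  have R0: "R \<ge> 0" using R T norm_ge_zero[of z0] by linarith
  have g: "growth_const \<alpha> R \<ge> 0" using R0 by (simp add: growth_const_def)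
  have "1 + (norm (\<phi> T))^2 \<le> exp (4 * growth_const \<alpha> R * T) * (1 + (norm (\<phi> 0))^2)"
  proof (rule exponential_growth[OF _ T(1) g])
    fix t assume t: "0 \<le> t" "t \<le> T"
    have n: "norm (of_real t * \<theta>) = t" using t \<theta> by (simp add: norm_mult)
    have b: "z0 + of_real t * \<theta> \<in> ball z0 r" using n t T by (simp add: dist_norm)
    have "norm (z0 + of_real t * \<theta>) \<le> R"
      using norm_triangle_ineq[of z0 "of_real t * \<theta>"] n t T R by linarith
    from lyapunov_growth[OF s b \<theta> this]
    show "\<exists>D. (\<phi> has_vector_derivative D) (at t) \<and> norm D \<le> growth_const \<alpha> R * (1 + norm (\<phi> t))"
      unfolding \<phi>_def .
  qed
  also have "\<dots> \<le> exp (4 * growth_const \<alpha> R * r) * (1 + (norm (\<phi> 0))^2)"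
    using T g by (intro mult_right_mono) (auto intro!: mult_left_mono)
  finally show ?thesis
    by (simp add: \<phi>_def zT)
qed

subsection \<open>Global continuation\<close>

lemma section_on_normal_point:
  assumes "section_on \<alpha> S s" "z \<in> S"
  shows "normal_point (s z)"
proof -
  obtain N i a b where N: "open N" "z \<in> N" "N \<subseteq> S" "chart_solution \<alpha> i N a b"
    "\<And>t. t \<in> N \<Longrightarrow> s t = normal_form \<alpha> t (i, (a t, b t))"
    by (rule section_onE[OF assms]) auto
  show ?thesis
    unfolding N(5)[OF N(2)] by (rule normal_point_normal_form)
qed

text \<open>Where \<open>y\<close> is large, \<open>u\<^sup>+ u\<^sup>- / y\<^sup>4\<close> is bounded and
  \<open>(u\<^sup>+ - u\<^sup>-) / y\<^sup>2\<close> is of size \<open>2 y\<^sup>2\<close>, so one of \<open>u\<^sup>+\<close>, \<open>u\<^sup>-\<close> is bounded.\<close>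

lemma lyapunov_proper:
  assumes B: "B \<ge> 0" and R: "R \<ge> 0"
  shows "\<exists>K\<ge>0. \<forall>z q. norm z \<le> R \<and> normal_point q \<and> norm (lyapunov \<alpha> z q) \<le> B \<longrightarrow>
    (\<exists>i a b. q = normal_form \<alpha> z (i, (a, b)) \<and> norm a \<le> K \<and> norm b \<le> K)"
proof -
  \<comment> \<open>For |y| > Y the cutoff is exactly 1/y, and R + 2 |\<alpha>| is below |y|, so the
    lower-order part of P+ - P- is absorbed by y^2.\<close>
  define Y where "Y = 1 + R + 2 * norm \<alpha>"
  define A where "A = B + (Y^4 + R * Y^2 + 2 * norm \<alpha> * Y)"
  define B' where "B' = B + R^2 + norm \<alpha> * R + 1 + (norm \<alpha>)^2"
  have Y: "Y \<ge> 1" using R by (simp add: Y_def)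
  have A: "A \<ge> 0" using B R Y by (simp add: A_def)
  have B': "B' \<ge> 1" using B R by (simp add: B'_def)
  define K where "K = Y + (A + 2 + 1) + 2 * B' + (B + R^2)"
  have R2: "0 \<le> R^2" by simp
  have KK: "Y \<le> K" "A + 2 + 1 \<le> K" "2 * B' \<le> K" "B + R^2 \<le> K" "1 \<le> K"
    unfolding K_def using Y A B' B R2 by linarith+
  show ?thesis
  proof (intro exI[of _ K] conjI allI impI)
    show K0: "K \<ge> 0" using KK(5) by linarith
    fix z q assume h: "norm z \<le> R \<and> normal_point q \<and> norm (lyapunov \<alpha> z q) \<le> B"
    then have z: "norm z \<le> R" and W: "norm (lyapunov \<alpha> z q) \<le> B" and n: "normal_point q" by auto
    obtain i x y where q: "q = (i, (x, y))" by (cases q) auto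
    show "\<exists>i a b. q = normal_form \<alpha> z (i, (a, b)) \<and> norm a \<le> K \<and> norm b \<le> K"
    proof (cases i)
      case (UW \<sigma>)
      then have y: "y = 0" using n q by (simp add: normal_point_def)
      have "norm (2 * x) \<le> norm (- 2 * pm_val \<sigma> * x + z^2 / 4) + norm (z^2 / 4)"
        using norm_triangle_ineq4[of "- 2 * pm_val \<sigma> * x + z^2 / 4" "z^2 / 4"] by (simp add: norm_mult)
      also have "\<dots> \<le> B + R^2"
      proof (rule add_mono)
        show "norm (- 2 * pm_val \<sigma> * x + z^2 / 4) \<le> B"
          using W q UW by (simp add: lyapunov_def)
        have "norm (z^2 / 4) \<le> norm z ^ 2" by (simp add: norm_power norm_divide)
        also have "\<dots> \<le> R^2" using z by (intro power_mono) auto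
        finally show "norm (z^2 / 4) \<le> R^2" .
      qed
      finally have "2 * norm x \<le> B + R^2" by (simp add: norm_mult)
      then have "norm x \<le> B + R^2" using norm_ge_zero[of x] by linarith
      then have "norm x \<le> K" using KK(4) by linarith
      then show ?thesis
        using q UW y K0 by - (rule exI[of _ i], rule exI[of _ x], rule exI[of _ y], simp add: normal_form_UW)
    next
      case XY
      have W: "norm (energy \<alpha> z x y + x * pole_cutoff y) \<le> B"
        using W q XY by (simp add: lyapunov_def)
      show ?thesis
      proof (cases "norm y \<le> Y")
        case True
        have "norm (y^4 + z * y^2 + 2 * \<alpha> * y) \<le> norm (y^4) + norm (z * y^2) + norm (2 * \<alpha> * y)"
          by (rule order_trans[OF norm_triangle_ineq add_right_mono[OF norm_triangle_ineq]])
        also have "\<dots> \<le> Y^4 + R * Y^2 + 2 * norm \<alpha> * Y"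
          unfolding norm_mult norm_power using True z R Y
          by (intro add_mono mult_mono power_mono) auto
        finally have s: "norm (y^4 + z * y^2 + 2 * \<alpha> * y) \<le> Y^4 + R * Y^2 + 2 * norm \<alpha> * Y" .
        have "x^2 = (energy \<alpha> z x y + x * pole_cutoff y) + (y^4 + z * y^2 + 2 * \<alpha> * y) - x * pole_cutoff y"
          by (simp add: energy_def)
        then have "norm (x^2) \<le> norm (energy \<alpha> z x y + x * pole_cutoff y) + norm (y^4 + z * y^2 + 2 * \<alpha> * y)
            + norm (x * pole_cutoff y)"
          by (simp only:) (rule order_trans[OF norm_triangle_ineq4 add_right_mono[OF norm_triangle_ineq]])
        also have "\<dots> \<le> A + 2 * norm x"
          using W s mult_left_mono[OF norm_pole_cutoff[of y] norm_ge_zero[of x]]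
          by (simp add: A_def norm_mult)
        finally have "norm x \<le> A + 2 + 1"
          using A by (intro quadratic_bound) (auto simp: norm_power)
        then have "norm x \<le> K" "norm y \<le> K"
          using True KK by linarith+
        then show ?thesis
          using q XY by - (rule exI[of _ XY], rule exI[of _ x], rule exI[of _ y], simp)
      next
        case False
        then have yY: "norm y > Y" by simp
        then have y1: "norm y \<ge> 1" and y0: "y \<noteq> 0" using Y by auto
        define w where "w = 1 / y"
        have yw: "y * w = 1" using y0 by (simp add: w_def)
        \<comment> \<open>P is u / y^2, affine in x with slope 1. Its two versions multiply to W up
          to bounded terms.\<close>
        define P where "P \<sigma> = fst (xy_to_uw \<alpha> \<sigma> z (x, y)) * w^2" for \<sigma>
        have P: "P \<sigma> = x + pm_val \<sigma> * y^2 + pm_val \<sigma> * (1/2) * z + (1/2 + pm_val \<sigma> * \<alpha>) * w" for \<sigma>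
          unfolding P_def xy_to_uw_def coord_u_def w_def using y0
          by (simp add: field_simps eval_nat_numeral)
        have prod: "P Plus * P Minus = (energy \<alpha> z x y + x * w) - z^2 / 4 - \<alpha> * z * w + (1/4 - \<alpha>^2) * w^2"
          unfolding P energy_def w_def using y0 by (simp add: field_simps eval_nat_numeral)
        have w1: "norm w \<le> 1" using y1 by (simp add: w_def norm_divide divide_le_eq)
        have pw: "pole_cutoff y = w" unfolding w_def by (rule pole_cutoff_large[OF y1])
        have "norm (P Plus * P Minus) \<le> norm (energy \<alpha> z x y + x * w) + norm (z^2 / 4) + norm (\<alpha> * z * w)
            + norm ((1/4 - \<alpha>^2) * w^2)"
          unfolding prod
          by (rule order_trans[OF norm_triangle_ineq add_right_mono[OF order_trans[OF
                norm_triangle_ineq4 add_right_mono[OF norm_triangle_ineq4]]]])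
        also have "\<dots> \<le> B + R^2 + norm \<alpha> * R + (1 + (norm \<alpha>)^2)"
        proof (intro add_mono)
          show "norm (energy \<alpha> z x y + x * w) \<le> B" using W pw by simp
          have "norm (z^2 / 4) \<le> norm z ^ 2" by (simp add: norm_power norm_divide)
          also have "\<dots> \<le> R^2" using z by (intro power_mono) auto
          finally show "norm (z^2 / 4) \<le> R^2" .
          have "norm (\<alpha> * z * w) \<le> (norm \<alpha> * R) * 1"
            unfolding norm_mult using z w1 R by (intro mult_mono) auto
          then show "norm (\<alpha> * z * w) \<le> norm \<alpha> * R" by simp
          have "norm ((1/4 - \<alpha>^2) * w^2) \<le> (1 + (norm \<alpha>)^2) * 1"
            unfolding norm_mult
          proof (rule mult_mono)
            show "norm (1/4 - \<alpha>^2) \<le> 1 + (norm \<alpha>)^2"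
              using norm_triangle_ineq4[of "1/4" "\<alpha>^2"] by (simp add: norm_power)
            show "norm (w^2) \<le> 1" using w1 by (simp add: norm_power power_le_one)
          qed auto
          then show "norm ((1/4 - \<alpha>^2) * w^2) \<le> 1 + (norm \<alpha>)^2" by simp
        qed
        finally have PP: "norm (P Plus) * norm (P Minus) \<le> B'"
          by (simp add: B'_def norm_mult)
        have diff: "(norm y)^2 \<le> norm (P Plus) + norm (P Minus)"
        proof -
          have "2 * y^2 = (P Plus - P Minus) - (z + 2 * \<alpha> * w)"
            unfolding P by (simp add: algebra_simps)
          then have "norm (2 * y^2) \<le> norm (P Plus - P Minus) + norm (z + 2 * \<alpha> * w)"
            by (simp only: norm_triangle_ineq4)
          moreover have "norm (P Plus - P Minus) \<le> norm (P Plus) + norm (P Minus)"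
            by (rule norm_triangle_ineq4)
          moreover have "norm (z + 2 * \<alpha> * w) \<le> (norm y)^2"
          proof -
            have "norm (2 * \<alpha> * w) \<le> 2 * norm \<alpha> * 1"
              unfolding norm_mult using w1 by (intro mult_mono) auto
            then have "norm (z + 2 * \<alpha> * w) \<le> R + 2 * norm \<alpha>"
              using z norm_triangle_ineq[of z "2 * \<alpha> * w"] by simp
            also have "\<dots> \<le> norm y" using yY by (simp add: Y_def)
            also have "\<dots> \<le> (norm y)^2"
              using mult_left_mono[OF y1 norm_ge_zero[of y]] by (simp add: power2_eq_square)
            finally show ?thesis .
          qed
          ultimately show ?thesis by (simp add: norm_mult norm_power)
        qed
        \<comment> \<open>The larger factor is at least |y|^2 / 2, so the bound B' on the product
          makes the smaller one at most 2 B' / |y|^2; times y^2 it is the u-coordinate in that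
          chart.\<close>
        have "\<exists>\<sigma>. norm (P \<sigma>) * (norm y)^2 \<le> 2 * B'"
        proof (cases "norm (P Plus) \<le> norm (P Minus)")
          case True
          then have "(norm y)^2 \<le> 2 * norm (P Minus)" using diff by simp
          then have "norm (P Plus) * (norm y)^2 \<le> norm (P Plus) * (2 * norm (P Minus))"
            by (intro mult_left_mono) auto
          then show ?thesis using PP by (intro exI[of _ Plus]) simp
        next
          case False
          then have "(norm y)^2 \<le> 2 * norm (P Plus)" using diff by simp
          then have "norm (P Minus) * (norm y)^2 \<le> norm (P Minus) * (2 * norm (P Plus))"
            by (intro mult_left_mono) auto
          then show ?thesis using PP by (intro exI[of _ Minus]) (simp add: mult_ac)
        qed
        then obtain \<sigma> where \<sigma>: "norm (P \<sigma>) * (norm y)^2 \<le> 2 * B'" by blast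
        define p where "p = xy_to_uw \<alpha> \<sigma> z (x, y)"
        have "fst p = P \<sigma> * y^2"
          unfolding P_def p_def w_def using y0 by (simp add: power_divide)
        then have "norm (fst p) \<le> 2 * B'"
          using \<sigma> by (simp add: norm_mult norm_power)
        moreover have "norm (snd p) \<le> 1"
          using w1 by (simp add: p_def w_def inverse_eq_divide)
        moreover have "q = normal_form \<alpha> z (UW \<sigma>, (fst p, snd p))"
          using q XY y0 unfolding prod.collapse by (simp add: normal_form_UW p_def)
        moreover have "norm (fst p) \<le> K" "norm (snd p) \<le> K"
          using calculation(1,2) KK by linarith+
        ultimately show ?thesis
          by - (rule exI[of _ "UW \<sigma>"], rule exI[of _ "fst p"], rule exI[of _ "snd p"], simp)
      qed
    qed
  qed
qed

text \<open>A bounded Lyapunov value places the point in a bounded part of some chart, where the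
  existence radius depends only on the bound; \<delta> is the least of the three radii. K + R bounds
  the coordinates and z by one constant.\<close>

lemma uniform_section:
  assumes B: "B \<ge> 0" and R: "R \<ge> 0"
  shows "\<exists>\<delta>>0. \<forall>z q. norm z \<le> R \<and> normal_point q \<and> norm (lyapunov \<alpha> z q) \<le> B \<longrightarrow>
    (\<exists>s. section_on \<alpha> (ball z \<delta>) s \<and> s z = q)"
proof -
  obtain K where K: "K \<ge> 0" "\<And>z q. norm z \<le> R \<Longrightarrow> normal_point q \<Longrightarrow> norm (lyapunov \<alpha> z q) \<le> B \<Longrightarrow>
      \<exists>i a b. q = normal_form \<alpha> z (i, (a, b)) \<and> norm a \<le> K \<and> norm b \<le> K"
    using lyapunov_proper[OF B R, of \<alpha>] by auto
  have "\<forall>i. \<exists>r>0. \<forall>z0 a b. norm z0 \<le> K + R \<and> norm a \<le> K + R \<and> norm b \<le> K + R \<longrightarrow>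
      (\<exists>x y. chart_solution \<alpha> i (ball z0 r) x y \<and> x z0 = a \<and> y z0 = b)"
    using K(1) R by (intro allI local_solution polynomial_chart_field) auto
  from choice[OF this] obtain r where "\<forall>i. r i > 0 \<and> (\<forall>z0 a b. norm z0 \<le> K + R \<and>
      norm a \<le> K + R \<and> norm b \<le> K + R \<longrightarrow>
      (\<exists>x y. chart_solution \<alpha> i (ball z0 (r i)) x y \<and> x z0 = a \<and> y z0 = b))" ..
  then have r: "\<And>i. r i > 0" "\<And>i z0 a b. norm z0 \<le> K + R \<Longrightarrow> norm a \<le> K + R \<Longrightarrow> norm b \<le> K + R \<Longrightarrow>
      \<exists>x y. chart_solution \<alpha> i (ball z0 (r i)) x y \<and> x z0 = a \<and> y z0 = b"
    by simp_all
  define \<delta> where "\<delta> = min (r XY) (min (r (UW Plus)) (r (UW Minus)))"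
  have \<delta>: "\<delta> > 0" using r(1) by (simp add: \<delta>_def)
  have \<delta>r: "\<delta> \<le> r i" for i
  proof (cases i)
    case (UW \<sigma>)
    then show ?thesis by (cases \<sigma>) (auto simp: \<delta>_def)
  qed (simp add: \<delta>_def)
  show ?thesis
  proof (intro exI[of _ \<delta>] conjI allI impI)
    fix z q assume h: "norm z \<le> R \<and> normal_point q \<and> norm (lyapunov \<alpha> z q) \<le> B"
    then obtain i a b where q: "q = normal_form \<alpha> z (i, (a, b))" "norm a \<le> K" "norm b \<le> K"
      using K(2)[of z q] by auto
    obtain x y where xy: "chart_solution \<alpha> i (ball z (r i)) x y" "x z = a" "y z = b"
      using r(2)[of z a b i] h q R K(1) by auto
    have "section_on \<alpha> (ball z \<delta>) (\<lambda>t. normal_form \<alpha> t (i, (x t, y t)))"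
      by (rule section_on_subset[OF section_on_chart[OF xy(1)]]) (use \<delta>r[of i] in auto)
    then show "\<exists>s. section_on \<alpha> (ball z \<delta>) s \<and> s z = q"
      using q xy by (intro exI[of _ "\<lambda>t. normal_form \<alpha> t (i, (x t, y t))"]) simp
  qed (rule \<delta>)
qed

text \<open>Discs of radius \<delta> about points of a disc of radius r cover the concentric disc of
  radius r + \<delta>. Intersections of discs are convex, hence connected, so uniqueness makes the
  pieces agree.\<close>

lemma section_glue:
  assumes s: "section_on \<alpha> (ball z0 r) s" and \<delta>: "\<delta> > 0" and r: "r > 0"
    and ext: "\<And>a. a \<in> ball z0 r \<Longrightarrow> \<exists>s'. section_on \<alpha> (ball a \<delta>) s' \<and> s' a = s a"
  shows "\<exists>s'. section_on \<alpha> (ball z0 (r + \<delta>)) s' \<and> s' z0 = s z0"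
proof -
  obtain S where S: "\<And>a. a \<in> ball z0 r \<Longrightarrow> section_on \<alpha> (ball a \<delta>) (S a)" "\<And>a. a \<in> ball z0 r \<Longrightarrow> S a a = s a"
    using ext by metis
  have near: "\<exists>a. a \<in> ball z0 r \<and> z \<in> ball a \<delta>" if z: "z \<in> ball z0 (r + \<delta>)" for z
  proof (cases "z = z0")
    case False
    define d where "d = norm (z - z0)"
    have d: "d > 0" "d < r + \<delta>" using z False by (auto simp: d_def dist_norm norm_minus_commute)
    \<comment> \<open>Contracting towards \<open>z0\<close> by this ratio moves z into the old disc
      and by less than \<delta>.\<close>
    define l where "l = r / (r + \<delta>)"
    have l: "0 < l" "l < 1" using r \<delta> by (auto simp: l_def)
    define a where "a = z0 + of_real l * (z - z0)"
    have "norm (a - z0) = l * d" using l by (simp add: a_def d_def norm_mult)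
    also have "\<dots> < l * (r + \<delta>)" using l d by (intro mult_strict_left_mono)
    also have "\<dots> = r" using r \<delta> by (simp add: l_def)
    finally have 1: "a \<in> ball z0 r" by (simp add: dist_norm norm_minus_commute)
    have "z - a = of_real (1 - l) * (z - z0)" by (simp add: a_def algebra_simps)
    then have "norm (z - a) = \<bar>1 - l\<bar> * d" by (simp only: norm_mult norm_of_real d_def)
    also have "\<dots> = (1 - l) * d" using l by simp
    also have "\<dots> < (1 - l) * (r + \<delta>)" using l d by (intro mult_strict_left_mono) auto
    also have "\<dots> = \<delta>" using r \<delta> by (simp add: l_def field_simps)
    finally have "z \<in> ball a \<delta>" by (simp add: dist_norm norm_minus_commute)
    then show ?thesis using 1 by blast
  next
    case True
    then show ?thesis using r \<delta> by (intro exI[of _ z0]) simp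
  qed
  have agree: "S a z = s z" if "a \<in> ball z0 r" "z \<in> ball a \<delta>" "z \<in> ball z0 r" for a z
  proof (rule section_unique[of "ball a \<delta> \<inter> ball z0 r" \<alpha> "S a" s a])
    show "connected (ball a \<delta> \<inter> ball z0 r)"
      by (intro convex_connected convex_Int convex_ball)
    show "section_on \<alpha> (ball a \<delta> \<inter> ball z0 r) (S a)"
      by (rule section_on_subset[OF S(1)[OF that(1)]]) auto
    show "section_on \<alpha> (ball a \<delta> \<inter> ball z0 r) s"
      by (rule section_on_subset[OF s]) auto
    show "S a a = s a" using S(2) that(1) .
  qed (use that \<delta> in auto)
  have agree2: "S a z = S b z" if ab: "a \<in> ball z0 r" "b \<in> ball z0 r" "z \<in> ball a \<delta>" "z \<in> ball b \<delta>" for a b z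
  proof -
    \<comment> \<open>The midpoint lies in both small discs and, by convexity, in the old disc,
      where both extensions equal s. It is the starting point for uniqueness on the lens.\<close>
    define m where "m = midpoint a b"
    have "m \<in> ball z0 r"
      using convex_contains_segment[of "ball z0 r"] midpoint_in_closed_segment[of a b] ab(1,2) convex_ball
      unfolding m_def by blast
    moreover have "dist a b < 2 * \<delta>"
      using ab(3,4) dist_triangle2[of a b z] by (simp add: dist_commute)
    then have "m \<in> ball a \<delta>" "m \<in> ball b \<delta>"
      by (auto simp: m_def dist_midpoint)
    ultimately have "S a m = S b m" using agree ab(1,2) by simp
    show ?thesis
    proof (rule section_unique[of "ball a \<delta> \<inter> ball b \<delta>" \<alpha> "S a" "S b" m])
      show "connected (ball a \<delta> \<inter> ball b \<delta>)"
        by (intro convex_connected convex_Int convex_ball)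
      show "section_on \<alpha> (ball a \<delta> \<inter> ball b \<delta>) (S a)"
        by (rule section_on_subset[OF S(1)[OF ab(1)]]) auto
      show "section_on \<alpha> (ball a \<delta> \<inter> ball b \<delta>) (S b)"
        by (rule section_on_subset[OF S(1)[OF ab(2)]]) auto
      show "S a m = S b m" by fact
    qed (use ab \<open>m \<in> ball a \<delta>\<close> \<open>m \<in> ball b \<delta>\<close> in auto)
  qed
  obtain c where c: "\<And>z. z \<in> ball z0 (r + \<delta>) \<Longrightarrow> c z \<in> ball z0 r \<and> z \<in> ball (c z) \<delta>"
    using near by metis
  define s' where "s' z = S (c z) z" for z
  have s'S: "s' z = S a z" if "z \<in> ball z0 (r + \<delta>)" "a \<in> ball z0 r" "z \<in> ball a \<delta>" for z a
    unfolding s'_def using agree2 c[OF that(1)] that by blast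
  have "section_on \<alpha> (ball z0 (r + \<delta>)) s'"
  proof (rule section_on_local)
    fix z assume z: "z \<in> ball z0 (r + \<delta>)"
    let ?T = "ball (c z) \<delta> \<inter> ball z0 (r + \<delta>)"
    have "section_on \<alpha> ?T (S (c z))"
      by (rule section_on_subset[OF S(1)]) (use c[OF z] in auto)
    then have "section_on \<alpha> ?T s'"
      by (rule section_on_cong) (use s'S c[OF z] in auto)
    then show "\<exists>T. open T \<and> z \<in> T \<and> T \<subseteq> ball z0 (r + \<delta>) \<and> section_on \<alpha> T s'"
      using c[OF z] z by (intro exI[of _ ?T]) auto
  qed
  moreover have "s' z0 = s z0"
    using s'S[of z0 z0] S(2)[of z0] r \<delta> by simp
  ultimately show ?thesis by blast
qed

text \<open>The bound B is computed beforehand from the final radius \<rho>, so every partial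
  section obeys it and one \<delta> serves all extensions. Finitely many of them reach
  \<rho>.\<close>

lemma section_on_ball:
  assumes q: "normal_point q" and \<rho>: "\<rho> > 0"
  shows "\<exists>s. section_on \<alpha> (ball z0 \<rho>) s \<and> s z0 = q"
proof -
  define R where "R = norm z0 + \<rho>"
  have R: "R \<ge> 0" using \<rho> by (simp add: R_def)
  define B2 where "B2 = exp (4 * growth_const \<alpha> R * \<rho>) * (1 + (norm (lyapunov \<alpha> z0 q))^2)"
  define B where "B = sqrt B2"
  have B2: "B2 \<ge> 0" by (simp add: B2_def)
  then have B: "B \<ge> 0" by (simp add: B_def)
  have g: "growth_const \<alpha> R \<ge> 0" using R by (simp add: growth_const_def)
  obtain \<delta> where \<delta>: "\<delta> > 0" "\<And>z q. norm z \<le> R \<Longrightarrow> normal_point q \<Longrightarrow> norm (lyapunov \<alpha> z q) \<le> B \<Longrightarrow>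
      \<exists>s. section_on \<alpha> (ball z \<delta>) s \<and> s z = q"
    using uniform_section[OF B R, of \<alpha>] by auto
  have step: "norm (lyapunov \<alpha> z (s z)) \<le> B" if "section_on \<alpha> (ball z0 r) s" "s z0 = q" "r \<le> \<rho>" "z \<in> ball z0 r" for r s z
  proof -
    have "(norm (lyapunov \<alpha> z (s z)))^2 \<le> exp (4 * growth_const \<alpha> R * r) * (1 + (norm (lyapunov \<alpha> z0 (s z0)))^2)"
      by (rule lyapunov_bound[OF that(1,4)]) (use that(3) in \<open>simp add: R_def\<close>)
    also have "\<dots> \<le> B2"
      unfolding B2_def that(2) using that(3) g by (intro mult_right_mono) (auto intro!: mult_left_mono)
    finally show ?thesis
      unfolding B_def by (rule real_le_rsqrt)
  qed
  have z0B: "norm (lyapunov \<alpha> z0 q) \<le> B"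
  proof -
    have "1 * (1 + (norm (lyapunov \<alpha> z0 q))^2) \<le> B2"
      unfolding B2_def using g \<rho> by (intro mult_right_mono) auto
    then have "(norm (lyapunov \<alpha> z0 q))^2 \<le> B2" by simp
    then show ?thesis unfolding B_def by (rule real_le_rsqrt)
  qed
  \<comment> \<open>The hypothesis has n but the disc n + 1 steps: the last extension may overshoot
    \<rho>, while the discs extended from stay within it.\<close>
  have grow: "real n * \<delta> \<le> \<rho> \<Longrightarrow> \<exists>s. section_on \<alpha> (ball z0 (real (Suc n) * \<delta>)) s \<and> s z0 = q" for n
  proof (induction n)
    case 0
    show ?case using \<delta>(2)[OF _ q z0B] \<rho> by (simp add: R_def)
  next
    case (Suc n)
    then have le: "real (Suc n) * \<delta> \<le> \<rho>" "real n * \<delta> \<le> \<rho>"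
      using \<delta>(1) by (auto simp: algebra_simps)
    obtain s where s: "section_on \<alpha> (ball z0 (real (Suc n) * \<delta>)) s" "s z0 = q"
      using Suc.IH[OF le(2)] by blast
    have "\<exists>s'. section_on \<alpha> (ball z0 (real (Suc n) * \<delta> + \<delta>)) s' \<and> s' z0 = s z0"
    proof (rule section_glue[OF s(1) \<delta>(1)])
      show "0 < real (Suc n) * \<delta>" using \<delta>(1) by simp
      fix a assume a: "a \<in> ball z0 (real (Suc n) * \<delta>)"
      show "\<exists>s'. section_on \<alpha> (ball a \<delta>) s' \<and> s' a = s a"
      proof (rule \<delta>(2))
        show "norm a \<le> R"
          using a le norm_triangle_sub[of a z0] by (simp add: R_def dist_norm norm_minus_commute)
        show "normal_point (s a)" by (rule section_on_normal_point[OF s(1) a])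
        show "norm (lyapunov \<alpha> a (s a)) \<le> B" by (rule step[OF s le(1) a])
      qed
    qed
    then show ?case using s(2) by (simp add: algebra_simps)
  qed
  define n where "n = nat \<lfloor>\<rho> / \<delta>\<rfloor>"
  have n: "real n \<le> \<rho> / \<delta>" "\<rho> / \<delta> < real n + 1"
    using \<rho> \<delta>(1) by (auto simp: n_def)
  then have n1: "real n * \<delta> \<le> \<rho>" and n2: "\<rho> < real (Suc n) * \<delta>"
    using \<delta>(1) by (auto simp: field_simps)
  obtain s where s: "section_on \<alpha> (ball z0 (real (Suc n) * \<delta>)) s" "s z0 = q"
    using grow[OF n1] by blast
  have "section_on \<alpha> (ball z0 \<rho>) s"
    by (rule section_on_subset[OF s(1)]) (use n2 in auto)
  then show ?thesis using s(2) by blast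
qed

theorem global_section:
  assumes q: "normal_point q"
  shows "\<exists>s. section_on \<alpha> UNIV s \<and> s z0 = q"
proof -
  have "\<forall>\<rho>. \<exists>s. \<rho> > 0 \<longrightarrow> section_on \<alpha> (ball z0 \<rho>) s \<and> s z0 = q"
    using section_on_ball[OF q] by blast
  from choice[OF this] obtain S where
    "\<forall>\<rho>. \<rho> > 0 \<longrightarrow> section_on \<alpha> (ball z0 \<rho>) (S \<rho>) \<and> S \<rho> z0 = q" ..
  then have S: "\<And>\<rho>. \<rho> > 0 \<Longrightarrow> section_on \<alpha> (ball z0 \<rho>) (S \<rho>)" "\<And>\<rho>. \<rho> > 0 \<Longrightarrow> S \<rho> z0 = q"
    by simp_all
  have agree: "S a z = S b z" if "0 < a" "a \<le> b" "z \<in> ball z0 a" for a b z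
  proof (rule section_unique[of "ball z0 a" \<alpha> "S a" "S b" z0])
    show "section_on \<alpha> (ball z0 a) (S b)"
      by (rule section_on_subset[OF S(1)]) (use that in auto)
  qed (use that S in auto)
  define s where "s z = S (dist z0 z + 1) z" for z
  have sS: "s z = S b z" if "z \<in> ball z0 b" for z b
  proof -
    have b: "b > 0" using that zero_le_dist[of z0 z] by (simp del: zero_le_dist)
    have d: "dist z0 z + 1 > 0" using zero_le_dist[of z0 z] by linarith
    show ?thesis
    proof (cases "dist z0 z + 1 \<le> b")
      case True
      then show ?thesis unfolding s_def by (intro agree d) auto
    next
      case False
      then show ?thesis unfolding s_def using that b by (intro agree[symmetric]) auto
    qed
  qed
  have "section_on \<alpha> UNIV s"
  proof (rule section_on_local)
    fix z
    have d: "dist z0 z + 1 > 0" using zero_le_dist[of z0 z] by linarith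
    have "section_on \<alpha> (ball z0 (dist z0 z + 1)) s"
      by (rule section_on_cong[OF S(1)[OF d]]) (rule sS)
    then show "\<exists>T. open T \<and> z \<in> T \<and> T \<subseteq> UNIV \<and> section_on \<alpha> T s"
      by (intro exI[of _ "ball z0 (dist z0 z + 1)"]) auto
  qed
  moreover have "s z0 = q"
    using S(2)[of 1] by (simp add: s_def)
  ultimately show ?thesis by blast
qed

lemma complex_differentiable_at_of_field:
  fixes f :: "complex \<Rightarrow> complex"
  assumes "(f has_field_derivative D) (at z)"
  shows "complex_differentiable_at f z"
  using assms unfolding complex_differentiable_at_def has_field_derivative_def
  by (intro exI[of _ "(*) D"]) (auto simp: cscale_complex_def mult_ac)

text \<open>The global section through one value of the given solution coincides with it on the
  connected set U. Passing from normal forms to classes turns it into a holomorphic section.\<close>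

theorem painleve_property:
  assumes U: "open U" "connected U" "U \<noteq> {}" and sol: "solution_on (PII_x \<alpha>) PII_y U x y"
  shows "\<exists>s. holomorphic_into s (total_chart (PII_chart \<alpha>)) \<and> (\<forall>z. snd (s z) = z) \<and>
    (\<forall>z\<in>U. s z = total_chart (PII_chart \<alpha>) XY ((x z, y z), z))"
proof -
  obtain z0 where z0: "z0 \<in> U" using U by blast
  have "normal_point (XY, (x z0, y z0))" by (simp add: normal_point_def)
  then obtain s where s: "section_on \<alpha> UNIV s" "s z0 = (XY, (x z0, y z0))"
    using global_section by blast
  have "chart_solution \<alpha> XY U x y" using sol by simp
  from section_on_chart[OF this U(1)]
  have sU: "section_on \<alpha> U (\<lambda>t. (XY, (x t, y t)))" by simp
  have eq: "s z = (XY, (x z, y z))" if "z \<in> U" for z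
    by (rule section_unique[OF U(1,2) section_on_subset[OF s(1) U(1)] sU z0 _ that]) (use s in auto)
  define \<Sigma> where "\<Sigma> z = (PII_chart \<alpha> z (fst (s z)) (snd (s z)), z)" for z
  have "holomorphic_into \<Sigma> (total_chart (PII_chart \<alpha>))"
    unfolding holomorphic_into_def
  proof
    fix t0
    obtain N i a b where N: "open N" "t0 \<in> N" "N \<subseteq> UNIV" "chart_solution \<alpha> i N a b"
      "\<And>t. t \<in> N \<Longrightarrow> s t = normal_form \<alpha> t (i, (a t, b t))"
      by (rule section_onE[OF s(1), of t0]) auto
    have "holomorphic_map_on (\<lambda>t. ((a t, b t), t)) N"
      unfolding holomorphic_map_on_iff
    proof (intro conjI ballI N(1))
      fix t assume t: "t \<in> N"
      have "complex_differentiable_at a t" "complex_differentiable_at b t"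
        using N(4) t unfolding solution_on_def by (auto intro: complex_differentiable_at_of_field)
      then show "complex_differentiable_at (\<lambda>t. ((a t, b t), t)) t"
        by (intro complex_differentiable_at_Pair complex_differentiable_at_id)
    qed
    moreover have "\<Sigma> t = total_chart (PII_chart \<alpha>) i ((a t, b t), t)" if "t \<in> N" for t
    proof -
      have "normal_form \<alpha> t (fst (s t), snd (s t)) = normal_form \<alpha> t (i, (a t, b t))"
      proof -
        have "normal_form \<alpha> t (s t) = s t"
          by (rule normal_form_normal_point[OF section_on_normal_point[OF s(1)]]) simp
        then show ?thesis using N(5)[OF that] by simp
      qed
      then show ?thesis
        unfolding \<Sigma>_def total_chart_def fst_conv snd_conv
        by (simp only: PII_chart_eq_iff[symmetric])
    qed
    ultimately show "\<exists>N i h. t0 \<in> N \<and> holomorphic_map_on h N \<and>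
        (\<forall>t\<in>N. \<Sigma> t = total_chart (PII_chart \<alpha>) i (h t))"
      using N(2) by (intro exI[of _ N] exI[of _ i] exI[of _ "\<lambda>t. ((a t, b t), t)"]) blast
  qed
  moreover have "snd (\<Sigma> z) = z" for z by (simp add: \<Sigma>_def)
  moreover have "\<Sigma> z = total_chart (PII_chart \<alpha>) XY ((x z, y z), z)" if "z \<in> U" for z
    using eq[OF that] by (simp add: \<Sigma>_def total_chart_def)
  ultimately show ?thesis by blast
qed

subsection \<open>Local triviality\<close>

text \<open>The product of a quotient map with the identity need not be a quotient map. Here the
  charts are open maps, so products of chart images with open sets form a basis for both
  topologies.\<close>

lemma glued_const_family:
  fixes \<psi> :: "'i \<Rightarrow> complex \<times> complex \<Rightarrow> 'p"
  assumes op: "\<And>i A. open A \<Longrightarrow> openin (glued_topology \<psi>) (\<psi> i ` A)"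
  shows "glued_topology (total_chart (\<lambda>_. \<psi>)) = prod_topology (glued_topology \<psi>) euclidean"
proof (rule topology_eq[THEN iffD2], rule allI, rule iffI)
  fix U :: "('p \<times> complex) set"
  assume U: "openin (glued_topology (total_chart (\<lambda>_. \<psi>))) U"
  show "openin (prod_topology (glued_topology \<psi>) euclidean) U"
    unfolding openin_prod_topology_alt
  proof (intro allI impI)
    fix e z assume ez: "(e, z) \<in> U"
    have "(e, z) \<in> (\<Union>i. range (total_chart (\<lambda>_. \<psi>) i))"
      using U ez unfolding openin_glued_topology by blast
    then obtain i p where e: "e = \<psi> i p"
      by (auto simp: total_chart_def)
    have "open (total_chart (\<lambda>_. \<psi>) i -` U)" "(p, z) \<in> total_chart (\<lambda>_. \<psi>) i -` U"
      using U ez e by (auto simp: openin_glued_topology total_chart_def)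
    then obtain A B where AB: "open A" "open B" "(p, z) \<in> A \<times> B" "A \<times> B \<subseteq> total_chart (\<lambda>_. \<psi>) i -` U"
      by (rule open_prod_elim)
    have "openin (glued_topology \<psi>) (\<psi> i ` A)" "openin euclidean B"
      using op AB(1,2) by simp_all
    moreover have "e \<in> \<psi> i ` A" "z \<in> B"
      using AB(3) e by auto
    moreover have "\<psi> i ` A \<times> B \<subseteq> U"
    proof
      fix P assume "P \<in> \<psi> i ` A \<times> B"
      then obtain q t where "P = (\<psi> i q, t)" "q \<in> A" "t \<in> B" by auto
      then have "total_chart (\<lambda>_. \<psi>) i (q, t) \<in> U" using AB(4) by auto
      then show "P \<in> U" using \<open>P = _\<close> by (simp add: total_chart_def)
    qed
    ultimately show "\<exists>V W. openin (glued_topology \<psi>) V \<and> openin euclidean W \<and> e \<in> V \<and> z \<in> W \<and> V \<times> W \<subseteq> U"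
      by - (rule exI[of _ "\<psi> i ` A"], rule exI[of _ B], intro conjI)
  qed
next
  fix U :: "('p \<times> complex) set"
  assume U: "openin (prod_topology (glued_topology \<psi>) euclidean) U"
  show "openin (glued_topology (total_chart (\<lambda>_. \<psi>))) U"
    unfolding openin_glued_topology
  proof (intro conjI allI)
    show "U \<subseteq> (\<Union>i. range (total_chart (\<lambda>_. \<psi>) i))"
    proof
      fix P assume "P \<in> U"
      then have "P \<in> topspace (prod_topology (glued_topology \<psi>) euclidean)"
        using openin_subset[OF U] by blast
      then obtain i p where "fst P = \<psi> i p"
        by (auto simp: topspace_glued_topology)
      then have "P = total_chart (\<lambda>_. \<psi>) i (p, snd P)"
        by (simp add: total_chart_def prod_eq_iff)
      then show "P \<in> (\<Union>i. range (total_chart (\<lambda>_. \<psi>) i))"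
        by blast
    qed
    show "open (total_chart (\<lambda>_. \<psi>) i -` U)" for i
    proof (rule open_prod_intro)
      fix P assume "P \<in> total_chart (\<lambda>_. \<psi>) i -` U"
      then have "(\<psi> i (fst P), snd P) \<in> U" by (simp add: total_chart_def)
      from U[unfolded openin_prod_topology_alt, rule_format, OF this]
      obtain V W where VW: "openin (glued_topology \<psi>) V" "openin euclidean W" "\<psi> i (fst P) \<in> V"
        "snd P \<in> W" "V \<times> W \<subseteq> U"
        by (elim exE conjE) (rule that)
      then have "open (\<psi> i -` V)" "open W" by (simp_all add: openin_glued_topology)
      moreover have "P \<in> (\<psi> i -` V) \<times> W" using VW by (simp add: mem_Times_iff)
      moreover have "(\<psi> i -` V) \<times> W \<subseteq> total_chart (\<lambda>_. \<psi>) i -` U"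
        using VW(5) by (auto simp: total_chart_def)
      ultimately show "\<exists>A B. open A \<and> open B \<and> P \<in> A \<times> B \<and> A \<times> B \<subseteq> total_chart (\<lambda>_. \<psi>) i -` U"
        by - (rule exI[of _ "\<psi> i -` V"], rule exI[of _ W], intro conjI)
    qed
  qed
qed

text \<open>A map out of a glued space is continuous as soon as it is so in coordinates, and h is
  its local expression; the target chart may vary with the point.\<close>

lemma continuous_map_glued:
  fixes \<psi> :: "'i \<Rightarrow> 'm::topological_space \<Rightarrow> 'p" and \<psi>' :: "'j \<Rightarrow> 'n::topological_space \<Rightarrow> 'q"
  assumes op: "\<And>i. open (\<psi> i -` S)"
    and loc: "\<And>i P. \<psi> i P \<in> S \<Longrightarrow> \<exists>N j h. open N \<and> P \<in> N \<and> continuous_on N h \<and>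
      (\<forall>Q\<in>N. \<Theta> (\<psi> i Q) = \<psi>' j (h Q))"
    and img: "\<And>q. q \<in> topspace (glued_topology \<psi>) \<Longrightarrow> q \<in> S \<Longrightarrow> \<Theta> q \<in> S'"
  shows "continuous_map (subtopology (glued_topology \<psi>) S) (subtopology (glued_topology \<psi>') S') \<Theta>"
  unfolding continuous_map_in_subtopology
proof
  show "\<Theta> \<in> topspace (subtopology (glued_topology \<psi>) S) \<rightarrow> S'"
    using img by auto
  show "continuous_map (subtopology (glued_topology \<psi>) S) (glued_topology \<psi>') \<Theta>"
    unfolding continuous_map_def
  proof (intro conjI allI impI)
    show "\<Theta> \<in> topspace (subtopology (glued_topology \<psi>) S) \<rightarrow> topspace (glued_topology \<psi>')"
    proof
      fix q assume "q \<in> topspace (subtopology (glued_topology \<psi>) S)"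
      then obtain i P where q: "q = \<psi> i P" "\<psi> i P \<in> S" by (auto simp: topspace_glued_topology)
      obtain N j h where "P \<in> N" "\<forall>Q\<in>N. \<Theta> (\<psi> i Q) = \<psi>' j (h Q)"
        using loc[OF q(2)] by blast
      then have "\<Theta> q = \<psi>' j (h P)" using q by blast
      then show "\<Theta> q \<in> topspace (glued_topology \<psi>')" by (auto simp: topspace_glued_topology)
    qed
    fix U assume U: "openin (glued_topology \<psi>') U"
    let ?V = "{q \<in> topspace (glued_topology \<psi>). q \<in> S \<and> \<Theta> q \<in> U}"
    have "openin (glued_topology \<psi>) ?V"
      unfolding openin_glued_topology
    proof (intro conjI allI)
      show "?V \<subseteq> (\<Union>i. range (\<psi> i))" by (auto simp: topspace_glued_topology)
      fix i
      show "open (\<psi> i -` ?V)"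
      proof (subst open_subopen, intro ballI)
        fix P assume "P \<in> \<psi> i -` ?V"
        then have P: "\<psi> i P \<in> S" "\<Theta> (\<psi> i P) \<in> U" by auto
        obtain N j h where N: "open N" "P \<in> N" "continuous_on N h" "\<forall>Q\<in>N. \<Theta> (\<psi> i Q) = \<psi>' j (h Q)"
          using loc[OF P(1)] by blast
        have "open (\<psi>' j -` U)" using U by (simp add: openin_glued_topology)
        then have "open (N \<inter> h -` (\<psi>' j -` U))"
          by (rule continuous_open_preimage[OF N(3,1)])
        then have "open ((N \<inter> h -` (\<psi>' j -` U)) \<inter> \<psi> i -` S)"
          using op by (rule open_Int)
        moreover have "P \<in> (N \<inter> h -` (\<psi>' j -` U)) \<inter> \<psi> i -` S"
          using N(2,4) P by simp
        moreover have "(N \<inter> h -` (\<psi>' j -` U)) \<inter> \<psi> i -` S \<subseteq> \<psi> i -` ?V"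
          using N(4) by (auto simp: topspace_glued_topology)
        ultimately show "\<exists>T. open T \<and> P \<in> T \<and> T \<subseteq> \<psi> i -` ?V"
          by - (rule exI, intro conjI)
      qed
    qed
    moreover have "{q \<in> topspace (subtopology (glued_topology \<psi>) S). \<Theta> q \<in> U} = ?V \<inter> S"
      by auto
    ultimately show "openin (subtopology (glued_topology \<psi>) S)
        {q \<in> topspace (subtopology (glued_topology \<psi>) S). \<Theta> q \<in> U}"
      unfolding openin_subtopology by blast
  qed
qed

text \<open>The fibres over \<open>z\<close> and \<open>z0\<close> are identified by \<open>(x, y) \<mapsto> (x, y + d \<tau> y)\<close> with \<open>d = z - z0\<close>.
  Near infinity \<open>\<tau> y = 1 / (4 y)\<close>, so that \<open>y\<^sup>2 + z/2\<close> is turned into the corresponding expression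
  at \<open>z0\<close> up to terms of order \<open>y\<^sup>-\<^sup>2\<close>, for both signs at once; near \<open>0\<close> the shift is smoothed out.\<close>

definition shift_amount :: "complex \<Rightarrow> complex"
  where "shift_amount y = cnj y / of_real (4 * (max 1 (norm y))^2)"

lemma shift_amount_large:
  assumes "norm y \<ge> 1"
  shows "shift_amount y = 1 / (4 * y)"
proof -
  have y: "y \<noteq> 0" using assms by auto
  have "shift_amount y = cnj y / (4 * (of_real (norm y))^2)"
    using assms by (simp add: shift_amount_def max_def)
  also have "\<dots> = 1 / (4 * y)"
    using y by (simp add: complex_norm_square field_simps flip: of_real_power)
  finally show ?thesis .
qed

lemma norm_shift_amount: "norm (shift_amount y) \<le> 1 / 4"
proof -
  define M where "M = max 1 (norm y)"
  have M: "M \<ge> 1" "norm y \<le> M" by (auto simp: M_def)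
  have "M * 1 \<le> M * M" using M(1) by (intro mult_left_mono) auto
  then have "norm y \<le> M^2"
    using M(2) unfolding power2_eq_square by linarith
  then show ?thesis
    unfolding shift_amount_def M_def[symmetric] using M
    by (simp add: norm_divide norm_mult norm_power divide_simps)
qed

text \<open>A constant below 1 is what makes the shift bijective for |d| \<le> 1. One quarter comes
  from varying the numerator and two quarters from varying the squared maximum.\<close>

lemma shift_amount_lipschitz:
  "norm (shift_amount y1 - shift_amount y2) \<le> 3/4 * norm (y1 - y2)"
proof -
  define M1 where "M1 = max 1 (norm y1)"
  define M2 where "M2 = max 1 (norm y2)"
  define \<Delta> where "\<Delta> = norm (y1 - y2)"
  have M: "M1 \<ge> 1" "M2 \<ge> 1" "norm y2 \<le> M2" by (auto simp: M1_def M2_def)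
  have d: "\<bar>M2 - M1\<bar> \<le> \<Delta>"
    using norm_triangle_ineq3[of y1 y2] unfolding M1_def M2_def \<Delta>_def by auto
  \<comment> \<open>1/M1^2 - 1/M2^2 is written with the factor M2 - M1, which the distance of the
    points bounds.\<close>
  have "4 * (shift_amount y1 - shift_amount y2)
      = cnj (y1 - y2) * of_real (1 / M1^2) + cnj y2 * of_real ((M2 - M1) * (1 / (M1 * M2^2) + 1 / (M1^2 * M2)))"
    using M unfolding shift_amount_def M1_def[symmetric] M2_def[symmetric]
    by (simp add: field_simps power2_eq_square)
  then have "4 * norm (shift_amount y1 - shift_amount y2)
      = norm (cnj (y1 - y2) * of_real (1 / M1^2) + cnj y2 * of_real ((M2 - M1) * (1 / (M1 * M2^2) + 1 / (M1^2 * M2))))"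
    by (metis norm_mult norm_numeral)
  also have "\<dots> \<le> \<Delta> * (1 / M1^2) + norm y2 * (\<bar>M2 - M1\<bar> * (1 / (M1 * M2^2) + 1 / (M1^2 * M2)))"
    using norm_triangle_ineq[of "cnj (y1 - y2) * of_real (1 / M1^2)"
        "cnj y2 * of_real ((M2 - M1) * (1 / (M1 * M2^2) + 1 / (M1^2 * M2)))"] M
    unfolding norm_mult complex_mod_cnj norm_of_real \<Delta>_def abs_mult by simp
  also have "\<dots> \<le> \<Delta> * 1 + M2 * (\<Delta> * (1 / M2 + 1 / M2))"
  proof (intro add_mono mult_mono)
    have "1 \<le> M1^2" using M by (simp add: one_le_power)
    then show "1 / M1^2 \<le> 1" by (subst divide_le_eq_1) linarith
    have "M2 * 1 \<le> M1 * M2^2"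
      using M mult_mono[of 1 "M1 * M2" M2 M2] mult_mono[of 1 M1 1 M2] by (simp add: power2_eq_square mult_ac)
    then show "1 / (M1 * M2^2) \<le> 1 / M2"
      using M by (intro divide_left_mono) auto
    have "1 * M2 \<le> M1^2 * M2"
      using M \<open>1 \<le> M1^2\<close> by (intro mult_right_mono) auto
    then show "1 / (M1^2 * M2) \<le> 1 / M2"
      using M by (intro divide_left_mono) auto
  qed (use M d in \<open>auto simp: \<Delta>_def intro!: add_nonneg_nonneg mult_nonneg_nonneg\<close>)
  also have "\<dots> = 3 * \<Delta>"
    using M by (simp add: field_simps)
  finally show ?thesis unfolding \<Delta>_def by simp
qed

lemma shift_unique:
  assumes "norm d \<le> 1"
  shows "\<exists>!y. y + d * shift_amount y = v"
proof -
  have "dist (v - d * shift_amount y1) (v - d * shift_amount y2) \<le> 3/4 * dist y1 y2" for y1 y2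
  proof -
    have "(v - d * shift_amount y1) - (v - d * shift_amount y2) = - (d * (shift_amount y1 - shift_amount y2))"
      by (simp add: algebra_simps)
    then have "dist (v - d * shift_amount y1) (v - d * shift_amount y2) = norm d * norm (shift_amount y1 - shift_amount y2)"
      by (simp only: dist_norm norm_minus_cancel norm_mult)
    also have "\<dots> \<le> 1 * (3/4 * norm (y1 - y2))"
      using assms shift_amount_lipschitz by (intro mult_mono) auto
    finally show ?thesis by (simp add: dist_norm)
  qed
  then have "\<exists>!y. v - d * shift_amount y = y"
    by (intro banach_fix_type[of "3/4"]) auto
  then show ?thesis
    by (simp add: eq_diff_eq diff_eq_eq eq_commute[of _ v])
qed

definition unshift_amount :: "complex \<Rightarrow> complex \<Rightarrow> complex"
  where "unshift_amount d v = (THE y. y + d * shift_amount y = v)"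

lemma unshift_shift:
  assumes "norm d \<le> 1"
  shows "unshift_amount d (y + d * shift_amount y) = y"
  unfolding unshift_amount_def by (rule the1_equality[OF shift_unique[OF assms]]) simp

lemma shift_unshift:
  assumes "norm d \<le> 1"
  shows "unshift_amount d v + d * shift_amount (unshift_amount d v) = v"
  unfolding unshift_amount_def by (rule theI'[OF shift_unique[OF assms]])

text \<open>The term 3/4 |y1 - y2| is absorbed on the left, which multiplies the rest by 4. The
  estimate is joint in d and v because z varies over the total space.\<close>

lemma unshift_lipschitz:
  assumes "norm d1 \<le> 1" "norm d2 \<le> 1"
  shows "norm (unshift_amount d1 v1 - unshift_amount d2 v2) \<le> 4 * norm (v1 - v2) + norm (d1 - d2)"
proof -
  define y1 where "y1 = unshift_amount d1 v1"
  define y2 where "y2 = unshift_amount d2 v2"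
  have "y1 - y2 = (v1 - v2) - (d1 * (shift_amount y1 - shift_amount y2) + (d1 - d2) * shift_amount y2)"
    using shift_unshift[OF assms(1), of v1] shift_unshift[OF assms(2), of v2]
    unfolding y1_def[symmetric] y2_def[symmetric] by (simp add: algebra_simps)
  then have "norm (y1 - y2) \<le> norm (v1 - v2) + norm (d1 * (shift_amount y1 - shift_amount y2) + (d1 - d2) * shift_amount y2)"
    by (simp only: norm_triangle_ineq4)
  also have "\<dots> \<le> norm (v1 - v2) + (norm (d1 * (shift_amount y1 - shift_amount y2)) + norm ((d1 - d2) * shift_amount y2))"
    by (intro add_left_mono norm_triangle_ineq)
  also have "\<dots> \<le> norm (v1 - v2) + (1 * (3/4 * norm (y1 - y2)) + norm (d1 - d2) * (1/4))"
    unfolding norm_mult using assms shift_amount_lipschitz norm_shift_amount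
    by (intro add_mono mult_mono order_refl) auto
  finally show ?thesis unfolding y1_def y2_def by simp
qed

lemma continuous_on_shift_amount: "continuous_on S shift_amount"
proof -
  have "continuous_on UNIV shift_amount"
    unfolding shift_amount_def by (intro continuous_intros) (auto simp: max_def)
  then show ?thesis by (rule continuous_on_subset) simp
qed

lemma continuous_on_unshift:
  assumes "continuous_on S f" "continuous_on S g" "\<And>P. P \<in> S \<Longrightarrow> norm (f P) \<le> 1"
  shows "continuous_on S (\<lambda>P. unshift_amount (f P) (g P))"
  unfolding continuous_on_def
proof
  fix P assume P: "P \<in> S"
  have f: "(f \<longlongrightarrow> f P) (at P within S)" and g: "(g \<longlongrightarrow> g P) (at P within S)"
    using assms(1,2) P by (auto simp: continuous_on_def)
  have "((\<lambda>Q. 4 * norm (g Q - g P) + norm (f Q - f P)) \<longlongrightarrow> 4 * norm (g P - g P) + norm (f P - f P)) (at P within S)"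
    by (intro tendsto_intros f g)
  then have "((\<lambda>Q. 4 * norm (g Q - g P) + norm (f Q - f P)) \<longlongrightarrow> 0) (at P within S)" by simp
  then have "((\<lambda>Q. unshift_amount (f Q) (g Q) - unshift_amount (f P) (g P)) \<longlongrightarrow> 0) (at P within S)"
  proof (rule Lim_null_comparison[rotated])
    show "\<forall>\<^sub>F Q in at P within S. norm (unshift_amount (f Q) (g Q) - unshift_amount (f P) (g P))
        \<le> 4 * norm (g Q - g P) + norm (f Q - f P)"
      unfolding eventually_at_filter
      by (intro always_eventually allI impI unshift_lipschitz assms(3) P)
  qed
  then show "((\<lambda>Q. unshift_amount (f Q) (g Q)) \<longlongrightarrow> unshift_amount (f P) (g P)) (at P within S)"
    by (rule Lim_null[THEN iffD2])
qed

text \<open>Intended for normal points; at infinity it is the limit of the finite shift. In (y +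
  d/(4 y))^2 = y^2 + d/2 + d^2/(16 y^2) the middle term compensates the change of z, and the last
  one, multiplied by y^2, moves u by \<sigma> d^2/16.\<close>

definition shift_point :: "complex \<Rightarrow> chart_point \<Rightarrow> chart_point"
  where "shift_point d q = (case fst q of
      XY \<Rightarrow> (XY, (fst (snd q), snd (snd q) + d * shift_amount (snd (snd q))))
    | UW \<sigma> \<Rightarrow> (UW \<sigma>, (fst (snd q) + pm_val \<sigma> * d^2 / 16, snd (snd q))))"

definition unshift_point :: "complex \<Rightarrow> chart_point \<Rightarrow> chart_point"
  where "unshift_point d q = (case fst q of
      XY \<Rightarrow> (XY, (fst (snd q), unshift_amount d (snd (snd q))))
    | UW \<sigma> \<Rightarrow> (UW \<sigma>, (fst (snd q) - pm_val \<sigma> * d^2 / 16, snd (snd q))))"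

lemma unshift_shift_point: "norm d \<le> 1 \<Longrightarrow> unshift_point d (shift_point d q) = q"
  by (cases q; cases "fst q") (simp_all add: shift_point_def unshift_point_def unshift_shift)

lemma shift_unshift_point: "norm d \<le> 1 \<Longrightarrow> shift_point d (unshift_point d q) = q"
  by (cases q; cases "fst q") (simp_all add: shift_point_def unshift_point_def shift_unshift)

lemma normal_point_shift: "normal_point (shift_point d q) = normal_point q"
  by (cases q; cases "fst q") (simp_all add: shift_point_def normal_point_def)

lemma normal_point_unshift: "normal_point (unshift_point d q) = normal_point q"
  by (cases q; cases "fst q") (simp_all add: unshift_point_def normal_point_def)

section \<open>The shift and its inverse in the coordinates at infinity\<close>

definition shift_uw :: "complex \<Rightarrow> pm \<Rightarrow> complex \<Rightarrow> complex \<times> complex \<Rightarrow> complex \<times> complex"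
  where "shift_uw \<alpha> \<sigma> d p = (let g = 1 + d * snd p ^ 2 / 4 in
    (g^2 * (fst p + pm_val \<sigma> * d^2 / 16) - (1/2 + pm_val \<sigma> * \<alpha>) * d * snd p / 4 * g, snd p / g))"

lemma shift_factor_nonzero:
  assumes "norm d \<le> 1" "norm w < 1"
  shows "1 + d * w^2 / 4 \<noteq> (0 :: complex)"
proof
  assume "1 + d * w^2 / 4 = 0"
  then have "d * w^2 = - 4" by (simp add: field_simps add_eq_0_iff)
  then have "norm d * norm w ^ 2 = 4" by (metis norm_minus_cancel norm_mult norm_numeral norm_power)
  moreover have "norm d * norm w ^ 2 \<le> 1 * 1"
    using assms by (intro mult_mono power_le_one) auto
  ultimately show False by simp
qed

text \<open>For |w| < 1 the shift is y to g y with g = 1 + d w^2 / 4, which does not vanish. Hence w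
  becomes w / g, and the new u has no pole in w.\<close>

lemma shift_normal_form_UW:
  assumes d: "norm (z - z0) \<le> 1" and w: "norm w < 1"
  shows "shift_point (z - z0) (normal_form \<alpha> z (UW \<sigma>, (u, w))) =
    normal_form \<alpha> z0 (UW \<sigma>, shift_uw \<alpha> \<sigma> (z - z0) (u, w))"
proof (cases "w = 0")
  case True
  then show ?thesis
    by (simp add: normal_form_UW shift_point_def shift_uw_def Let_def)
next
  case False
  define d where "d = z - z0"
  define g where "g = 1 + d * w^2 / 4"
  define e where "e = pm_val \<sigma>"
  define c where "c = 1/2 + e * \<alpha>"
  define k where "k = d / 4"
  define y where "y = inverse w"
  have g0: "g \<noteq> 0"
    unfolding g_def d_def using d w by (rule shift_factor_nonzero)
  have yw: "y * w = 1" using False by (simp add: y_def)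
  have gk: "g = 1 + k * w^2" by (simp add: g_def k_def)
  have "norm y \<ge> 1"
    using w False by (simp add: y_def norm_inverse one_le_inverse)
  then have "shift_amount y = 1 / (4 * y)" by (rule shift_amount_large)
  then have sh: "y + d * shift_amount y = g * y"
    using False by (simp add: y_def g_def field_simps power2_eq_square)
  define x where "x = u * w^2 - e * y^2 - e * (z / 2) - c * w"
  have nf: "normal_form \<alpha> z (UW \<sigma>, (u, w)) = (XY, (x, y))"
    using False by (simp add: normal_form_UW uw_to_xy_def x_def y_def e_def c_def)
  have gy: "g * y \<noteq> 0" using g0 False by (simp add: y_def)
  have z: "z / 2 = z0 / 2 + 2 * k" by (simp add: k_def d_def field_simps)
  have "xy_to_uw \<alpha> \<sigma> z0 (x, g * y) = shift_uw \<alpha> \<sigma> d (u, w)"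
  proof -
    have "(u * w^2 - e * y^2 - e * (h + 2 * k) - c * w) * (g * y)^2 + e * (g * y)^4 + e * h * (g * y)^2 + c * (g * y)
        = g^2 * (u + e * k^2) - c * k * w * g" for h
      using yw gk by algebra
    from this[of "z0 / 2"]
    have "coord_u \<alpha> \<sigma> z0 (x, g * y) = g^2 * (u + e * k^2) - c * k * w * g"
      unfolding x_def z by (simp add: coord_u_def e_def c_def)
    moreover have "coord_w (x, g * y) = w / g"
      using g0 by (simp add: coord_w_def y_def divide_inverse mult.commute)
    moreover have "shift_uw \<alpha> \<sigma> d (u, w) = (g^2 * (u + e * d^2 / 16) - c * d * w / 4 * g, w / g)"
      by (simp add: shift_uw_def Let_def g_def e_def c_def)
    ultimately show ?thesis
      by (simp add: xy_to_uw_def k_def power_divide)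
  qed
  then have "uw_to_xy \<alpha> \<sigma> z0 (shift_uw \<alpha> \<sigma> d (u, w)) = (x, g * y)"
    using uw_to_xy_xy_to_uw[of "(x, g * y)" \<alpha> \<sigma> z0] gy by simp
  moreover have "snd (shift_uw \<alpha> \<sigma> d (u, w)) \<noteq> 0"
    using g0 False by (simp add: shift_uw_def Let_def g_def)
  ultimately show ?thesis
    unfolding nf d_def[symmetric] by (simp add: normal_form_UW shift_point_def sh)
qed

text \<open>The inverse of \<open>w \<mapsto> w / (1 + d w\<^sup>2 / 4)\<close> near \<open>0\<close>.\<close>

definition unshift_w :: "complex \<Rightarrow> complex \<Rightarrow> complex"
  where "unshift_w d w = 2 * w / (1 + csqrt (1 - d * w^2))"

lemma norm_le_one_plus_csqrt: "1 \<le> norm (1 + csqrt v)"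
proof -
  have "1 \<le> Re (1 + csqrt v)"
    using Re_csqrt[of v] by simp
  also have "\<dots> \<le> norm (1 + csqrt v)" by (rule complex_Re_le_cmod)
  finally show ?thesis .
qed

lemma norm_unshift_w:
  assumes "norm w < 1/2"
  shows "norm (unshift_w d w) < 1"
proof -
  have "norm (unshift_w d w) \<le> 2 * norm w / 1"
    unfolding unshift_w_def norm_divide norm_mult norm_numeral
    using norm_le_one_plus_csqrt[of "1 - d * w^2"] by (intro divide_left_mono) auto
  then show ?thesis using assms by simp
qed

text \<open>\<open>unshift_w\<close> is a root o of d w o^2 / 4 - o + w = 0, written with the square
  root in the denominator so that it stays defined for d w = 0.\<close>

lemma unshift_w_equation: "w * (1 + d * unshift_w d w ^ 2 / 4) = unshift_w d w"
proof -
  define s where "s = csqrt (1 - d * w^2)"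
  have s0: "1 + s \<noteq> 0"
    using norm_le_one_plus_csqrt[of "1 - d * w^2"] unfolding s_def by auto
  have s2: "s^2 = 1 - d * w^2" by (simp add: s_def)
  have o: "unshift_w d w * (1 + s) = 2 * w"
    using s0 by (simp add: unshift_w_def s_def[symmetric])
  have "(w * (4 + d * unshift_w d w ^ 2) - 4 * unshift_w d w) * (1 + s)^2 = 0"
    using o s2 by algebra
  then have "w * (4 + d * unshift_w d w ^ 2) - 4 * unshift_w d w = 0 \<or> (1 + s)^2 = 0"
    by (simp only: mult_eq_0_iff)
  moreover have "(1 + s)^2 \<noteq> 0" using s0 by simp
  ultimately have "w * (4 + d * unshift_w d w ^ 2) - 4 * unshift_w d w = 0" by blast
  then show ?thesis
    by (simp add: field_simps)
qed

definition unshift_uw :: "complex \<Rightarrow> pm \<Rightarrow> complex \<Rightarrow> complex \<times> complex \<Rightarrow> complex \<times> complex"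
  where "unshift_uw \<alpha> \<sigma> d p = (let o' = unshift_w d (snd p); g = 1 + d * o'^2 / 4 in
    ((fst p + (1/2 + pm_val \<sigma> * \<alpha>) * d * o' / 4 * g) / g^2 - pm_val \<sigma> * d^2 / 16, o'))"

lemma shift_uw_unshift_uw:
  assumes "norm d \<le> 1" "norm (snd p) < 1/2"
  shows "shift_uw \<alpha> \<sigma> d (unshift_uw \<alpha> \<sigma> d p) = p"
proof -
  define o' where "o' = unshift_w d (snd p)"
  define g where "g = 1 + d * o'^2 / 4"
  have g0: "g \<noteq> 0"
    unfolding g_def o'_def by (rule shift_factor_nonzero[OF assms(1) norm_unshift_w[OF assms(2)]])
  have "o' / g = snd p"
    using unshift_w_equation[of "snd p" d] g0 by (simp add: o'_def[symmetric] g_def[symmetric] field_simps)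
  then show ?thesis
    using g0 by (simp add: shift_uw_def unshift_uw_def Let_def o'_def[symmetric] g_def[symmetric] prod_eq_iff)
qed

text \<open>The forward formula is applied to the preimage and then inverted; |w| < 1/2 guarantees
  that the preimage has |w| < 1.\<close>

lemma unshift_normal_form_UW:
  assumes d: "norm (z - z0) \<le> 1" and w: "norm (snd p) < 1/2"
  shows "unshift_point (z - z0) (normal_form \<alpha> z0 (UW \<sigma>, p)) =
    normal_form \<alpha> z (UW \<sigma>, unshift_uw \<alpha> \<sigma> (z - z0) p)"
proof -
  define P where "P = unshift_uw \<alpha> \<sigma> (z - z0) p"
  have "norm (snd P) < 1"
    using norm_unshift_w[OF w] by (simp add: P_def unshift_uw_def Let_def)
  then have "shift_point (z - z0) (normal_form \<alpha> z (UW \<sigma>, P)) = normal_form \<alpha> z0 (UW \<sigma>, p)"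
    using shift_normal_form_UW[OF d, of "snd P" \<alpha> \<sigma> "fst P"] shift_uw_unshift_uw[OF d w, of \<alpha> \<sigma>]
    by (simp add: P_def)
  then show ?thesis
    using unshift_shift_point[OF d, of "normal_form \<alpha> z (UW \<sigma>, P)"] by (simp add: P_def)
qed

section \<open>The trivialising homeomorphism\<close>

definition class_point :: "complex \<Rightarrow> complex \<Rightarrow> chart_point set \<Rightarrow> chart_point"
  where "class_point \<alpha> z e = (SOME q. normal_point q \<and> e = PII_chart \<alpha> z (fst q) (snd q))"

lemma class_point_chart: "class_point \<alpha> z (PII_chart \<alpha> z i p) = normal_form \<alpha> z (i, p)"
  unfolding class_point_def
proof (rule some_equality)
  show "normal_point (normal_form \<alpha> z (i, p)) \<and>
      PII_chart \<alpha> z i p = PII_chart \<alpha> z (fst (normal_form \<alpha> z (i, p))) (snd (normal_form \<alpha> z (i, p)))"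
    using normal_form_normal_point[OF normal_point_normal_form] normal_point_normal_form
    by (simp add: PII_chart_eq_iff)
  fix q assume q: "normal_point q \<and> PII_chart \<alpha> z i p = PII_chart \<alpha> z (fst q) (snd q)"
  then show "q = normal_form \<alpha> z (i, p)"
    using normal_form_normal_point[of q \<alpha> z] by (simp add: PII_chart_eq_iff)
qed

lemma PII_chart_normal_form:
  "PII_chart \<alpha> z (fst (normal_form \<alpha> z q)) (snd (normal_form \<alpha> z q)) = PII_chart \<alpha> z (fst q) (snd q)"
  by (simp add: PII_chart_eq_iff normal_form_normal_point[OF normal_point_normal_form])

lemma continuous_on_uw_to_xy:
  assumes "continuous_on S f" "continuous_on S g" "\<And>P. P \<in> S \<Longrightarrow> snd (g P) \<noteq> 0"
  shows "continuous_on S (\<lambda>P. uw_to_xy \<alpha> \<sigma> (f P) (g P))"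
  unfolding uw_to_xy_def using assms by (intro continuous_intros) auto

text \<open>Over the unit disc about z0 the shift by z - z0 is invertible. The product of the fibre
  with the disc is itself read as a gluing, that of the constant family, so both directions are maps
  between glued spaces and can be checked in charts.\<close>

theorem fiber_bundle_PII:
  "fiber_bundle (glued_topology (total_chart (PII_chart \<alpha>))) (\<lambda>z. glued_topology (PII_chart \<alpha> z))"
  unfolding fiber_bundle_def
proof (intro conjI allI)
  let ?T = "glued_topology (total_chart (PII_chart \<alpha>))"
  show "topspace ?T = {(e, z). e \<in> topspace (glued_topology (PII_chart \<alpha> z))}"
  proof (intro set_eqI iffI)
    fix q assume "q \<in> topspace ?T"
    then obtain i P where "q = total_chart (PII_chart \<alpha>) i P"
      by (auto simp: topspace_glued_topology)
    then show "q \<in> {(e, z). e \<in> topspace (glued_topology (PII_chart \<alpha> z))}"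
      by (auto simp: topspace_glued_topology total_chart_def)
  next
    fix q assume "q \<in> {(e, z). e \<in> topspace (glued_topology (PII_chart \<alpha> z))}"
    then obtain i p where "fst q = PII_chart \<alpha> (snd q) i p"
      by (auto simp: topspace_glued_topology)
    then have "q = total_chart (PII_chart \<alpha>) i (p, snd q)"
      unfolding total_chart_def fst_conv snd_conv by (metis prod.collapse)
    then show "q \<in> topspace ?T"
      unfolding topspace_glued_topology by blast
  qed
  have snd_vimage: "open (total_chart (PII_chart \<alpha>) i -` {q. snd q \<in> V})" if "open V" for i V
  proof -
    have "total_chart (PII_chart \<alpha>) i -` {q. snd q \<in> V} = snd -` V"
      by (auto simp: total_chart_def)
    then show ?thesis using open_vimage_snd[OF that] by simp
  qed
  show "continuous_map ?T euclidean snd"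
    unfolding continuous_map_def
  proof (intro conjI allI impI)
    fix V :: "complex set" assume "openin euclidean V"
    moreover have "total_chart (PII_chart \<alpha>) i -` {q \<in> topspace ?T. snd q \<in> V} = total_chart (PII_chart \<alpha>) i -` {q. snd q \<in> V}" for i
      by (auto simp: topspace_glued_topology)
    ultimately show "openin ?T {q \<in> topspace ?T. snd q \<in> V}"
      unfolding openin_glued_topology using snd_vimage by (auto simp: topspace_glued_topology)
  qed simp
  fix z0 :: complex
  let ?D = "ball z0 1"
  let ?E = "glued_topology (PII_chart \<alpha> z0)"
  let ?C = "total_chart (\<lambda>_. PII_chart \<alpha> z0)"
  define \<Theta> where "\<Theta> q = (let r = shift_point (snd q - z0) (class_point \<alpha> (snd q) (fst q)) in
      (PII_chart \<alpha> z0 (fst r) (snd r), snd q))" for q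
  define \<Xi> where "\<Xi> q = (let r = unshift_point (snd q - z0) (class_point \<alpha> z0 (fst q)) in
      (PII_chart \<alpha> (snd q) (fst r) (snd r), snd q))" for q
  have dD: "norm (z - z0) \<le> 1" if "z \<in> ?D" for z
    using that by (simp add: dist_norm norm_minus_commute)
  have \<Theta>: "\<Theta> (total_chart (PII_chart \<alpha>) i (p, z)) = ?C j (p', z)"
    if "shift_point (z - z0) (normal_form \<alpha> z (i, p)) = normal_form \<alpha> z0 (j, p')" for i p z j p'
    using that PII_chart_normal_form[of \<alpha> z0 "(j, p')"]
    by (simp add: \<Theta>_def total_chart_def class_point_chart Let_def)
  have \<Xi>: "\<Xi> (?C i (p, z)) = total_chart (PII_chart \<alpha>) j (p', z)"
    if "unshift_point (z - z0) (normal_form \<alpha> z0 (i, p)) = normal_form \<alpha> z (j, p')" for i p z j p'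
    using that PII_chart_normal_form[of \<alpha> z "(j, p')"]
    by (simp add: \<Xi>_def total_chart_def class_point_chart Let_def)
  have prod: "prod_topology ?E (top_of_set ?D) = subtopology (glued_topology ?C) {q. snd q \<in> ?D}"
  proof -
    have "glued_topology ?C = prod_topology ?E euclidean"
      by (rule glued_const_family) (rule holomorphic_gluing.openin_image[OF holomorphic_gluing_fiber])
    moreover have "prod_topology ?E (top_of_set ?D) = subtopology (prod_topology ?E euclidean) (topspace ?E \<times> ?D)"
      by (rule prod_topology_subtopology)
    moreover have "\<dots> = subtopology (prod_topology ?E euclidean) {q. snd q \<in> ?D}"
    proof -
      have "topspace ?E \<times> ?D = topspace (prod_topology ?E euclidean) \<inter> {q. snd q \<in> ?D}"
        by auto
      then show ?thesis by (simp only: subtopology_restrict)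
    qed
    ultimately show ?thesis by simp
  qed
  have sC: "snd (?C i P) = snd P" "snd (total_chart (PII_chart \<alpha>) i P) = snd P" for i P
    by (simp_all add: total_chart_def)
  have cont1: "continuous_map (subtopology ?T {q. snd q \<in> ?D}) (subtopology (glued_topology ?C) {q. snd q \<in> ?D}) \<Theta>"
  proof (rule continuous_map_glued)
    show "open (total_chart (PII_chart \<alpha>) i -` {q. snd q \<in> ?D})" for i
      by (rule snd_vimage) simp
    show "\<Theta> q \<in> {q. snd q \<in> ?D}" if "q \<in> {q. snd q \<in> ?D}" for q
      using that by (simp add: \<Theta>_def Let_def)
    fix i P assume "total_chart (PII_chart \<alpha>) i P \<in> {q. snd q \<in> ?D}"
    then have PD: "snd P \<in> ?D" by (simp add: sC)
    define H where "H P = ((fst (fst P), snd (fst P) + (snd P - z0) * shift_amount (snd (fst P))), snd P)"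
      for P :: "(complex \<times> complex) \<times> complex"
    have H: "continuous_on S H" for S
      unfolding H_def
      by (intro continuous_intros continuous_on_compose2[OF continuous_on_shift_amount[of UNIV]]) auto
    show "\<exists>N j h. open N \<and> P \<in> N \<and> continuous_on N h \<and>
        (\<forall>Q\<in>N. \<Theta> (total_chart (PII_chart \<alpha>) i Q) = ?C j (h Q))"
    proof (cases i)
      case XY
      have "\<Theta> (total_chart (PII_chart \<alpha>) i Q) = ?C XY (H Q)" for Q
        using \<Theta>[of "snd Q" i "fst Q" XY "fst (H Q)"] XY by (simp add: H_def shift_point_def)
      then show ?thesis
        by (intro exI[of _ UNIV] exI[of _ XY] exI[of _ H]) (simp add: H)
    next
      case (UW \<sigma>)
      \<comment> \<open>Away from w = 0 the point is moved to the (x, y)-plane, where the shift has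
        one formula; near w = 0 the formula at infinity takes over.\<close>
      show ?thesis
      proof (cases "snd (fst P) = 0")
        case False
        let ?N = "{P :: (complex \<times> complex) \<times> complex. snd (fst P) \<noteq> 0}"
        let ?h = "\<lambda>Q. H (uw_to_xy \<alpha> \<sigma> (snd Q) (fst Q), snd Q)"
        have "open ?N" by (intro open_Collect_neq continuous_intros)
        moreover have "continuous_on ?N ?h"
          by (intro continuous_on_compose2[OF H[of UNIV]] continuous_intros continuous_on_uw_to_xy) auto
        moreover have "\<Theta> (total_chart (PII_chart \<alpha>) i Q) = ?C XY (?h Q)" if "Q \<in> ?N" for Q
          using \<Theta>[of "snd Q" i "fst Q" XY "fst (?h Q)"] UW that
          by (simp add: H_def shift_point_def normal_form_UW)
        ultimately show ?thesis
          using False by (intro exI[of _ ?N] exI[of _ XY] exI[of _ ?h]) simp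
      next
        case True
        let ?N = "{P :: (complex \<times> complex) \<times> complex. norm (snd (fst P)) < 1} \<inter> snd -` ?D"
        let ?h = "\<lambda>Q. (shift_uw \<alpha> \<sigma> (snd Q - z0) (fst Q), snd Q)"
        have "open ?N"
          by (intro open_Int open_vimage_snd open_ball open_Collect_less continuous_intros)
        moreover have "continuous_on ?N ?h"
          unfolding shift_uw_def Let_def
          by (intro continuous_intros ballI shift_factor_nonzero dD) auto
        moreover have "\<Theta> (total_chart (PII_chart \<alpha>) i Q) = ?C (UW \<sigma>) (?h Q)" if "Q \<in> ?N" for Q
          using \<Theta>[of "snd Q" i "fst Q" "UW \<sigma>" "shift_uw \<alpha> \<sigma> (snd Q - z0) (fst Q)"] UW that
            shift_normal_form_UW[OF dD, of "snd Q" "snd (fst Q)" \<alpha> \<sigma> "fst (fst Q)"]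
          by simp
        ultimately show ?thesis
          using True PD by (intro exI[of _ ?N] exI[of _ "UW \<sigma>"] exI[of _ ?h]) simp
      qed
    qed
  qed
  have cont2: "continuous_map (subtopology (glued_topology ?C) {q. snd q \<in> ?D}) (subtopology ?T {q. snd q \<in> ?D}) \<Xi>"
  proof (rule continuous_map_glued)
    show "open (?C i -` {q. snd q \<in> ?D})" for i
    proof -
      have "?C i -` {q. snd q \<in> ?D} = snd -` ?D" by (auto simp: sC)
      then show ?thesis using open_vimage_snd[OF open_ball] by simp
    qed
    show "\<Xi> q \<in> {q. snd q \<in> ?D}" if "q \<in> {q. snd q \<in> ?D}" for q
      using that by (simp add: \<Xi>_def Let_def)
    fix i P assume "?C i P \<in> {q. snd q \<in> ?D}"
    then have PD: "snd P \<in> ?D" by (simp add: sC)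
    define H where "H P = ((fst (fst P), unshift_amount (snd P - z0) (snd (fst P))), snd P)"
      for P :: "(complex \<times> complex) \<times> complex"
    have H: "continuous_on (snd -` ?D) H"
      unfolding H_def by (intro continuous_intros continuous_on_unshift) (auto intro: dD)
    have oD: "open (snd -` ?D :: ((complex \<times> complex) \<times> complex) set)"
      by (intro open_vimage_snd open_ball)
    show "\<exists>N j h. open N \<and> P \<in> N \<and> continuous_on N h \<and>
        (\<forall>Q\<in>N. \<Xi> (?C i Q) = total_chart (PII_chart \<alpha>) j (h Q))"
    proof (cases i)
      case XY
      have "\<Xi> (?C i Q) = total_chart (PII_chart \<alpha>) XY (H Q)" for Q
        using \<Xi>[of "snd Q" i "fst Q" XY "fst (H Q)"] XY by (simp add: H_def unshift_point_def)
      then show ?thesis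
        using PD by (intro exI[of _ "snd -` ?D"] exI[of _ XY] exI[of _ H]) (simp add: H oD)
    next
      case (UW \<sigma>)
      show ?thesis
      proof (cases "snd (fst P) = 0")
        case False
        let ?N = "{P :: (complex \<times> complex) \<times> complex. snd (fst P) \<noteq> 0} \<inter> snd -` ?D"
        let ?h = "\<lambda>Q. H (uw_to_xy \<alpha> \<sigma> z0 (fst Q), snd Q)"
        have "open ?N" by (intro open_Int oD open_Collect_neq continuous_intros)
        moreover have "continuous_on ?N ?h"
          by (intro continuous_on_compose2[OF H] continuous_intros continuous_on_uw_to_xy) auto
        moreover have "\<Xi> (?C i Q) = total_chart (PII_chart \<alpha>) XY (?h Q)" if "Q \<in> ?N" for Q
          using \<Xi>[of "snd Q" i "fst Q" XY "fst (?h Q)"] UW that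
          by (simp add: H_def unshift_point_def normal_form_UW)
        ultimately show ?thesis
          using False PD by (intro exI[of _ ?N] exI[of _ XY] exI[of _ ?h]) simp
      next
        case True
        let ?N = "{P :: (complex \<times> complex) \<times> complex. norm (snd (fst P)) < 1/2} \<inter> snd -` ?D"
        let ?h = "\<lambda>Q. (unshift_uw \<alpha> \<sigma> (snd Q - z0) (fst Q), snd Q)"
        have "open ?N"
          by (intro open_Int oD open_Collect_less continuous_intros)
        moreover have "continuous_on ?N ?h"
        proof -
          have w: "continuous_on ?N (\<lambda>Q. unshift_w (snd Q - z0) (snd (fst Q)))"
            unfolding unshift_w_def
          proof (intro continuous_intros ballI)
            show "continuous_on ?N (\<lambda>Q. csqrt (1 - (snd Q - z0) * snd (fst Q) ^ 2))"
            proof (rule continuous_on_compose2[OF continuous_on_csqrt])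
              \<comment> \<open>With |d| \<le> 1 and |w| < 1/2 the radicand has positive real part
                and stays off the cut of \<open>csqrt\<close>.\<close>
              show "(\<lambda>Q. 1 - (snd Q - z0) * snd (fst Q) ^ 2) ` ?N \<subseteq> - \<real>\<^sub>\<le>\<^sub>0"
              proof
                fix v assume "v \<in> (\<lambda>Q. 1 - (snd Q - z0) * snd (fst Q) ^ 2) ` ?N"
                then obtain Q where Q: "Q \<in> ?N" "v = 1 - (snd Q - z0) * snd (fst Q) ^ 2" by blast
                have "norm ((snd Q - z0) * snd (fst Q) ^ 2) \<le> 1 * (1/2)^2"
                  unfolding norm_mult norm_power using Q(1) dD[of "snd Q"] by (intro mult_mono power_mono) auto
                then have "Re ((snd Q - z0) * snd (fst Q) ^ 2) < 1"
                  using complex_Re_le_cmod[of "(snd Q - z0) * snd (fst Q) ^ 2"] by (simp add: power2_eq_square)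
                then have "Re v > 0" using Q(2) by simp
                then show "v \<in> - \<real>\<^sub>\<le>\<^sub>0" by (auto simp: complex_nonpos_Reals_iff)
              qed
            qed (intro continuous_intros)
            fix Q
            show "1 + csqrt (1 - (snd Q - z0) * snd (fst Q) ^ 2) \<noteq> 0"
              using norm_le_one_plus_csqrt[of "1 - (snd Q - z0) * snd (fst Q) ^ 2"] by auto
          qed
          have nz: "1 + (snd Q - z0) * unshift_w (snd Q - z0) (snd (fst Q)) ^ 2 / 4 \<noteq> 0" if "Q \<in> ?N" for Q
            using that by (intro shift_factor_nonzero norm_unshift_w dD) auto
          show ?thesis
            unfolding unshift_uw_def Let_def
            by (intro continuous_intros w ballI) (use nz in auto)
        qed
        moreover have "\<Xi> (?C i Q) = total_chart (PII_chart \<alpha>) (UW \<sigma>) (?h Q)" if "Q \<in> ?N" for Q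
          using \<Xi>[of "snd Q" i "fst Q" "UW \<sigma>" "unshift_uw \<alpha> \<sigma> (snd Q - z0) (fst Q)"] UW that
            unshift_normal_form_UW[OF dD, of "snd Q" "fst Q" \<alpha> \<sigma>]
          by simp
        ultimately show ?thesis
          using True PD by (intro exI[of _ ?N] exI[of _ "UW \<sigma>"] exI[of _ ?h]) simp
      qed
    qed
  qed
  have inv1: "\<Xi> (\<Theta> q) = q" if qt: "q \<in> topspace (subtopology ?T {q. snd q \<in> ?D})" for q
  proof -
    obtain i P where q: "q = total_chart (PII_chart \<alpha>) i P"
      using qt by (auto simp: topspace_glued_topology)
    have PD: "snd P \<in> ?D" using qt unfolding q by (simp add: sC)
    define r where "r = shift_point (snd P - z0) (normal_form \<alpha> (snd P) (i, fst P))"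
    have nr: "normal_point r" unfolding r_def normal_point_shift by (rule normal_point_normal_form)
    have "\<Theta> q = ?C (fst r) (snd r, snd P)"
      unfolding q using \<Theta>[of "snd P" i "fst P" "fst r" "snd r"] normal_form_normal_point[OF nr]
      by (simp add: r_def)
    also have "\<Xi> \<dots> = total_chart (PII_chart \<alpha>) i (fst P, snd P)"
      by (rule \<Xi>) (simp only: prod.collapse normal_form_normal_point[OF nr],
          simp only: r_def unshift_shift_point[OF dD[OF PD]])
    finally show ?thesis by (simp add: q)
  qed
  have inv2: "\<Theta> (\<Xi> q) = q" if qt: "q \<in> topspace (subtopology (glued_topology ?C) {q. snd q \<in> ?D})" for q
  proof -
    obtain i P where q: "q = ?C i P"
      using qt by (auto simp: topspace_glued_topology)
    have PD: "snd P \<in> ?D" using qt unfolding q by (simp add: sC)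
    define r where "r = unshift_point (snd P - z0) (normal_form \<alpha> z0 (i, fst P))"
    have nr: "normal_point r" unfolding r_def normal_point_unshift by (rule normal_point_normal_form)
    have "\<Xi> q = total_chart (PII_chart \<alpha>) (fst r) (snd r, snd P)"
      unfolding q using \<Xi>[of "snd P" i "fst P" "fst r" "snd r"] normal_form_normal_point[OF nr]
      by (simp add: r_def)
    also have "\<Theta> \<dots> = ?C i (fst P, snd P)"
      by (rule \<Theta>) (simp only: prod.collapse normal_form_normal_point[OF nr],
          simp only: r_def shift_unshift_point[OF dD[OF PD]])
    finally show ?thesis by (simp add: q)
  qed
  show "\<exists>D \<Theta>. open D \<and> z0 \<in> D \<and>
      homeomorphic_map (subtopology ?T {q. snd q \<in> D}) (prod_topology ?E (top_of_set D)) \<Theta> \<and>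
      (\<forall>q\<in>topspace ?T. snd q \<in> D \<longrightarrow> snd (\<Theta> q) = snd q)"
  proof (intro exI conjI)
    show "homeomorphic_map (subtopology ?T {q. snd q \<in> ?D}) (prod_topology ?E (top_of_set ?D)) \<Theta>"
      unfolding prod homeomorphic_map_maps homeomorphic_maps_def
      using cont1 cont2 inv1 inv2 by (intro exI[of _ \<Xi>] conjI ballI)
    show "\<forall>q\<in>topspace ?T. snd q \<in> ?D \<longrightarrow> snd (\<Theta> q) = snd q"
      by (simp add: \<Theta>_def Let_def)
  qed simp_all
qed

theorem theorem4p3:
  fixes \<alpha> :: complex
  shows "space_of_initial_conditions (PII_x \<alpha>) PII_y XY (PII_chart \<alpha>) \<and>
    ((\<forall>\<sigma> z x y v v'. y \<noteq> 0 \<longrightarrow>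
        wedge_d snd fst (x, y) v v' = wedge_d (coord_u \<alpha> \<sigma> z) coord_w (x, y) v v') \<and>
     polynomial_hamiltonian_xy UNIV (PII_x \<alpha>) PII_y \<and>
     (\<forall>\<sigma>. polynomial_hamiltonian_uw \<alpha> \<sigma> UNIV (PII_x \<alpha>) PII_y)) \<and>
    (\<forall>D f g. open D \<and> polynomial_hamiltonian_xy D f g \<and>
        (\<forall>\<sigma>. polynomial_hamiltonian_uw \<alpha> \<sigma> D f g) \<longrightarrow>
        (\<forall>z\<in>D. \<forall>x y. f x y z = PII_x \<alpha> x y z \<and> g x y z = PII_y x y z))"
proof (intro conjI allI impI ballI)
  show "space_of_initial_conditions (PII_x \<alpha>) PII_y XY (PII_chart \<alpha>)"
    unfolding space_of_initial_conditions_def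
    by (intro conjI allI impI holomorphic_gluing.complex_manifold[OF holomorphic_gluing_fiber]
        holomorphic_gluing.complex_manifold[OF holomorphic_gluing_total] fiber_bundle_PII)
      (elim conjE, rule painleve_property)
  show "wedge_d snd fst (x, y) v v' = wedge_d (coord_u \<alpha> \<sigma> z) coord_w (x, y) v v'"
    if "y \<noteq> 0" for \<sigma> z x y v v'
    using that by (rule symplectic)
  show "polynomial_hamiltonian_xy UNIV (PII_x \<alpha>) PII_y"
    by (rule PII_hamiltonian_xy)
  show "polynomial_hamiltonian_uw \<alpha> \<sigma> UNIV (PII_x \<alpha>) PII_y" for \<sigma>
    by (rule PII_hamiltonian_uw)
  fix D f g z x y
  assume h: "open D \<and> polynomial_hamiltonian_xy D f g \<and> (\<forall>\<sigma>. polynomial_hamiltonian_uw \<alpha> \<sigma> D f g)"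
    and z: "z \<in> D"
  have "f x y z = PII_x \<alpha> x y z \<and> g x y z = PII_y x y z"
    by (rule PII_rigidity[OF _ _ z]) (use h in simp_all)
  then show "f x y z = PII_x \<alpha> x y z" "g x y z = PII_y x y z"
    by simp_all
qed

end
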